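(* Let $U(\phi)=\frac18(1-\phi^2)^2$. A solution $\boldsymbol\phi=(\phi,\partial_t\phi)$ of $\partial_t^2\phi-\partial_x^2\phi+U'(\phi)=0$ satisfies $\lim_{t\to\infty}\|\partial_t\phi(t)\|_{L^2}^2=0$ if and only if $\boldsymbol\phi$ or $-\boldsymbol\phi$ is a kink cluster.
   Context: The equation, posed for $(t,x)\in\mathbb R\times\mathbb R$ with real-valued $\phi$, is written as the first-order system $\partial_t\phi=\dot\phi$, $\partial_t\dot\phi=\partial_x^2\phi-U'(\phi)$ for $\boldsymbol\phi=(\phi,\dot\phi)$. Energies: $E_p(\phi_0)=\int_{\mathbb R}(\tfrac12(\partial_x\phi_0)^2+U(\phi_0))dx$, $E(\boldsymbol\phi_0)=E_p(\phi_0)+\int_{\mathbb R}\tfrac12\dot\phi_0^2dx$. For $\iota_-,\iota_+\in\{-1,1\}$, $\mathcal E_{\iota_-,\iota_+}$ is the set of $\boldsymbol\phi_0=(\phi_0,\dot\phi_0)$ with $E(\boldsymbol\phi_0)<\infty$, $\lim_{x\to-\infty}\phi_0=\iota_-$, $\lim_{x\to+\infty}\phi_0=\iota_+$; it is an affine space parallel to $\mathcal E=H^1(\mathbb R)\times L^2(\mathbb R)$. A solution is a finite-energy solution: $\boldsymbol\phi\in C(\mathbb R;\mathcal E_{\iota_-,\iota_+})$ for some $\iota_\pm$, satisfying the system in the sense of distributions (for each initial data there is a unique global solution and $E$ is conserved; write $E(\boldsymbol\phi)$). $H:\mathbb R\to(-1,1)$ is the increasing odd function $H=G^{-1}$, $G(\psi)=\int_0^\psi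 dy/\sqrt{2U(y)}$; it satisfies $\partial_x^2H=U'(H)$. For $n\in\{0,1,\ldots\}$, a solution $\boldsymbol\phi$ is a kink $n$-cluster if $E(\boldsymbol\phi)\le nE_p(H)$ and there exist real-valued functions $x_0(t)\le\ldots\le x_n(t)$ such that $\lim_{t\to\infty}\phi(t,x_k(t))=(-1)^k$ for all $k\in\{0,\ldots,n\}$. A solution is a kink cluster if it is a kink $n$-cluster for some $n\in\{0,1,\ldots\}$. *)

theory Defs
  imports "HOL-Analysis.Analysis"
begin

section \<open>Test functions and weak derivatives\<close>

text \<open>On a finite-dimensional domain \<open>Ck k f\<close> says that all partial derivatives of order at most
  \<open>k\<close> exist and are continuous.\<close>

primrec Ck :: "nat \<Rightarrow> ('a::euclidean_space \<Rightarrow> real) \<Rightarrow> bool" where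
  "Ck 0 f \<longleftrightarrow> continuous_on UNIV f"
| "Ck (Suc k) f \<longleftrightarrow>
     f differentiable_on UNIV \<and> (\<forall>v. Ck k (\<lambda>x. frechet_derivative f (at x) v))"

definition test_function :: "('a::euclidean_space \<Rightarrow> real) \<Rightarrow> bool" where
  "test_function f \<longleftrightarrow> (\<forall>k. Ck k f) \<and> compact (closure {x. f x \<noteq> 0})"

definition locally_integrable :: "(real \<Rightarrow> real) \<Rightarrow> bool" where
  "locally_integrable f \<longleftrightarrow> (\<forall>a b. set_integrable lborel {a..b} f)"

definition has_weak_derivative :: "(real \<Rightarrow> real) \<Rightarrow> (real \<Rightarrow> real) \<Rightarrow> bool" where
  "has_weak_derivative f g \<longleftrightarrow>
     locally_integrable f \<and> locally_integrable g \<and>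
     (\<forall>\<psi>. test_function \<psi> \<longrightarrow>
        (LINT x|lborel. f x * deriv \<psi> x) = - (LINT x|lborel. g x * \<psi> x))"

text \<open>The weak derivative is unique up to null sets; below it only occurs under integrals, so the
  choice of representative is immaterial.\<close>

definition weak_deriv :: "(real \<Rightarrow> real) \<Rightarrow> real \<Rightarrow> real" where
  "weak_deriv f = (SOME g. has_weak_derivative f g)"

section \<open>Energy and phase space\<close>

definition U :: "real \<Rightarrow> real" where
  "U \<phi> = 1/8 * (1 - \<phi>\<^sup>2)\<^sup>2"

text \<open>A state \<open>(\<phi>\<^sub>0, \<phi>'\<^sub>0)\<close> is the pair of the field and its velocity. Energies and squared norms
  take values in \<open>ennreal\<close>, so that they are meaningful without integrability assumptions.\<close>

type_synonym state = "(real \<Rightarrow> real) \<times> (real \<Rightarrow> real)"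

definition potential_energy :: "(real \<Rightarrow> real) \<Rightarrow> ennreal" where
  "potential_energy \<phi> = (\<integral>\<^sup>+x. ennreal (1/2 * (weak_deriv \<phi> x)\<^sup>2 + U (\<phi> x)) \<partial>lborel)"

definition energy :: "state \<Rightarrow> ennreal" where
  "energy s = potential_energy (fst s) + (\<integral>\<^sup>+x. ennreal (1/2 * (snd s x)\<^sup>2) \<partial>lborel)"

text \<open>A field of finite energy is in \<open>H\<^sup>1\<close> locally; it is represented by its continuous
  representative, so that its limits and point values make sense.\<close>

definition finite_energy_states :: "real \<Rightarrow> real \<Rightarrow> state set" where
  "finite_energy_states l r =
     {(\<phi>, \<phi>'). continuous_on UNIV \<phi> \<and> (\<exists>g. has_weak_derivative \<phi> g) \<and>
        \<phi>' \<in> borel_measurable lborel \<and> energy (\<phi>, \<phi>') < \<infinity> \<and>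
        (\<phi> \<longlongrightarrow> l) at_bot \<and> (\<phi> \<longlongrightarrow> r) at_top}"

definition L2_norm_sq :: "(real \<Rightarrow> real) \<Rightarrow> ennreal" where
  "L2_norm_sq f = (\<integral>\<^sup>+x. ennreal ((f x)\<^sup>2) \<partial>lborel)"

definition H1_L2_norm_sq :: "state \<Rightarrow> ennreal" where
  "H1_L2_norm_sq s =
     L2_norm_sq (fst s) + L2_norm_sq (weak_deriv (fst s)) + L2_norm_sq (snd s)"

section \<open>Finite-energy solutions\<close>

text \<open>Continuity in time for the topology that the affine space inherits from \<open>H\<^sup>1 \<times> L\<^sup>2\<close>.\<close>

definition continuous_in_time :: "(real \<Rightarrow> state) \<Rightarrow> bool" where
  "continuous_in_time \<Phi> \<longleftrightarrow>
     (\<forall>t. ((\<lambda>s. H1_L2_norm_sq (\<Phi> s - \<Phi> t)) \<longlongrightarrow> 0) (at t))"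

text \<open>The system \<open>\<partial>\<^sub>t\<phi> = \<phi>'\<close>, \<open>\<partial>\<^sub>t\<phi>' = \<partial>\<^sub>x\<^sup>2\<phi> - U'(\<phi>)\<close> tested against \<open>\<psi>(t,x)\<close>, where \<open>\<phi>'\<close> is the
  velocity component. The integrals are iterated because each \<open>snd (\<Phi> t)\<close> is determined only up to
  a null set depending on \<open>t\<close>, so that it need not be jointly measurable in \<open>(t,x)\<close>.\<close>

definition solves_in_distributions :: "(real \<Rightarrow> state) \<Rightarrow> bool" where
  "solves_in_distributions \<Phi> \<longleftrightarrow>
     (\<forall>\<psi> :: real \<times> real \<Rightarrow> real. test_function \<psi> \<longrightarrow>
        - (LINT t|lborel. LINT x|lborel. fst (\<Phi> t) x * deriv (\<lambda>s. \<psi> (s, x)) t)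
          = (LINT t|lborel. LINT x|lborel. snd (\<Phi> t) x * \<psi> (t, x)) \<and>
        - (LINT t|lborel. LINT x|lborel. snd (\<Phi> t) x * deriv (\<lambda>s. \<psi> (s, x)) t)
          = (LINT t|lborel. LINT x|lborel.
               fst (\<Phi> t) x * (deriv ^^ 2) (\<lambda>y. \<psi> (t, y)) x
               - deriv U (fst (\<Phi> t) x) * \<psi> (t, x)))"

definition solution :: "(real \<Rightarrow> state) \<Rightarrow> bool" where
  "solution \<Phi> \<longleftrightarrow>
     (\<exists>l\<in>{-1, 1}. \<exists>r\<in>{-1, 1}. \<forall>t. \<Phi> t \<in> finite_energy_states l r) \<and>
     continuous_in_time \<Phi> \<and> solves_in_distributions \<Phi>"

section \<open>Kinks and kink clusters\<close>

definition kink_G :: "real \<Rightarrow> real" where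
  "kink_G \<psi> = (LBINT y=0..ereal \<psi>. 1 / sqrt (2 * U y))"

definition kink :: "real \<Rightarrow> real" where
  "kink = inv_into {-1<..<1} kink_G"

text \<open>The energy of a solution is conserved, so it may be evaluated at time \<open>0\<close>.\<close>

definition kink_n_cluster :: "nat \<Rightarrow> (real \<Rightarrow> state) \<Rightarrow> bool" where
  "kink_n_cluster n \<Phi> \<longleftrightarrow>
     solution \<Phi> \<and> energy (\<Phi> 0) \<le> of_nat n * potential_energy kink \<and>
     (\<exists>x :: nat \<Rightarrow> real \<Rightarrow> real.
        (\<forall>t. \<forall>k<n. x k t \<le> x (Suc k) t) \<and>
        (\<forall>k\<le>n. ((\<lambda>t. fst (\<Phi> t) (x k t)) \<longlongrightarrow> (-1) ^ k) at_top))"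

definition kink_cluster :: "(real \<Rightarrow> state) \<Rightarrow> bool" where
  "kink_cluster \<Phi> \<longleftrightarrow> (\<exists>n. kink_n_cluster n \<Phi>)"

end

theory Submission
  imports Defs
begin

text \<open>
  \<^bold>\<open>Clusters are asymptotically static.\<close> Let \<open>W(y) = y\<^sup>3/3 - y\<close>, so that \<open>|W'| = 2 sqrt (2 U)\<close>. The inequality
  \<open>2ab \<le> a\<^sup>2 + b\<^sup>2\<close> shows that a field which passes from the value \<open>a\<close> to the value \<open>b\<close> has potential
  energy at least \<open>|W(b) - W(a)|/2\<close> on the way (\<open>Bogomolny_bound\<close>). Between the two vacua this is
  \<open>2/3\<close>, which is exactly the energy of the kink (\<open>potential_energy_kink\<close>). A kink \<open>n\<close>-cluster makes
  \<open>n\<close> such transitions while its energy, which is conserved (\<open>energy_conserved\<close>), is at most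
  \<open>n \<cdot> 2/3\<close>. So the kinetic energy tends to \<open>0\<close>.

  \<^bold>\<open>Asymptotically static solutions are clusters.\<close> Suppose that the velocity has norm at most \<open>\<kappa>\<close> on
  \<open>[t, t+1]\<close>, and average the field over this interval. The field moves by at most \<open>\<kappa>\<close> in \<open>L\<^sup>2\<close>, and
  integrating the equation in time turns \<open>\<partial>\<^sub>t\<^sup>2 \<phi>\<close> into a difference of two velocities. Hence the
  average solves \<open>\<phi>'' = U'(\<phi>) + f\<close> with \<open>f\<close> of norm \<open>O(\<kappa>)\<close> (\<open>averaged_profile\<close>). For such a
  profile \<open>\<phi>'\<^sup>2/2 - U(\<phi>)\<close>, whose derivative is \<open>\<phi>' f\<close>, is \<open>O(\<kappa>)\<close> everywhere. Away from the vacua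
  the profile is therefore strictly monotone and crosses from one vacuum to the other at the cost
  \<open>2/3 + o(1)\<close>; near a vacuum, testing the equation with the distance to it shows that the energy
  there is small as well. So a profile with fewer than \<open>n\<close> crossings has energy at most
  \<open>(n - 1) \<cdot> 2/3 + o(1)\<close> (\<open>energy_or_alternates\<close>). The virial identity and conservation of energy
  show that averaging loses no energy in the limit (\<open>gradient_energy_of_average\<close>). If \<open>n\<close> is least
  with \<open>E \<le> n \<cdot> 2/3\<close>, there are thus at least \<open>n\<close> crossings at all late times, and since the average
  is uniformly close to the field, the field has them too.

  \<^bold>\<open>Weak solutions.\<close> All differentiation is reduced to integration. A weak derivative is the same as
  the integrand of a primitive (\<open>weak_derivative_continuous_imp_primitive\<close>). The space of
  square-integrable functions is made into a Banach space type \<open>l2\<close>, and a solution becomes a triple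
  of continuous curves in it: the displacement, the gradient and the velocity. Testing the equation
  with products \<open>a(t) b(x)\<close> gives identities between their time integrals. In particular the time
  averages over \<open>[t, t+h]\<close> satisfy the equation in \<open>L\<^sup>2\<close>; the energy identity is immediate for them
  and passes to the limit \<open>h \<longrightarrow> 0\<close>.
\<close>

section \<open>Smooth test functions\<close>

text \<open>The definition of \<open>Ck\<close> fixes the derivative to be \<open>frechet_derivative\<close>; a freely chosen
  derivative makes the closure properties immediate inductions.\<close>

lemma Ck_Suc_iff:
  "Ck (Suc k) f \<longleftrightarrow>
     (\<exists>f'. (\<forall>x. (f has_derivative f' x) (at x)) \<and> (\<forall>v. Ck k (\<lambda>x. f' x v)))"
proof
  assume "Ck (Suc k) f"
  then have "(\<forall>x. (f has_derivative frechet_derivative f (at x)) (at x)) \<and>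
      (\<forall>v. Ck k (\<lambda>x. frechet_derivative f (at x) v))"
    by (auto simp: differentiable_on_def frechet_derivative_works)
  then show "\<exists>f'. (\<forall>x. (f has_derivative f' x) (at x)) \<and> (\<forall>v. Ck k (\<lambda>x. f' x v))"
    by (intro exI[of _ "\<lambda>x. frechet_derivative f (at x)"])
next
  assume "\<exists>f'. (\<forall>x. (f has_derivative f' x) (at x)) \<and> (\<forall>v. Ck k (\<lambda>x. f' x v))"
  then obtain f' where f': "\<And>x. (f has_derivative f' x) (at x)" "\<And>v. Ck k (\<lambda>x. f' x v)"
    by blast
  have "frechet_derivative f (at x) = f' x" for x
    using frechet_derivative_at[OF f'(1)] by simp
  then show "Ck (Suc k) f"
    using f' by (auto simp: differentiable_on_def differentiable_def)
qed

lemma Ck_imp_continuous: "Ck k f \<Longrightarrow> continuous_on UNIV f"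
  by (cases k) (auto simp: differentiable_imp_continuous_on)

lemma Ck_SucD: "Ck (Suc k) f \<Longrightarrow> Ck k f"
proof (induction k arbitrary: f)
  case 0
  then show ?case using Ck_imp_continuous by fastforce
next
  case (Suc k)
  then show ?case unfolding Ck_Suc_iff[of _ f] by meson
qed

lemma Ck_const: "Ck k (\<lambda>x. c)"
proof (induction k arbitrary: c)
  case (Suc k)
  show ?case unfolding Ck_Suc_iff
    by (intro exI[of _ "\<lambda>x v. 0"]) (auto intro: Suc)
qed auto

lemma Ck_add: "Ck k f \<Longrightarrow> Ck k g \<Longrightarrow> Ck k (\<lambda>x. f x + g x)"
proof (induction k arbitrary: f g)
  case (Suc k)
  from Suc.prems obtain f' g' where
    "\<And>x. (f has_derivative f' x) (at x)" "\<And>v. Ck k (\<lambda>x. f' x v)"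
    "\<And>x. (g has_derivative g' x) (at x)" "\<And>v. Ck k (\<lambda>x. g' x v)"
    unfolding Ck_Suc_iff by blast
  then show ?case unfolding Ck_Suc_iff
    by (intro exI[of _ "\<lambda>x v. f' x v + g' x v"]) (auto intro!: Suc.IH has_derivative_add)
qed (auto intro: continuous_on_add)

lemma Ck_mult: "Ck k f \<Longrightarrow> Ck k g \<Longrightarrow> Ck k (\<lambda>x. f x * g x)"
proof (induction k arbitrary: f g)
  case (Suc k)
  from Suc.prems obtain f' g' where
    "\<And>x. (f has_derivative f' x) (at x)" "\<And>v. Ck k (\<lambda>x. f' x v)"
    "\<And>x. (g has_derivative g' x) (at x)" "\<And>v. Ck k (\<lambda>x. g' x v)"
    unfolding Ck_Suc_iff by blast
  then show ?case unfolding Ck_Suc_iff using Suc.prems[THEN Ck_SucD]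
    by (intro exI[of _ "\<lambda>x v. f x * g' x v + f' x v * g x"])
       (auto intro!: Suc.IH has_derivative_mult Ck_add)
qed (auto intro: continuous_on_mult)

lemma Ck_diff: "Ck k f \<Longrightarrow> Ck k g \<Longrightarrow> Ck k (\<lambda>x. f x - g x)"
  using Ck_add[of k f "\<lambda>x. -1 * g x"] Ck_mult[OF Ck_const, of k g "-1"] by simp

lemma Ck_affine:
  assumes L: "bounded_linear L"
  shows "Ck k f \<Longrightarrow> Ck k (\<lambda>x. f (L x + c))"
proof (induction k arbitrary: f)
  case 0
  then show ?case
    using linear_continuous_on[OF L]
    by (auto intro!: continuous_on_compose2[of UNIV f] continuous_intros)
next
  case (Suc k)
  from Suc.prems obtain f' where
    f': "\<And>x. (f has_derivative f' x) (at x)" "\<And>v. Ck k (\<lambda>x. f' x v)"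
    unfolding Ck_Suc_iff by blast
  have "((\<lambda>x. f (L x + c)) has_derivative (\<lambda>v. f' (L x + c) (L v))) (at x)" for x
    using L by (intro has_derivative_compose[OF _ f'(1)] has_derivative_add_const bounded_linear_imp_has_derivative)
  then show ?case unfolding Ck_Suc_iff using f'(2)
    by (intro exI[of _ "\<lambda>x v. f' (L x + c) (L v)"]) (auto intro!: Suc.IH)
qed

lemma Ck_real_iff:
  fixes f :: "real \<Rightarrow> real"
  shows "Ck (Suc k) f \<longleftrightarrow> (\<forall>x. (f has_real_derivative deriv f x) (at x)) \<and> Ck k (deriv f)"
proof
  assume "Ck (Suc k) f"
  then obtain f' where f': "\<And>x. (f has_derivative f' x) (at x)" "\<And>v. Ck k (\<lambda>x. f' x v)"
    unfolding Ck_Suc_iff by blast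
  have "f' x = (\<lambda>v. f' x 1 * v)" for x
    using has_derivative_linear[OF f'(1)[of x]] by (metis linear_scale_real mult.commute mult.right_neutral)
  then have *: "(f has_real_derivative f' x 1) (at x)" for x
    using f'(1)[of x] unfolding has_field_derivative_def by simp
  then have "deriv f x = f' x 1" for x using DERIV_imp_deriv by blast
  then show "(\<forall>x. (f has_real_derivative deriv f x) (at x)) \<and> Ck k (deriv f)"
    using * f'(2)[of 1] by (metis (no_types, lifting) ext)
next
  assume "(\<forall>x. (f has_real_derivative deriv f x) (at x)) \<and> Ck k (deriv f)"
  then show "Ck (Suc k) f" unfolding Ck_Suc_iff
    by (intro exI[of _ "\<lambda>x v. deriv f x * v"])
      (auto intro!: Ck_mult Ck_const simp: has_field_derivative_def)
qed

lemma Ck_realI: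
  fixes f :: "real \<Rightarrow> real"
  assumes "\<And>x. (f has_real_derivative f' x) (at x)" "Ck k f'"
  shows "Ck (Suc k) f"
  using assms DERIV_imp_deriv[OF assms(1)] unfolding Ck_real_iff
  by (metis (no_types, lifting) ext)

text \<open>The derivative of \<open>P(1/x) exp(-1/x)\<close> is again of this form, with \<open>P\<close> replaced by
  \<open>X\<^sup>2 (P - P')\<close>, and all these functions are flat at \<open>0\<close>; so all of them are smooth at once.\<close>

definition flat_exp :: "real poly \<Rightarrow> real \<Rightarrow> real" where
  "flat_exp P x = (if x \<le> 0 then 0 else poly P (1/x) * exp (- (1/x)))"

lemma poly_exp_tendsto_0: "((\<lambda>y. poly P y * exp (- y)) \<longlongrightarrow> 0) at_top" for P :: "real poly"
proof -
  have "((\<lambda>y. \<Sum>i\<le>degree P. coeff P i * (y ^ i / exp y)) \<longlongrightarrow> (\<Sum>i\<le>degree P. coeff P i * 0)) at_top"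
    by (intro tendsto_sum tendsto_mult tendsto_const tendsto_power_div_exp_0)
  then show ?thesis
    by (simp add: poly_altdef sum_distrib_left exp_minus divide_inverse mult_ac)
qed

lemma flat_exp_has_derivative:
  "(flat_exp P has_real_derivative flat_exp ([:0,0,1:] * (P - pderiv P)) x) (at x)"
proof -
  consider "x < 0" | "x > 0" | "x = 0" by linarith
  then show ?thesis
  proof cases
    case 1
    have "((\<lambda>x. 0) has_real_derivative flat_exp ([:0,0,1:] * (P - pderiv P)) x) (at x)"
      using 1 by (simp add: flat_exp_def)
    then show ?thesis
      by (rule DERIV_cong_ev[THEN iffD1, rotated 3])
         (use 1 in \<open>auto simp: flat_exp_def eventually_nhds intro!: exI[of _ "{..<0}"]\<close>)
  next
    case 2
    have "((\<lambda>x. poly P (1/x) * exp (- (1/x))) has_real_derivative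
        flat_exp ([:0,0,1:] * (P - pderiv P)) x) (at x)"
      using 2 by (auto intro!: derivative_eq_intros simp: flat_exp_def field_simps power2_eq_square)
    then show ?thesis
      by (rule DERIV_cong_ev[THEN iffD1, rotated 3])
         (use 2 in \<open>auto simp: flat_exp_def eventually_nhds intro!: exI[of _ "{0<..}"]\<close>)
  next
    case 3
    have "((\<lambda>h. poly ([:0,1:] * P) (inverse h) * exp (- inverse h)) \<longlongrightarrow> 0) (at_right 0)"
      by (rule filterlim_compose[OF poly_exp_tendsto_0 filterlim_inverse_at_top_right])
    then have "((\<lambda>h. flat_exp P h / h) \<longlongrightarrow> 0) (at_right 0)"
      by (rule Lim_transform_eventually)
         (auto simp: flat_exp_def field_simps eventually_at_right_less eventually_at intro!: exI[of _ 1])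
    moreover have "((\<lambda>h. flat_exp P h / h) \<longlongrightarrow> 0) (at_left 0)"
      by (rule tendsto_eventually) (auto simp: flat_exp_def eventually_at intro!: exI[of _ 1])
    ultimately have "((\<lambda>h. flat_exp P h / h) \<longlongrightarrow> 0) (at 0)"
      using filterlim_split_at_real by (metis filterlim_at_split)
    then show ?thesis using 3 by (simp add: DERIV_def flat_exp_def)
  qed
qed

lemma Ck_flat_exp: "Ck k (flat_exp P)"
proof (induction k arbitrary: P)
  case 0
  show ?case
    using DERIV_continuous_on[of UNIV "flat_exp P"] flat_exp_has_derivative by auto
next
  case (Suc k)
  show ?case by (rule Ck_realI[OF flat_exp_has_derivative Suc])
qed

lemma test_functionI:
  fixes f :: "real \<Rightarrow> real"
  assumes "\<And>k. Ck k f" "\<And>x. R < \<bar>x\<bar> \<Longrightarrow> f x = 0"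
  shows "test_function f"
proof -
  have "closure {x. f x \<noteq> 0} \<subseteq> {-R..R}"
  proof (rule closure_minimal)
    show "{x. f x \<noteq> 0} \<subseteq> {-R..R}"
    proof
      fix x assume "x \<in> {x. f x \<noteq> 0}"
      then have "\<not> R < \<bar>x\<bar>" using assms(2) by auto
      then show "x \<in> {-R..R}" by auto
    qed
  qed simp
  then have "bounded (closure {x. f x \<noteq> 0})"
    using bounded_subset bounded_closed_interval by blast
  then have "compact (closure {x. f x \<noteq> 0})"
    by (simp add: compact_eq_bounded_closed)
  then show ?thesis using assms(1) by (simp add: test_function_def)
qed

lemma test_functionE:
  fixes f :: "real \<Rightarrow> real"
  assumes "test_function f"
  obtains R where "R > 0" "\<And>x. R < \<bar>x\<bar> \<Longrightarrow> f x = 0"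
proof -
  have "bounded {x. f x \<noteq> 0}"
    using assms compact_imp_bounded bounded_subset closure_subset
    unfolding test_function_def by metis
  then obtain R where R: "\<And>x. f x \<noteq> 0 \<Longrightarrow> \<bar>x\<bar> \<le> R"
    unfolding bounded_real by auto
  show ?thesis
    by (rule that[of "max R 1"]) (use R in \<open>force+\<close>)
qed

lemma test_function_Ck: "test_function f \<Longrightarrow> Ck k f"
  by (simp add: test_function_def)

lemma test_function_continuous: "test_function f \<Longrightarrow> continuous_on A f"
  using Ck_imp_continuous[OF test_function_Ck] continuous_on_subset by blast

lemma test_function_has_derivative:
  fixes f :: "real \<Rightarrow> real"
  shows "test_function f \<Longrightarrow> (f has_real_derivative deriv f x) (at x)"
  using Ck_real_iff test_function_Ck by blast

lemma test_function_deriv: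
  fixes f :: "real \<Rightarrow> real"
  assumes "test_function f"
  shows "test_function (deriv f)"
proof -
  obtain R where R: "R > 0" "\<And>x. R < \<bar>x\<bar> \<Longrightarrow> f x = 0"
    using assms test_functionE by blast
  show ?thesis
  proof (rule test_functionI)
    show "Ck k (deriv f)" for k using Ck_real_iff test_function_Ck[OF assms] by blast
    fix x assume x: "R < \<bar>x\<bar>"
    have "(f has_real_derivative 0) (at x)"
      by (rule DERIV_cong_ev[THEN iffD1, of x x "\<lambda>_. 0"])
         (use x R in \<open>auto simp: eventually_nhds intro!: exI[of _ "{x. R < \<bar>x\<bar>}"] open_Collect_less continuous_intros\<close>)
    then show "deriv f x = 0" by (rule DERIV_imp_deriv)
  qed
qed

lemma test_function_mult_const:
  fixes f :: "real \<Rightarrow> real"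
  assumes "test_function f"
  shows "test_function (\<lambda>x. c * f x)"
proof -
  obtain R where "R > 0" "\<And>x. R < \<bar>x\<bar> \<Longrightarrow> f x = 0"
    using assms test_functionE by blast
  then show ?thesis
    using assms by (intro test_functionI[of _ R] Ck_mult Ck_const) (auto simp: test_function_Ck)
qed

lemma test_function_diff:
  fixes f g :: "real \<Rightarrow> real"
  assumes "test_function f" "test_function g"
  shows "test_function (\<lambda>x. f x - g x)"
proof -
  obtain R where R: "R > 0" "\<And>x. R < \<bar>x\<bar> \<Longrightarrow> f x = 0"
    using assms test_functionE by blast
  obtain S where S: "S > 0" "\<And>x. S < \<bar>x\<bar> \<Longrightarrow> g x = 0"
    using assms test_functionE by blast
  show ?thesis
    by (rule test_functionI[of _ "max R S"])
       (use R S in \<open>auto intro!: Ck_diff simp: test_function_Ck assms\<close>)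
qed

lemma test_function_tensor:
  fixes a b :: "real \<Rightarrow> real"
  assumes a: "test_function a" and b: "test_function b"
  shows "test_function (\<lambda>p :: real \<times> real. a (fst p) * b (snd p))"
proof -
  obtain R where R: "R > 0" "\<And>x. R < \<bar>x\<bar> \<Longrightarrow> a x = 0"
    using a test_functionE by blast
  obtain S where S: "S > 0" "\<And>x. S < \<bar>x\<bar> \<Longrightarrow> b x = 0"
    using b test_functionE by blast
  have "Ck k (\<lambda>p :: real \<times> real. a (fst p) * b (snd p))" for k
    using Ck_affine[OF bounded_linear_fst test_function_Ck[OF a], of k 0]
          Ck_affine[OF bounded_linear_snd test_function_Ck[OF b], of k 0]
    by (auto intro: Ck_mult)
  moreover
  have "{p. a (fst p) * b (snd p) \<noteq> 0} \<subseteq> {-R..R} \<times> {-S..S}"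
  proof
    fix p assume "p \<in> {p. a (fst p) * b (snd p) \<noteq> 0}"
    then have "\<not> R < \<bar>fst p\<bar>" "\<not> S < \<bar>snd p\<bar>" using R(2) S(2) by auto
    then show "p \<in> {-R..R} \<times> {-S..S}" by (auto simp: mem_Times_iff)
  qed
  then have "closure {p. a (fst p) * b (snd p) \<noteq> 0} \<subseteq> {-R..R} \<times> {-S..S}"
    by (intro closure_minimal closed_Times) auto
  then have "bounded (closure {p. a (fst p) * b (snd p) \<noteq> 0})"
    by (rule bounded_subset[OF bounded_Times[OF bounded_closed_interval bounded_closed_interval]])
  then have "compact (closure {p. a (fst p) * b (snd p) \<noteq> 0})"
    by (simp add: compact_eq_bounded_closed)
  ultimately show ?thesis by (simp add: test_function_def)
qed

lemma has_derivative_integral_from: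
  fixes f :: "real \<Rightarrow> real"
  assumes f: "continuous_on UNIV f" and R: "\<And>x. x < -R \<Longrightarrow> f x = 0"
  shows "((\<lambda>x. integral {-R..x} f) has_real_derivative f x) (at x)"
proof -
  define a where "a = min x (-R) - 1"
  have int: "f integrable_on {c..d}" for c d
    using f continuous_on_subset integrable_continuous_interval by blast
  have eq: "integral {a..y} f = integral {-R..y} f" for y
  proof (cases "-R \<le> y")
    case True
    have "integral {a..-R} f = integral {a..-R} (\<lambda>_. 0)"
      by (rule integral_spike[of "{-R}"]) (auto simp: R)
    moreover have "integral {a..-R} f + integral {-R..y} f = integral {a..y} f"
      using True by (intro Henstock_Kurzweil_Integration.integral_combine int) (auto simp: a_def)
    ultimately show ?thesis by simp
  next
    case False
    have "integral {a..y} f = integral {a..y} (\<lambda>_. 0)"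
      using False by (intro Henstock_Kurzweil_Integration.integral_cong) (auto simp: R)
    then show ?thesis using False by simp
  qed
  have "((\<lambda>y. integral {a..y} f) has_real_derivative f x) (at x within {a..x+1})"
    using f by (intro integral_has_real_derivative) (auto simp: a_def intro: continuous_on_subset)
  then have "((\<lambda>y. integral {a..y} f) has_real_derivative f x) (at x)"
    by (subst (asm) at_within_interior) (auto simp: a_def interior_atLeastAtMost_real)
  then show ?thesis by (simp add: eq)
qed

text \<open>To the right of the support the antiderivative is the full integral, so it has compact support
  exactly when that integral vanishes.\<close>

lemma test_function_antiderivative:
  fixes f :: "real \<Rightarrow> real"
  assumes f: "test_function f" and R: "\<And>x. R < \<bar>x\<bar> \<Longrightarrow> f x = 0"
    and zero: "integral {-R..R} f = 0" and "R \<ge> 0"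
  shows "\<exists>F. test_function F \<and> deriv F = f"
proof -
  define F where "F x = integral {-R..x} f" for x
  have d: "(F has_real_derivative f x) (at x)" for x
    unfolding F_def using f R by (intro has_derivative_integral_from test_function_continuous) auto
  have dF: "deriv F = f" using DERIV_imp_deriv[OF d] by auto
  have "Ck k F" for k
  proof (cases k)
    case 0 then show ?thesis using DERIV_continuous_on[of UNIV F f] d by auto
  next
    case (Suc j) then show ?thesis using Ck_realI[OF d test_function_Ck[OF f]] by simp
  qed
  moreover have "F x = 0" if "R < \<bar>x\<bar>" for x
  proof (cases "x < -R")
    case False
    with that have "x > R" by auto
    have int: "f integrable_on {c..d}" for c d
      using test_function_continuous[OF f] integrable_continuous_interval by blast
    have "integral {R..x} f = integral {R..x} (\<lambda>_. 0)"
      using R by (intro integral_spike[of "{R}"]) auto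
    moreover have "integral {-R..R} f + integral {R..x} f = integral {-R..x} f"
      using \<open>x > R\<close> \<open>R \<ge> 0\<close> by (intro Henstock_Kurzweil_Integration.integral_combine int) auto
    ultimately show ?thesis using zero by (simp add: F_def)
  qed (simp add: F_def)
  ultimately have "test_function F" by (rule test_functionI)
  then show ?thesis using dF by blast
qed

lemma ex_bump:
  "\<exists>B :: real \<Rightarrow> real. test_function B \<and> (\<forall>x. B x \<ge> 0) \<and> (\<forall>x. x \<notin> {0..1} \<longrightarrow> B x = 0) \<and> integral {0..1} B = 1"
proof -
  define A where "A x = flat_exp 1 x * flat_exp 1 (1 - x)" for x :: real
  have CkA: "Ck k A" for k
    unfolding A_def
    using Ck_affine[of "\<lambda>x. - x" k "flat_exp 1" 1] Ck_flat_exp[of k 1] bounded_linear_minus[OF bounded_linear_ident]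
    by (intro Ck_mult) (simp_all)
  have A0: "A x = 0" if "x \<notin> {0..1}" for x
    using that by (auto simp: A_def flat_exp_def)
  have Apos: "A x \<ge> 0" for x by (simp add: A_def flat_exp_def)
  have cont: "continuous_on S A" for S
    using Ck_imp_continuous[OF CkA] continuous_on_subset by blast
  have "integral {0..1} A \<noteq> 0"
  proof
    assume "integral {0..1} A = 0"
    then have "\<forall>x\<in>{0..1}. A x = 0"
      using integral_eq_0_iff[of 0 1 A] Apos cont by auto
    from bspec[OF this, of "1/2"] have "A (1/2) = 0" by simp
    then show False by (simp add: A_def flat_exp_def)
  qed
  moreover have "integral {0..1} A \<ge> 0" by (intro integral_nonneg) (auto simp: Apos cont integrable_continuous_interval)
  ultimately have c: "integral {0..1} A > 0" by simp
  define c where "c = integral {0..1} A"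
  have "test_function A" proof (rule test_functionI[of _ 1])
    show "A x = 0" if "1 < \<bar>x\<bar>" for x using that by (intro A0) auto
  qed (rule CkA)
  then have "test_function (\<lambda>x. inverse c * A x)" by (rule test_function_mult_const)
  moreover have "integral {0..1} (\<lambda>x. inverse c * A x) = 1"
    using c by (simp add: c_def)
  ultimately show ?thesis
    using Apos A0 c by (intro exI[of _ "\<lambda>x. inverse c * A x"]) (auto simp: c_def)
qed

lemma ex_smooth_step:
  "\<exists>S :: real \<Rightarrow> real. (\<forall>k. Ck k S) \<and> (\<forall>x\<le>0. S x = 0) \<and> (\<forall>x\<ge>1. S x = 1) \<and> (\<forall>x. 0 \<le> S x \<and> S x \<le> 1)"
proof -
  obtain B :: "real \<Rightarrow> real" where B: "test_function B" "\<And>x. B x \<ge> 0" "\<And>x. x \<notin> {0..1} \<Longrightarrow> B x = 0"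
    "integral {0..1} B = 1"
    using ex_bump by auto
  define S where "S x = integral {-0..x} B" for x
  have d: "(S has_real_derivative B x) (at x)" for x
    unfolding S_def using B by (intro has_derivative_integral_from test_function_continuous) auto
  have Ck: "Ck k S" for k
  proof (cases k)
    case 0 then show ?thesis using DERIV_continuous_on[of UNIV S B] d by auto
  next
    case (Suc j) then show ?thesis using Ck_realI[OF d test_function_Ck[OF B(1)]] by simp
  qed
  have mono: "S x \<le> S y" if "x \<le> y" for x y
    using DERIV_nonneg_imp_nondecreasing[OF that] d B(2) by blast
  have S0: "S x = 0" if "x \<le> 0" for x using that by (cases "x = 0") (auto simp: S_def)
  have S1: "S x = 1" if "x \<ge> 1" for x
  proof -
    have int: "B integrable_on {c..d}" for c d
      using test_function_continuous[OF B(1)] integrable_continuous_interval by blast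
    have "integral {1..x} B = integral {1..x} (\<lambda>_. 0)"
      using B(3) by (intro integral_spike[of "{1}"]) auto
    moreover have "integral {0..1} B + integral {1..x} B = integral {0..x} B"
      using that by (intro Henstock_Kurzweil_Integration.integral_combine int) auto
    ultimately show ?thesis using B(4) by (simp add: S_def)
  qed
  have "0 \<le> S x \<and> S x \<le> 1" for x
    using mono[of 0 x] mono[of x 0] S0 S1 mono[of x 1] by (metis order.refl linear)
  then show ?thesis using Ck S0 S1 by blast
qed

section \<open>Primitives of locally integrable functions\<close>

text \<open>Local absolute continuity of \<open>f\<close>, with the fundamental theorem of calculus built in: the almost
  everywhere derivative \<open>g\<close> is part of the data.\<close>

definition is_primitive :: "(real \<Rightarrow> real) \<Rightarrow> (real \<Rightarrow> real) \<Rightarrow> bool" where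
  "is_primitive f g \<longleftrightarrow> locally_integrable g \<and>
     (\<forall>a b. a \<le> b \<longrightarrow> f b - f a = (LINT x:{a..b}|lborel. g x))"

lemma locally_integrableD: "locally_integrable g \<Longrightarrow> set_integrable lborel {a..b} g"
  by (simp add: locally_integrable_def)

lemma locally_integrable_measurable:
  assumes "locally_integrable g"
  shows "g \<in> borel_measurable borel"
proof (rule borel_measurable_LIMSEQ_real)
  show "(\<lambda>x. indicator {- real n..real n} x * g x) \<in> borel_measurable borel" for n
    using locally_integrableD[OF assms, of "- real n" "real n"]
    unfolding set_integrable_def by (auto dest: borel_measurable_integrable)
  fix x :: real
  have "eventually (\<lambda>n. real n \<ge> \<bar>x\<bar>) sequentially"
    by (simp add: eventually_sequentially) (meson nat_ceiling_le_eq order.trans of_nat_le_iff real_nat_ceiling_ge)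
  then have "eventually (\<lambda>n. indicator {- real n..real n} x * g x = g x) sequentially"
    by eventually_elim (auto simp: indicator_def)
  then show "(\<lambda>n. indicator {- real n..real n} x * g x) \<longlonglongrightarrow> g x"
    by (rule tendsto_eventually)
qed

lemma continuous_measurable: "continuous_on UNIV f \<Longrightarrow> f \<in> borel_measurable borel" for f :: "real \<Rightarrow> real"
  by (simp add: borel_measurable_continuous_onI)

lemma locally_integrable_continuous: "continuous_on UNIV f \<Longrightarrow> locally_integrable f"
  unfolding locally_integrable_def
  by (auto intro!: borel_integrable_atLeastAtMost' intro: continuous_on_subset)

lemma set_integrable_of_integrable:
  "integrable lborel f \<Longrightarrow> A \<in> sets borel \<Longrightarrow> set_integrable lborel A f"
  for f :: "real \<Rightarrow> real"
  unfolding set_integrable_def by (intro integrable_mult_indicator) auto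

lemma locally_integrable_integrable: "integrable lborel f \<Longrightarrow> locally_integrable f"
  unfolding locally_integrable_def set_integrable_def
  by (intro allI integrable_mult_indicator) auto

lemma locally_integrable_bound:
  assumes "locally_integrable g" "f \<in> borel_measurable borel" "\<And>x. \<bar>f x\<bar> \<le> \<bar>g x\<bar>"
  shows "locally_integrable f"
  unfolding locally_integrable_def
proof (intro allI)
  fix a b
  show "set_integrable lborel {a..b} f"
    by (rule set_integrable_bound[OF locally_integrableD[OF assms(1)]])
       (use assms in \<open>auto simp: set_borel_measurable_def\<close>)
qed

lemma locally_integrable_mult_continuous:
  assumes g: "locally_integrable g" and f: "continuous_on UNIV f"
  shows "locally_integrable (\<lambda>x. f x * g x)"
  unfolding locally_integrable_def
proof (intro allI)
  fix a b :: real
  have "compact (f ` {a..b})"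
    using f by (intro compact_continuous_image) (auto intro: continuous_on_subset)
  then have "bounded (f ` {a..b})" by (rule compact_imp_bounded)
  then obtain K where K: "\<And>x. x \<in> {a..b} \<Longrightarrow> \<bar>f x\<bar> \<le> K"
    unfolding bounded_real by blast
  have [measurable]: "f \<in> borel_measurable borel" "g \<in> borel_measurable borel"
    using f g by (auto intro: continuous_measurable locally_integrable_measurable)
  show "set_integrable lborel {a..b} (\<lambda>x. f x * g x)"
  proof (rule set_integrable_bound)
    show "set_integrable lborel {a..b} (\<lambda>x. K * g x)"
      using locally_integrableD[OF g] by simp
    show "AE x in lborel. x \<in> {a..b} \<longrightarrow> norm (f x * g x) \<le> norm (K * g x)"
    proof (intro AE_I2 impI)
      fix x assume "x \<in> {a..b}"
      then have "\<bar>f x\<bar> \<le> \<bar>K\<bar>" using K by fastforce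
      then show "norm (f x * g x) \<le> norm (K * g x)" by (simp add: abs_mult mult_right_mono)
    qed
  qed (auto simp: set_borel_measurable_def)
qed

lemma locally_integrable_add:
  "locally_integrable f \<Longrightarrow> locally_integrable g \<Longrightarrow> locally_integrable (\<lambda>x. f x + g x)"
  unfolding locally_integrable_def by simp

lemma locally_integrable_diff:
  "locally_integrable f \<Longrightarrow> locally_integrable g \<Longrightarrow> locally_integrable (\<lambda>x. f x - g x)"
  unfolding locally_integrable_def by simp

lemma locally_integrable_cmult:
  "locally_integrable f \<Longrightarrow> locally_integrable (\<lambda>x. c * f x)"
  unfolding locally_integrable_def by simp

lemma locally_integrable_abs:
  "locally_integrable f \<Longrightarrow> locally_integrable (\<lambda>x. \<bar>f x\<bar>)"
  unfolding locally_integrable_def by (simp add: set_integrable_abs)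

lemma LINT_eq_integral:
  "locally_integrable g \<Longrightarrow> (LINT x:{a..b}|lborel. g x) = integral {a..b} g"
  "locally_integrable g \<Longrightarrow> g integrable_on {a..b}"
  using set_borel_integral_eq_integral[OF locally_integrableD] by auto

lemma LINT_combine:
  assumes "locally_integrable g" "a \<le> b" "b \<le> c"
  shows "(LINT x:{a..b}|lborel. g x) + (LINT x:{b..c}|lborel. g x) = (LINT x:{a..c}|lborel. g x)"
  using assms by (simp add: LINT_eq_integral Henstock_Kurzweil_Integration.integral_combine)

lemma LINT_abs_le:
  assumes "locally_integrable g" "a \<le> b"
  shows "\<bar>LINT x:{a..b}|lborel. g x\<bar> \<le> (LINT x:{a..b}|lborel. \<bar>g x\<bar>)"
proof -
  have "\<bar>LINT x:{a..b}|lborel. g x\<bar> \<le> (LINT x|lborel. norm (indicator {a..b} x *\<^sub>R g x))"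
    unfolding set_lebesgue_integral_def real_norm_def[symmetric] by (rule integral_norm_bound)
  then show ?thesis by (simp add: set_lebesgue_integral_def abs_mult)
qed

lemma is_primitive_integral:
  "is_primitive f g \<Longrightarrow> a \<le> b \<Longrightarrow> (LINT x:{a..b}|lborel. g x) = f b - f a"
  by (simp add: is_primitive_def)

lemma is_primitive_locally_integrable: "is_primitive f g \<Longrightarrow> locally_integrable g"
  by (simp add: is_primitive_def)

lemma is_primitive_continuous:
  assumes "is_primitive f g"
  shows "continuous_on UNIV f"
proof -
  have lg: "locally_integrable g" using assms by (rule is_primitive_locally_integrable)
  have "isCont f x" for x
  proof -
    have eq: "f y = f (x - 1) + integral {x-1..y} g" if "y \<in> {x-1..x+1}" for y
      using is_primitive_integral[OF assms, of "x - 1" y] LINT_eq_integral(1)[OF lg] that by simp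
    have "continuous_on {x-1..x+1} (\<lambda>y. f (x - 1) + integral {x-1..y} g)"
      using assms LINT_eq_integral(2)
      by (intro continuous_intros indefinite_integral_continuous_1) (auto simp: is_primitive_def)
    then have "continuous_on {x-1..x+1} f"
      by (rule continuous_on_eq) (rule eq[symmetric])
    then have "continuous_on {x-1<..<x+1} f" by (rule continuous_on_subset) auto
    then show ?thesis by (subst (asm) continuous_on_eq_continuous_at) auto
  qed
  then show ?thesis by (simp add: continuous_on_eq_continuous_at)
qed

lemma is_primitive_C1:
  assumes "\<And>x. (f has_real_derivative g x) (at x)" "continuous_on UNIV g"
  shows "is_primitive f g"
proof -
  have "f b - f a = (LINT x:{a..b}|lborel. g x)" if "a \<le> b" for a b
  proof -
    have "(g has_integral f b - f a) {a..b}"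
      using assms(1) that
      by (intro fundamental_theorem_of_calculus)
         (auto simp: has_real_derivative_iff_has_vector_derivative[symmetric] intro: DERIV_subset)
    then show ?thesis
      using LINT_eq_integral[OF locally_integrable_continuous[OF assms(2)]] by (simp add: integral_unique)
  qed
  then show ?thesis using assms(2) by (auto simp: is_primitive_def locally_integrable_continuous)
qed

lemma is_primitive_has_derivative:
  assumes "is_primitive f g" "continuous_on UNIV g"
  shows "(f has_real_derivative g x) (at x)"
proof -
  have eq: "f y = f (x - 1) + integral {x-1..y} g" if "y \<ge> x - 1" for y
    using is_primitive_integral[OF assms(1), of "x - 1" y] that
      LINT_eq_integral(1)[OF is_primitive_locally_integrable[OF assms(1)]] by simp
  have "((\<lambda>y. integral {x-1..y} g) has_real_derivative g x) (at x within {x-1..x+1})"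
    using assms(2) by (intro integral_has_real_derivative) (auto intro: continuous_on_subset)
  then have "((\<lambda>y. f (x-1) + integral {x-1..y} g) has_real_derivative g x) (at x)"
    by (subst (asm) at_within_interior) (auto simp: interior_atLeastAtMost_real intro!: derivative_eq_intros)
  moreover have "eventually (\<lambda>y. f y = f (x-1) + integral {x-1..y} g) (nhds x)"
    unfolding eventually_nhds by (intro exI[of _ "{x-1<..}"] conjI ballI eq) auto
  ultimately show ?thesis by (subst DERIV_cong_ev[OF refl _ refl])
qed

lemma is_primitive_add:
  "is_primitive f g \<Longrightarrow> is_primitive f' g' \<Longrightarrow> is_primitive (\<lambda>x. f x + f' x) (\<lambda>x. g x + g' x)"
  unfolding is_primitive_def
  by (auto simp: locally_integrable_add locally_integrableD add_diff_add)

lemma is_primitive_diff: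
  "is_primitive f g \<Longrightarrow> is_primitive f' g' \<Longrightarrow> is_primitive (\<lambda>x. f x - f' x) (\<lambda>x. g x - g' x)"
  unfolding is_primitive_def
  by (auto simp: locally_integrable_diff locally_integrableD algebra_simps)

lemma is_primitive_cmult:
  "is_primitive f g \<Longrightarrow> is_primitive (\<lambda>x. c * f x) (\<lambda>x. c * g x)"
  unfolding is_primitive_def
  by (auto simp: locally_integrable_cmult right_diff_distrib[symmetric])

lemma is_primitive_add_const:
  "is_primitive f g \<Longrightarrow> is_primitive (\<lambda>x. f x + c) g"
  unfolding is_primitive_def by simp

text \<open>A primitive need not be differentiable everywhere, so the chain rule is proved from the
  mean value theorem on short intervals: there it holds up to an error \<open>\<epsilon> \<integral>|g|\<close>, and such
  errors add up to \<open>\<epsilon> \<integral>|g|\<close> over the whole interval.\<close>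

lemma is_primitive_compose:
  assumes fg: "is_primitive f g"
    and F: "\<And>y. (F has_real_derivative F' y) (at y)" and F': "continuous_on UNIV F'"
  shows "is_primitive (\<lambda>x. F (f x)) (\<lambda>x. F' (f x) * g x)"
proof -
  have cf: "continuous_on UNIV f" by (rule is_primitive_continuous[OF fg])
  have ch: "continuous_on UNIV (\<lambda>x. F' (f x))"
    using continuous_on_compose2[OF F' cf] by auto
  have lg: "locally_integrable g" using fg by (simp add: is_primitive_def)
  have lh: "locally_integrable (\<lambda>x. F' (f x) * g x)"
    by (rule locally_integrable_mult_continuous[OF lg ch])
  have la: "locally_integrable (\<lambda>x. \<bar>g x\<bar>)" by (rule locally_integrable_abs[OF lg])
  define \<Delta> where "\<Delta> x y = F (f y) - F (f x) - (LINT z:{x..y}|lborel. F' (f z) * g z)" for x y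
  define J where "J x y = (LINT z:{x..y}|lborel. \<bar>g z\<bar>)" for x y
  have bound: "\<bar>\<Delta> a b\<bar> \<le> \<epsilon> * J a b" if ab: "a \<le> b" and "\<epsilon> > 0" for a b \<epsilon>
  proof -
    have "uniformly_continuous_on {a..b} (\<lambda>x. F' (f x))"
      using ch by (intro compact_uniformly_continuous) (auto intro: continuous_on_subset)
    then obtain d where d: "d > 0"
      "\<And>x y. x \<in> {a..b} \<Longrightarrow> y \<in> {a..b} \<Longrightarrow> \<bar>x - y\<bar> < d \<Longrightarrow> \<bar>F' (f x) - F' (f y)\<bar> < \<epsilon>"
      using \<open>\<epsilon> > 0\<close> unfolding uniformly_continuous_on_def dist_real_def by metis
    have short: "\<bar>\<Delta> x y\<bar> \<le> \<epsilon> * J x y" if xy: "x \<le> y" "x \<in> {a..b}" "y \<in> {a..b}" "y - x < d" for x y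
    proof -
      obtain c where c: "c \<in> {x..y}" "F (f y) - F (f x) = F' (f c) * (f y - f x)"
      proof (cases "f x = f y")
        case True
        then show ?thesis using that[of x] xy by auto
      next
        case False
        then consider "f x < f y" | "f y < f x" by linarith
        then show ?thesis
        proof cases
          case 1
          then obtain v where v: "f x < v" "v < f y" "F (f y) - F (f x) = (f y - f x) * F' v"
            using MVT2[of "f x" "f y" F F'] F by blast
          then obtain c where "c \<in> {x..y}" "f c = v"
            using IVT'[of f x v y] xy cf continuous_on_subset by (metis atLeastAtMost_iff less_imp_le subset_UNIV)
          then show ?thesis using that v by (metis mult.commute)
        next
          case 2
          then obtain v where v: "f y < v" "v < f x" "F (f x) - F (f y) = (f x - f y) * F' v"
            using MVT2[of "f y" "f x" F F'] F by blast
          then obtain c where "c \<in> {x..y}" "f c = v"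
            using IVT2'[of f y v x] xy cf continuous_on_subset by (metis atLeastAtMost_iff less_imp_le subset_UNIV)
          moreover have "F (f y) - F (f x) = F' v * (f y - f x)" using v(3) by (simp add: algebra_simps)
          ultimately show ?thesis using that by blast
        qed
      qed
      have "F (f y) - F (f x) = (LINT z:{x..y}|lborel. F' (f c) * g z)"
        using c(2) is_primitive_integral[OF fg xy(1)] by simp
      then have "\<Delta> x y = (LINT z:{x..y}|lborel. F' (f c) * g z - F' (f z) * g z)"
        unfolding \<Delta>_def
        using set_integral_diff(2)[of lborel "{x..y}" "\<lambda>z. F' (f c) * g z" "\<lambda>z. F' (f z) * g z"]
        by (simp add: locally_integrableD lg lh)
      also have "\<bar>\<dots>\<bar> \<le> (LINT z:{x..y}|lborel. \<bar>F' (f c) * g z - F' (f z) * g z\<bar>)"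
        using xy by (intro LINT_abs_le locally_integrable_diff locally_integrable_cmult lg lh)
      also have "\<dots> \<le> (LINT z:{x..y}|lborel. \<epsilon> * \<bar>g z\<bar>)"
      proof (rule set_integral_mono)
        show "set_integrable lborel {x..y} (\<lambda>z. \<bar>F' (f c) * g z - F' (f z) * g z\<bar>)"
          by (intro locally_integrableD locally_integrable_abs locally_integrable_diff
              locally_integrable_cmult lg lh)
        show "set_integrable lborel {x..y} (\<lambda>z. \<epsilon> * \<bar>g z\<bar>)"
          by (intro locally_integrableD locally_integrable_cmult la)
        fix z assume z: "z \<in> {x..y}"
        have "\<bar>F' (f c) - F' (f z)\<bar> \<le> \<epsilon>"
        proof -
          have "\<bar>c - z\<bar> < d" using z c xy(4) by (auto simp: abs_if)
          then show ?thesis using d(2)[of c z] z c xy by auto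
        qed
        then show "\<bar>F' (f c) * g z - F' (f z) * g z\<bar> \<le> \<epsilon> * \<bar>g z\<bar>"
          by (simp add: left_diff_distrib[symmetric] abs_mult mult_right_mono)
      qed
      finally show ?thesis by (simp add: J_def)
    qed
    have "a \<le> x \<and> y \<le> b \<longrightarrow> \<bar>\<Delta> x y\<bar> \<le> \<epsilon> * J x y" if "x = a" "y = b" for x y
    proof -
      have "x \<le> y" using ab that by simp
      then show ?thesis
      proof (induction rule: Bolzano)
        case (trans p q r)
        have "\<Delta> p r = \<Delta> p q + \<Delta> q r" "J p r = J p q + J q r"
          using LINT_combine[OF lh trans(3,4)] LINT_combine[OF la trans(3,4)]
          by (simp_all add: \<Delta>_def J_def)
        then show ?case using trans by (auto simp: distrib_left)
      next
        case (local x)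
        then show ?case using \<open>d > 0\<close> that short
          by (intro exI[of _ d]) auto
      qed
    qed
    then show ?thesis by auto
  qed
  have "\<Delta> a b = 0" if "a \<le> b" for a b
  proof -
    have J: "J a b \<ge> 0" unfolding J_def set_lebesgue_integral_def by (intro integral_nonneg_AE) auto
    have "\<bar>\<Delta> a b\<bar> \<le> 0 + e" if "e > 0" for e
    proof -
      have "\<bar>\<Delta> a b\<bar> \<le> e / (J a b + 1) * J a b"
        by (intro bound[OF \<open>a \<le> b\<close>]) (use J that in auto)
      also have "\<dots> \<le> e" using J that by (auto simp: field_simps)
      finally show ?thesis by simp
    qed
    then have "\<bar>\<Delta> a b\<bar> \<le> 0" by (rule field_le_epsilon)
    then show ?thesis by simp
  qed
  then show ?thesis using lh by (auto simp: is_primitive_def \<Delta>_def)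
qed

text \<open>Polarisation reduces a product to squares, for which there is the chain rule.\<close>

lemma is_primitive_mult:
  assumes 1: "is_primitive f g" and 2: "is_primitive f' g'"
  shows "is_primitive (\<lambda>x. f x * f' x) (\<lambda>x. f x * g' x + g x * f' x)"
proof -
  have sq: "is_primitive (\<lambda>x. (h x)\<^sup>2) (\<lambda>x. 2 * h x * k x)" if "is_primitive h k" for h k
    by (rule is_primitive_compose[OF that]) (auto intro!: derivative_eq_intros continuous_intros)
  have "is_primitive (\<lambda>x. 1/4 * ((f x + f' x)\<^sup>2 - (f x - f' x)\<^sup>2))
    (\<lambda>x. 1/4 * (2 * (f x + f' x) * (g x + g' x) - 2 * (f x - f' x) * (g x - g' x)))"
    by (intro is_primitive_cmult is_primitive_diff sq is_primitive_add 1 2)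
  then show ?thesis by (simp add: power2_eq_square algebra_simps)
qed

lemma is_primitive_reflect:
  assumes "is_primitive f g"
  shows "is_primitive (\<lambda>x. f (- x)) (\<lambda>x. - g (- x))"
proof -
  have I: "(LINT x:{a..b}|lborel. g (- x)) = (LINT x:{-b..-a}|lborel. g x)" for a b
  proof -
    have "{x. - x \<in> {-b..-a}} = {a..b}" by auto
    then show ?thesis using set_integral_reflect[of "{-b..-a}" g] by simp
  qed
  have S: "set_integrable lborel {a..b} (\<lambda>x. g (- x))" for a b
  proof -
    have "integrable lborel (\<lambda>x. indicator {-b..-a} x *\<^sub>R g x)"
      using assms by (simp add: is_primitive_def locally_integrable_def set_integrable_def)
    from lborel_integrable_real_affine[OF this, of "-1" 0]
    have "integrable lborel (\<lambda>x. indicator {-b..-a} (-x) *\<^sub>R g (-x))" by simp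
    moreover have "indicator {-b..-a} (-x) = (indicator {a..b} x :: real)" for x
      by (auto simp: indicator_def)
    ultimately show ?thesis unfolding set_integrable_def by simp
  qed
  have S': "set_integrable lborel {a..b} (\<lambda>x. - g (- x))" for a b
    using set_integrable_mult_right[of "-1::real", OF S] by simp
  show ?thesis
    unfolding is_primitive_def locally_integrable_def
  proof (intro conjI allI impI S')
    fix a b :: real assume "a \<le> b"
    then have "(LINT x:{-b..-a}|lborel. g x) = f (-a) - f (-b)"
      by (intro is_primitive_integral[OF assms]) simp
    then show "f (- b) - f (- a) = (LINT x:{a..b}|lborel. - g (- x))"
      by (simp add: set_integral_uminus[OF S] I)
  qed

qed

lemma is_primitive_const: "is_primitive (\<lambda>x. c) (\<lambda>x. 0)"
  by (rule is_primitive_C1) auto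

lemma is_primitive_integral_from_0:
  assumes "locally_integrable g"
  shows "is_primitive (\<lambda>x. if 0 \<le> x then LINT y:{0..x}|lborel. g y else - (LINT y:{x..0}|lborel. g y)) g"
  unfolding is_primitive_def
proof (intro conjI allI impI assms)
  fix a b :: real assume "a \<le> b"
  then consider "0 \<le> a" | "a < 0" "0 \<le> b" | "b < 0" by linarith
  then show "(if 0 \<le> b then LINT y:{0..b}|lborel. g y else - (LINT y:{b..0}|lborel. g y)) -
    (if 0 \<le> a then LINT y:{0..a}|lborel. g y else - (LINT y:{a..0}|lborel. g y)) = (LINT x:{a..b}|lborel. g x)"
    by cases (use \<open>a \<le> b\<close> LINT_combine[OF assms, of 0 a b] LINT_combine[OF assms, of a 0 b]
      LINT_combine[OF assms, of a b 0] in \<open>auto\<close>)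
qed

subsection \<open>Behaviour at infinity\<close>

lemma integrable_limit_at_top_zero:
  fixes h :: "real \<Rightarrow> real"
  assumes h: "integrable lborel h" and L: "(h \<longlongrightarrow> L) at_top"
  shows "L = 0"
proof (rule ccontr)
  assume "L \<noteq> 0"
  then have "eventually (\<lambda>x. dist (h x) L < \<bar>L\<bar> / 2) at_top"
    using L tendstoD by (metis half_gt_zero zero_less_abs_iff)
  then obtain B where B: "\<And>x. x \<ge> B \<Longrightarrow> \<bar>h x - L\<bar> < \<bar>L\<bar> / 2"
    unfolding eventually_at_top_linorder dist_real_def by auto
  have hB: "\<bar>h x\<bar> \<ge> \<bar>L\<bar> / 2" if "x \<ge> B" for x using B[OF that] by (simp add: abs_if split: if_splits)
  have "real n * (\<bar>L\<bar> / 2) \<le> (LINT x|lborel. \<bar>h x\<bar>)" for n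
  proof -
    have "(LINT x|lborel. indicator {B..B + real n} x * (\<bar>L\<bar>/2)) \<le> (LINT x|lborel. \<bar>h x\<bar>)"
    proof (rule integral_mono)
      show "integrable lborel (\<lambda>x. indicator {B..B + real n} x * (\<bar>L\<bar>/2))"
        by (intro integrable_mult_left) simp
    qed (use hB h in \<open>auto simp: indicator_def\<close>)
    then show ?thesis by simp
  qed
  moreover obtain n where "real n * (\<bar>L\<bar> / 2) > (LINT x|lborel. \<bar>h x\<bar>)"
    using reals_Archimedean3[of "\<bar>L\<bar>/2"] \<open>L \<noteq> 0\<close> by auto
  ultimately show False by (meson not_less)
qed

text \<open>Integrability of \<open>k\<close> makes \<open>h\<close> converge, and an integrable function can only converge to \<open>0\<close>.\<close>

lemma is_primitive_tendsto_at_top: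
  assumes hk: "is_primitive h k" and k: "integrable lborel k" and h: "integrable lborel h"
  shows "(h \<longlongrightarrow> 0) at_top"
proof -
  have "((\<lambda>b. LINT x:{0..b}|lborel. k x) \<longlongrightarrow> (LINT x:{0..}|lborel. k x)) at_top"
    using k by (intro tendsto_set_lebesgue_integral_at_top)
      (auto intro: set_integrable_of_integrable)
  then have "((\<lambda>b. h 0 + (LINT x:{0..b}|lborel. k x)) \<longlongrightarrow> h 0 + (LINT x:{0..}|lborel. k x)) at_top"
    by (intro tendsto_intros)
  moreover have "eventually (\<lambda>b. h 0 + (LINT x:{0..b}|lborel. k x) = h b) at_top"
    using eventually_ge_at_top[of 0] by eventually_elim (simp add: is_primitive_integral[OF hk])
  ultimately have "(h \<longlongrightarrow> h 0 + (LINT x:{0..}|lborel. k x)) at_top"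
    by (rule Lim_transform_eventually)
  then show ?thesis using integrable_limit_at_top_zero[OF h] by metis
qed

lemma is_primitive_tendsto_at_bot:
  assumes hk: "is_primitive h k" and k: "integrable lborel k" and h: "integrable lborel h"
  shows "(h \<longlongrightarrow> 0) at_bot"
proof -
  have "((\<lambda>x. h (- x)) \<longlongrightarrow> 0) at_top"
    using lborel_integrable_real_affine[OF k, of "-1" 0] lborel_integrable_real_affine[OF h, of "-1" 0]
    by (intro is_primitive_tendsto_at_top[OF is_primitive_reflect[OF hk]]) auto
  then show ?thesis unfolding at_bot_mirror filterlim_filtermap by simp
qed

lemma LINT_symmetric_interval_tendsto:
  fixes k :: "real \<Rightarrow> real"
  assumes "integrable lborel k"
  shows "(\<lambda>n. LINT x:{-real n..real n}|lborel. k x) \<longlonglongrightarrow> (LINT x|lborel. k x)"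
  unfolding set_lebesgue_integral_def
proof (rule integral_dominated_convergence[where w="\<lambda>x. \<bar>k x\<bar>"])
  show "AE x in lborel. (\<lambda>n. indicat_real {-real n..real n} x *\<^sub>R k x) \<longlonglongrightarrow> k x"
  proof (rule AE_I2)
    fix x :: real
    have "eventually (\<lambda>n. real n \<ge> \<bar>x\<bar>) sequentially"
      by (simp add: eventually_sequentially) (meson nat_ceiling_le_eq order.trans of_nat_le_iff real_nat_ceiling_ge)
    then have "eventually (\<lambda>n. indicat_real {-real n..real n} x *\<^sub>R k x = k x) sequentially"
      by eventually_elim (auto simp: indicator_def)
    then show "(\<lambda>n. indicat_real {-real n..real n} x *\<^sub>R k x) \<longlonglongrightarrow> k x"
      by (rule tendsto_eventually)
  qed
qed (use assms in \<open>auto simp: indicator_def\<close>)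

lemma is_primitive_integral_zero:
  assumes hk: "is_primitive h k" and k: "integrable lborel k" and h: "integrable lborel h"
  shows "(LINT x|lborel. k x) = 0"
proof -
  have "(\<lambda>n. LINT x:{-real n..real n}|lborel. k x) \<longlonglongrightarrow> (LINT x|lborel. k x)"
    by (rule LINT_symmetric_interval_tendsto[OF k])
  moreover have "(\<lambda>n. h (real n) - h (- real n)) \<longlonglongrightarrow> 0 - 0"
    by (intro tendsto_diff filterlim_compose[OF is_primitive_tendsto_at_top[OF assms] filterlim_real_sequentially]
       filterlim_compose[OF is_primitive_tendsto_at_bot[OF assms]]
       filterlim_uminus_at_bot_at_top[THEN filterlim_compose] filterlim_real_sequentially)
  moreover have "(\<lambda>n. LINT x:{-real n..real n}|lborel. k x) = (\<lambda>n. h (real n) - h (- real n))"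
    by (simp add: is_primitive_integral[OF hk])
  ultimately show ?thesis using LIMSEQ_unique by (metis diff_zero)
qed

text \<open>Integrate from \<open>-\<infinity>\<close>, where \<open>h\<close> vanishes.\<close>

lemma is_primitive_abs_le:
  assumes hk: "is_primitive h k" and k: "integrable lborel k" and h: "integrable lborel h"
  shows "\<bar>h x\<bar> \<le> (LINT y|lborel. \<bar>k y\<bar>)"
proof -
  have "((\<lambda>a. \<bar>h x - h a\<bar>) \<longlongrightarrow> \<bar>h x - 0\<bar>) at_bot"
    by (intro tendsto_intros is_primitive_tendsto_at_bot[OF assms])
  moreover have "eventually (\<lambda>a. \<bar>h x - h a\<bar> \<le> (LINT y|lborel. \<bar>k y\<bar>)) at_bot"
    using eventually_le_at_bot[of x]
  proof eventually_elim
    case (elim a)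
    have "\<bar>h x - h a\<bar> = \<bar>LINT y:{a..x}|lborel. k y\<bar>" by (simp add: is_primitive_integral[OF hk elim])
    also have "\<dots> \<le> (LINT y:{a..x}|lborel. \<bar>k y\<bar>)"
      by (rule LINT_abs_le[OF is_primitive_locally_integrable[OF hk] elim])
    also have "\<dots> \<le> (LINT y|lborel. \<bar>k y\<bar>)"
      unfolding set_lebesgue_integral_def using k
      by (intro integral_mono integrable_mult_indicator) (auto simp: indicator_def)
    finally show ?case .
  qed
  ultimately show ?thesis
    using tendsto_upperbound by (metis diff_zero trivial_limit_at_bot_linorder)
qed

section \<open>Weak derivatives and primitives\<close>

text \<open>These approximations transfer information about test functions to integrals over intervals.\<close>

lemma ex_test_approx_indicator:
  fixes a b :: real
  assumes "a < b"
  shows "\<exists>c. (\<forall>n::nat. test_function (c n)) \<and> (\<forall>n x. \<bar>c n x\<bar> \<le> indicator {a..b+1} x) \<and>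
    (\<forall>x. (\<lambda>n. c n x) \<longlonglongrightarrow> indicator {a<..b} x)"
proof -
  obtain S :: "real \<Rightarrow> real" where S: "\<And>k. Ck k S" "\<And>x. x \<le> 0 \<Longrightarrow> S x = 0" "\<And>x. x \<ge> 1 \<Longrightarrow> S x = 1"
    "\<And>x. 0 \<le> S x \<and> S x \<le> 1" using ex_smooth_step by blast
  define T where "T c n x = S (real (Suc n) * (x - c))" for c n x
  have T0: "T c n x = 0" if "x \<le> c" for c n x
    unfolding T_def using that by (intro S(2)) (auto simp: mult_le_0_iff)
  have T1: "T c n x = 1" if "x \<ge> c + 1" for c n x
  proof -
    have "real (Suc n) * (x - c) \<ge> 1 * 1" using that by (intro mult_mono) auto
    then show ?thesis unfolding T_def by (intro S(3)) auto
  qed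
  have Tb: "0 \<le> T c n x \<and> T c n x \<le> 1" for c n x unfolding T_def by (rule S(4))
  have Tlim: "(\<lambda>n. T c n x) \<longlonglongrightarrow> indicator {c<..} x" for c x
  proof (cases "x \<le> c")
    case True then show ?thesis by (simp add: T0)
  next
    case False
    then obtain N :: nat where N: "real N * (x - c) > 1" using reals_Archimedean3[of "x - c"] by auto
    have "T c n x = 1" if "n \<ge> N" for n
    proof -
      have "real (Suc n) * (x - c) \<ge> real N * (x - c)" using that False by (intro mult_right_mono) auto
      then show ?thesis unfolding T_def using N by (intro S(3)) auto
    qed
    then have "eventually (\<lambda>n. T c n x = indicator {c<..} x) sequentially"
      using False by (auto simp: eventually_sequentially)
    then show ?thesis by (rule tendsto_eventually)
  qed
  have TC: "Ck k (T c n)" for k c n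
    using Ck_affine[OF bounded_linear_mult_right[of "real (Suc n)"] S(1), of k "- real (Suc n) * c"]
    unfolding T_def by (simp add: algebra_simps)
  define c where "c n x = T a n x - T b n x" for n x
  have z: "c n x = 0" if "x \<notin> {a..b+1}" for n x
    using that assms T0[of x a] T0[of x b] T1[of a x] T1[of b x] by (cases "x < a") (auto simp: c_def)
  have "test_function (c n)" for n
  proof (rule test_functionI[of _ "\<bar>a\<bar> + \<bar>b\<bar> + 1"])
    show "Ck k (c n)" for k unfolding c_def using Ck_diff[OF TC TC] by simp
    show "c n x = 0" if "\<bar>a\<bar> + \<bar>b\<bar> + 1 < \<bar>x\<bar>" for x using that by (intro z) auto
  qed
  moreover have "\<bar>c n x\<bar> \<le> indicator {a..b+1} x" for n x
    using z Tb[of a n x] Tb[of b n x] by (auto simp: indicator_def c_def abs_le_iff) 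
  moreover have "(\<lambda>n. c n x) \<longlonglongrightarrow> indicator {a<..b} x" for x
  proof -
    have "(\<lambda>n. c n x) \<longlonglongrightarrow> indicator {a<..} x - indicator {b<..} x"
      unfolding c_def by (intro tendsto_diff Tlim)
    moreover have "indicator {a<..} x - indicator {b<..} x = (indicator {a<..b} x :: real)"
      using assms by (auto simp: indicator_def)
    ultimately show ?thesis by simp
  qed
  ultimately show ?thesis by blast
qed

text \<open>The half-open intervals generate the Borel sets and are closed under intersection, so the
  integrals over all bounded Borel sets vanish.\<close>

lemma AE_zero_of_interval_integrals:
  assumes h: "locally_integrable h" and z: "\<And>a b. a < b \<Longrightarrow> (LINT x:{a<..b}|lborel. h x) = 0"
  shows "AE x in lborel. h x = 0"
proof -
  have [measurable]: "h \<in> borel_measurable borel" by (rule locally_integrable_measurable[OF h])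
  have *: "AE x in lborel. indicator {-real n<..real n} x *\<^sub>R h x = 0" for n
  proof (rule sigma_finite_measure.density_zero[OF lborel.sigma_finite_measure_axioms])
    let ?g = "\<lambda>x. indicator {-real n<..real n} x *\<^sub>R h x"
    show int: "integrable lborel ?g"
    proof -
      have "{-real n<..real n} \<subseteq> {-real n..real n}" by (simp add: subset_iff)
      then show ?thesis
        using set_integrable_subset[OF locally_integrableD[OF h, of "-real n" "real n"], of "{-real n<..real n}"]
        by (simp add: set_integrable_def)
    qed
    fix A :: "real set" assume A: "A \<in> sets lborel"
    have si: "set_integrable lborel B ?g" if "B \<in> sets lborel" for B
      using integrable_mult_indicator[OF that int] by (simp add: set_integrable_def)
    have "Int_stable (range (\<lambda>(a, b). {a <.. b::real}))"
    proof (rule Int_stableI)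
      fix X Y assume "X \<in> range (\<lambda>(a, b). {a <.. b::real})" "Y \<in> range (\<lambda>(a, b). {a <.. b::real})"
      then show "X \<inter> Y \<in> range (\<lambda>(a, b). {a <.. b::real})"
        by (auto simp: image_iff split_beta) (metis greaterThanAtMost_def fst_conv snd_conv Int_greaterThanAtMost)
    qed
    moreover have "range (\<lambda>(a, b). {a <.. b::real}) \<subseteq> Pow UNIV" by auto
    moreover have "A \<in> sigma_sets UNIV (range (\<lambda>(a, b). {a <.. b::real}))"
      using A by (simp add: borel_sigma_sets_Ioc)
    ultimately show "set_lebesgue_integral lborel A ?g = 0"
    proof (induction rule: sigma_sets_induct_disjoint)
      case (basic A)
      then obtain a b where ab: "A = {a<..b}" by auto
      have "set_lebesgue_integral lborel A ?g = (LINT x:{max a (-real n)<..min b (real n)}|lborel. h x)"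
        unfolding set_lebesgue_integral_def ab
        by (intro Bochner_Integration.integral_cong) (auto simp: indicator_def)
      also have "\<dots> = 0"
      proof (cases "max a (-real n) < min b (real n)")
        case False
        then have e: "{max a (-real n)<..min b (real n)} = {}" by auto
        show ?thesis unfolding e by (simp add: set_lebesgue_integral_def)
      qed (rule z)
      finally show ?case .
    next
      case empty
      then show ?case by (simp add: set_lebesgue_integral_def)
    next
      case (compl A)
      then have m: "A \<in> sets lborel" by (simp add: borel_sigma_sets_Ioc)
      have "set_lebesgue_integral lborel UNIV ?g = (LINT x:{-real n<..real n}|lborel. h x)"
        unfolding set_lebesgue_integral_def by simp
      also have "\<dots> = 0"
        using z[of "-real n" "real n"] by (cases "n = 0") (auto simp: set_lebesgue_integral_def)
      finally have "set_lebesgue_integral lborel UNIV ?g = 0" .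
      moreover have "set_lebesgue_integral lborel (A \<union> (UNIV - A)) ?g =
          set_lebesgue_integral lborel A ?g + set_lebesgue_integral lborel (UNIV - A) ?g"
        using m by (intro set_integral_Un si) auto
      ultimately show ?case using compl by simp
    next
      case (union A)
      then have m: "A i \<in> sets lborel" for i by (auto simp: borel_sigma_sets_Ioc)
      have "set_lebesgue_integral lborel (\<Union>i. A i) ?g = (\<Sum>i. set_lebesgue_integral lborel (A i) ?g)"
        using union m by (intro lebesgue_integral_countable_add si) (auto simp: disjoint_family_on_def)
      then show ?case using union by simp
    qed
  qed
  have "AE x in lborel. \<forall>n::nat. indicator {-real n<..real n} x *\<^sub>R h x = 0"
    unfolding AE_all_countable using * by blast
  then show ?thesis
  proof eventually_elim
    case (elim x)
    obtain n where "\<bar>x\<bar> < real n" using reals_Archimedean2 by blast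
    then show ?case using elim[rule_format, of n] by (auto simp: indicator_def split: if_splits)
  qed
qed

lemma test_times_integrable:
  assumes "locally_integrable h" "test_function \<psi>"
  shows "integrable lborel (\<lambda>x. h x * \<psi> x)"
proof -
  obtain R where R: "R > 0" "\<And>x. R < \<bar>x\<bar> \<Longrightarrow> \<psi> x = 0" using test_functionE[OF assms(2)] by blast
  have "set_integrable lborel {-R..R} (\<lambda>x. \<psi> x * h x)"
    by (intro locally_integrableD locally_integrable_mult_continuous assms test_function_continuous)
  moreover have "(\<lambda>x. indicator {-R..R} x *\<^sub>R (\<psi> x * h x)) = (\<lambda>x. h x * \<psi> x)"
  proof
    fix x
    show "indicator {-R..R} x *\<^sub>R (\<psi> x * h x) = h x * \<psi> x"
      using R(2)[of x] by (cases "R < \<bar>x\<bar>") (auto simp: indicator_def split: abs_split)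
  qed
  ultimately show ?thesis by (simp only: set_integrable_def)
qed

lemma test_times_LINT:
  fixes h \<psi> :: "real \<Rightarrow> real"
  assumes "\<And>x. R < \<bar>x\<bar> \<Longrightarrow> \<psi> x = 0"
  shows "(LINT x|lborel. h x * \<psi> x) = (LINT x:{-R..R}|lborel. h x * \<psi> x)"
  unfolding set_lebesgue_integral_def
proof (rule Bochner_Integration.integral_cong)
  fix x
  show "h x * \<psi> x = indicator {-R..R} x *\<^sub>R (h x * \<psi> x)"
    using assms[of x] by (cases "R < \<bar>x\<bar>") (auto simp: indicator_def split: abs_split)
qed simp

lemma du_Bois_Reymond:
  assumes h: "locally_integrable h" and z: "\<And>\<psi>. test_function \<psi> \<Longrightarrow> (LINT x|lborel. h x * \<psi> x) = 0"
  shows "AE x in lborel. h x = 0"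
proof (rule AE_zero_of_interval_integrals[OF h])
  have [measurable]: "h \<in> borel_measurable borel" by (rule locally_integrable_measurable[OF h])
  fix a b :: real assume "a < b"
  then obtain c where c: "\<And>n::nat. test_function (c n)" "\<And>n x. \<bar>c n x\<bar> \<le> indicator {a..b+1} x"
    "\<And>x. (\<lambda>n. c n x) \<longlonglongrightarrow> indicator {a<..b} x"
    using ex_test_approx_indicator by meson
  have "(\<lambda>n. LINT x|lborel. h x * c n x) \<longlonglongrightarrow> (LINT x|lborel. h x * indicator {a<..b} x)"
  proof (rule integral_dominated_convergence[where w="\<lambda>x. indicator {a..b+1} x * \<bar>h x\<bar>"])
    show "integrable lborel (\<lambda>x. indicator {a..b+1} x * \<bar>h x\<bar>)"
      using locally_integrableD[OF locally_integrable_abs[OF h]] by (simp add: set_integrable_def)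
    show "AE x in lborel. (\<lambda>n. h x * c n x) \<longlonglongrightarrow> h x * indicator {a<..b} x"
      by (intro AE_I2 tendsto_mult tendsto_const c(3))
    show "AE x in lborel. norm (h x * c n x) \<le> indicator {a..b+1} x * \<bar>h x\<bar>" for n
      using c(2)[of n] by (auto simp: abs_mult mult.commute[of "\<bar>h _\<bar>"] intro!: mult_right_mono)
    show "(\<lambda>x. h x * c n x) \<in> borel_measurable lborel" for n
      using continuous_measurable[OF test_function_continuous[OF c(1)[of n]]] by simp
  qed auto
  moreover have "(LINT x|lborel. h x * c n x) = 0" for n by (rule z[OF c(1)])
  ultimately have "(LINT x|lborel. h x * indicator {a<..b} x) = 0"
    using LIMSEQ_unique tendsto_const by (metis (no_types, lifting) LIMSEQ_const_iff ext)
  then show "(LINT x:{a<..b}|lborel. h x) = 0"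
    by (simp add: set_lebesgue_integral_def mult.commute)
qed

lemma is_primitive_unique:
  assumes "is_primitive f g" "is_primitive f g'"
  shows "AE x in lborel. g x = g' x"
proof -
  have l: "locally_integrable (\<lambda>x. g x - g' x)"
    using assms by (auto simp: is_primitive_def intro: locally_integrable_diff)
  have "is_primitive (\<lambda>x. f x - f x) (\<lambda>x. g x - g' x)" by (rule is_primitive_diff[OF assms])
  then have *: "(LINT x:{a..b}|lborel. g x - g' x) = 0" if "a \<le> b" for a b
    using is_primitive_integral that by fastforce
  have [measurable]: "g \<in> borel_measurable borel" "g' \<in> borel_measurable borel"
    using assms by (auto simp: is_primitive_def intro: locally_integrable_measurable)
  have "AE x in lborel. g x - g' x = 0"
  proof (rule AE_zero_of_interval_integrals[OF l])
    fix a b :: real assume "a < b"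
    have "(LINT x:{a<..b}|lborel. g x - g' x) = (LINT x:{a..b}|lborel. g x - g' x)"
      using AE_lborel_singleton[of a]
      by (intro set_integral_cong_set) (auto simp: set_borel_measurable_def)
    then show "(LINT x:{a<..b}|lborel. g x - g' x) = 0" using * \<open>a < b\<close> by simp
  qed
  then show ?thesis by simp
qed

text \<open>The product with a test function is a primitive with compact support, so its derivative has
  integral \<open>0\<close>.\<close>

lemma is_primitive_imp_weak_derivative:
  assumes fg: "is_primitive f g"
  shows "has_weak_derivative f g"
  unfolding has_weak_derivative_def
proof (intro conjI allI impI)
  show lf: "locally_integrable f" by (rule locally_integrable_continuous[OF is_primitive_continuous[OF fg]])
  show lg: "locally_integrable g" using fg by (simp add: is_primitive_def)
  fix \<psi> :: "real \<Rightarrow> real" assume \<psi>: "test_function \<psi>"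
  then obtain R where R: "R > 0" "\<And>x. R < \<bar>x\<bar> \<Longrightarrow> \<psi> x = 0" using test_functionE by blast
  have d: "test_function (deriv \<psi>)" by (rule test_function_deriv[OF \<psi>])
  have z: "\<psi> (R + 1) = 0" "\<psi> (- (R + 1)) = 0" using R by auto
  have "is_primitive (\<lambda>x. f x * \<psi> x) (\<lambda>x. f x * deriv \<psi> x + g x * \<psi> x)"
    by (intro is_primitive_mult fg is_primitive_C1 test_function_has_derivative \<psi> test_function_continuous d)
  then have pr: "is_primitive (\<lambda>x. f x * \<psi> x) (\<lambda>x. f x * deriv \<psi> x + g x * \<psi> x)" .
  have i: "integrable lborel (\<lambda>x. f x * deriv \<psi> x + g x * \<psi> x)"
    by (intro Bochner_Integration.integrable_add test_times_integrable lf lg \<psi> d)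
  have "(LINT x|lborel. f x * deriv \<psi> x + g x * \<psi> x) = 0"
    by (rule is_primitive_integral_zero[OF pr i test_times_integrable[OF lf \<psi>]])
  then show "(LINT x|lborel. f x * deriv \<psi> x) = - (LINT x|lborel. g x * \<psi> x)"
    using Bochner_Integration.integral_add[OF test_times_integrable[OF lf d] test_times_integrable[OF lg \<psi>]] by simp
qed

text \<open>Every test function differs from a fixed multiple of a bump by the derivative of a test
  function; so a function whose weak derivative vanishes acts on test functions as a constant.\<close>

lemma weak_derivative_zero_imp_const:
  assumes h: "locally_integrable h"
    and z: "\<And>\<psi>. test_function \<psi> \<Longrightarrow> (LINT x|lborel. h x * deriv \<psi> x) = 0"
  shows "\<exists>c. AE x in lborel. h x = c"
proof -
  obtain B :: "real \<Rightarrow> real" where B: "test_function B" "\<And>x. x \<notin> {0..1} \<Longrightarrow> B x = 0" "integral {0..1} B = 1"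
    using ex_bump by blast
  define c where "c = (LINT x|lborel. h x * B x)"
  have lc: "locally_integrable (\<lambda>x. c)" by (rule locally_integrable_continuous) auto
  have li: "locally_integrable \<psi>" if "test_function \<psi>" for \<psi>
    by (rule locally_integrable_continuous[OF test_function_continuous[OF that]])
  have "AE x in lborel. h x - c = 0"
  proof (rule du_Bois_Reymond)
    show "locally_integrable (\<lambda>x. h x - c)" by (intro locally_integrable_diff h lc)
    fix \<psi> :: "real \<Rightarrow> real" assume \<psi>: "test_function \<psi>"
    then obtain R where R: "R > 0" "\<And>x. R < \<bar>x\<bar> \<Longrightarrow> \<psi> x = 0" using test_functionE by blast
    define m where "m = integral {- (R + 1)..R + 1} \<psi>"
    have R': "R + 1 < \<bar>x\<bar> \<Longrightarrow> \<psi> x = 0" for x using R by auto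
    have intB: "integral {-(R+1)..R+1} B = 1"
    proof -
      have "integral {0..1} B = integral {-(R+1)..R+1} (\<lambda>x. if x \<in> {0..1} then B x else 0)"
        using R(1) by (simp only: integral_restrict_Int) (simp add: min_def max_def)
      also have "\<dots> = integral {-(R+1)..R+1} B"
        using B(2) by (intro Henstock_Kurzweil_Integration.integral_cong) auto
      finally show ?thesis using B(3) by simp
    qed
    define \<theta> where "\<theta> x = \<psi> x - m * B x" for x
    have \<theta>: "test_function \<theta>" unfolding \<theta>_def
      by (intro test_function_diff test_function_mult_const \<psi> B)
    have "\<exists>F. test_function F \<and> deriv F = \<theta>"
    proof (rule test_function_antiderivative[OF \<theta>])
      show "\<theta> x = 0" if "R + 1 < \<bar>x\<bar>" for x
      proof -
        have "x \<notin> {0..1}" using that R(1) by auto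
        then show ?thesis using R'[OF that] B(2) by (simp add: \<theta>_def)
      qed
      have "\<psi> integrable_on {- (R + 1)..R + 1}" "B integrable_on {- (R + 1)..R + 1}"
        using test_function_continuous \<psi> B(1) integrable_continuous_interval by blast+
      then have "integral {- (R + 1)..R + 1} \<theta> = integral {- (R + 1)..R + 1} \<psi> - m * integral {- (R + 1)..R + 1} B"
        unfolding \<theta>_def
        by (subst Henstock_Kurzweil_Integration.integral_diff) (auto intro: integrable_on_mult_right)
      then show "integral {- (R + 1)..R + 1} \<theta> = 0" unfolding intB m_def by simp
      show "0 \<le> R + 1" using R by simp
    qed
    then have "(LINT x|lborel. h x * \<theta> x) = 0" using z by metis
    moreover have "(LINT x|lborel. h x * \<theta> x) = (LINT x|lborel. h x * \<psi> x) - m * c"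
    proof -
      have "h x * \<theta> x = h x * \<psi> x - m * (h x * B x)" for x by (simp add: \<theta>_def algebra_simps)
      then show ?thesis
        using test_times_integrable[OF h \<psi>] test_times_integrable[OF h B(1)] by (simp add: c_def)
    qed
    moreover have "(LINT x|lborel. c * \<psi> x) = c * m"
    proof -
      have "(LINT x|lborel. 1 * \<psi> x) = (LINT x:{-(R+1)..R+1}|lborel. 1 * \<psi> x)"
        by (rule test_times_LINT[OF R'])
      also have "\<dots> = m" unfolding m_def using LINT_eq_integral(1)[OF li[OF \<psi>]] by simp
      finally show ?thesis by simp
    qed
    ultimately show "(LINT x|lborel. (h x - c) * \<psi> x) = 0"
      unfolding left_diff_distrib
      using Bochner_Integration.integral_diff[OF test_times_integrable[OF h \<psi>] test_times_integrable[OF lc \<psi>]]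
      by (auto simp: mult.commute)
  qed
  then show ?thesis by auto
qed

lemma weak_derivative_imp_AE_primitive:
  assumes "has_weak_derivative f g"
  shows "\<exists>F. is_primitive F g \<and> (AE x in lborel. f x = F x)"
proof -
  have lf: "locally_integrable f" and lg: "locally_integrable g"
    and w: "\<And>\<psi>. test_function \<psi> \<Longrightarrow> (LINT x|lborel. f x * deriv \<psi> x) = - (LINT x|lborel. g x * \<psi> x)"
    using assms by (auto simp: has_weak_derivative_def)
  obtain F where F: "is_primitive F g" using is_primitive_integral_from_0[OF lg] by blast
  have lF: "locally_integrable F" by (rule locally_integrable_continuous[OF is_primitive_continuous[OF F]])
  have "\<exists>c. AE x in lborel. f x - F x = c"
  proof (rule weak_derivative_zero_imp_const)
    show "locally_integrable (\<lambda>x. f x - F x)" by (rule locally_integrable_diff[OF lf lF])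
    fix \<psi> :: "real \<Rightarrow> real" assume \<psi>: "test_function \<psi>"
    have "(LINT x|lborel. F x * deriv \<psi> x) = - (LINT x|lborel. g x * \<psi> x)"
      using is_primitive_imp_weak_derivative[OF F] \<psi> by (simp add: has_weak_derivative_def)
    then show "(LINT x|lborel. (f x - F x) * deriv \<psi> x) = 0"
      using w[OF \<psi>] test_times_integrable[OF lf test_function_deriv[OF \<psi>]]
        test_times_integrable[OF lF test_function_deriv[OF \<psi>]]
      by (simp add: left_diff_distrib)
  qed
  then obtain c where c: "AE x in lborel. f x - F x = c" by blast
  show ?thesis
    by (intro exI[of _ "\<lambda>x. F x + c"] conjI is_primitive_add_const F)
       (use c in eventually_elim, simp)
qed

lemma continuous_AE_eq:
  fixes f g :: "real \<Rightarrow> real"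
  assumes "continuous_on UNIV f" "continuous_on UNIV g" "AE x in lborel. f x = g x"
  shows "f x = g x"
proof (rule ccontr)
  assume "f x \<noteq> g x"
  have o: "open {x. f x \<noteq> g x}"
    using assms(1,2) by (intro open_Collect_neq)
  have "{x. f x \<noteq> g x} \<in> null_sets lborel"
    using assms(3) o by (intro AE_iff_null_sets[THEN iffD2]) auto
  then have "negligible {x. f x \<noteq> g x}"
    by (simp add: negligible_iff_null_sets null_sets_completionI)
  then show False using open_not_negligible[OF o] \<open>f x \<noteq> g x\<close> by auto
qed

text \<open>For the continuous representative of a field the identity holds at every point. This is how
  weak derivatives enter all later arguments.\<close>

lemma weak_derivative_continuous_imp_primitive:
  assumes "has_weak_derivative f g" "continuous_on UNIV f"
  shows "is_primitive f g"
proof -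
  obtain F where F: "is_primitive F g" "AE x in lborel. f x = F x"
    using weak_derivative_imp_AE_primitive[OF assms(1)] by blast
  have "f = F" using continuous_AE_eq[OF assms(2) is_primitive_continuous[OF F(1)] F(2)] by auto
  then show ?thesis using F by simp
qed

section \<open>The Hilbert space of square-integrable functions\<close>

definition square_integrable :: "(real \<Rightarrow> real) \<Rightarrow> bool" where
  "square_integrable f \<longleftrightarrow> f \<in> borel_measurable borel \<and> integrable lborel (\<lambda>x. (f x)\<^sup>2)"

lemma square_integrableI:
  "f \<in> borel_measurable borel \<Longrightarrow> integrable lborel (\<lambda>x. (f x)\<^sup>2) \<Longrightarrow> square_integrable f"
  by (simp add: square_integrable_def)

lemma square_integrable_measurable [measurable_dest]:
  "square_integrable f \<Longrightarrow> f \<in> borel_measurable borel"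
  by (simp add: square_integrable_def)

lemma square_integrable_square: "square_integrable f \<Longrightarrow> integrable lborel (\<lambda>x. (f x)\<^sup>2)"
  by (simp add: square_integrable_def)

lemma square_integrable_bound:
  assumes g: "integrable lborel g" and f: "f \<in> borel_measurable borel" and b: "\<And>x. (f x)\<^sup>2 \<le> g x"
  shows "square_integrable f"
proof (rule square_integrableI[OF f])
  show "integrable lborel (\<lambda>x. (f x)\<^sup>2)"
  proof (rule Bochner_Integration.integrable_bound[OF g])
    show "AE x in lborel. norm ((f x)\<^sup>2) \<le> norm (g x)"
      using b by (intro AE_I2) (smt (verit) real_norm_def zero_le_power2)
  qed (use f in measurable)
qed

lemma square_integrable_mult:
  assumes f: "square_integrable f" and g: "square_integrable g"
  shows "integrable lborel (\<lambda>x. f x * g x)"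
proof (rule Bochner_Integration.integrable_bound)
  show "integrable lborel (\<lambda>x. (f x)\<^sup>2 + (g x)\<^sup>2)"
    using f g by (simp add: square_integrable_def)
  have "\<bar>f x * g x\<bar> \<le> (f x)\<^sup>2 + (g x)\<^sup>2" for x
  proof -
    have "2 * (\<bar>f x\<bar> * \<bar>g x\<bar>) \<le> (f x)\<^sup>2 + (g x)\<^sup>2"
      using sum_squares_bound[of "\<bar>f x\<bar>" "\<bar>g x\<bar>"] by (simp add: mult.assoc)
    moreover have "0 \<le> \<bar>f x\<bar> * \<bar>g x\<bar>" by simp
    ultimately show ?thesis unfolding abs_mult by linarith
  qed
  then show "AE x in lborel. norm (f x * g x) \<le> norm ((f x)\<^sup>2 + (g x)\<^sup>2)" by simp
  show "(\<lambda>x. f x * g x) \<in> borel_measurable lborel" using f g by measurable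
qed

lemma square_integrable_add:
  assumes f: "square_integrable f" and g: "square_integrable g"
  shows "square_integrable (\<lambda>x. f x + g x)"
proof (rule square_integrableI)
  have "integrable lborel (\<lambda>x. (f x)\<^sup>2 + (g x)\<^sup>2 + 2 * (f x * g x))"
    using square_integrable_mult[OF f g] f g by (simp add: square_integrable_def)
  then show "integrable lborel (\<lambda>x. (f x + g x)\<^sup>2)" by (simp add: power2_sum mult.assoc)
  show "(\<lambda>x. f x + g x) \<in> borel_measurable borel" using f g by measurable
qed

lemma square_integrable_cmult: "square_integrable f \<Longrightarrow> square_integrable (\<lambda>x. c * f x)"
  by (auto simp: square_integrable_def power_mult_distrib)

lemma square_integrable_minus: "square_integrable f \<Longrightarrow> square_integrable (\<lambda>x. - f x)"
  using square_integrable_cmult[of f "-1"] by simp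

lemma square_integrable_diff:
  "square_integrable f \<Longrightarrow> square_integrable g \<Longrightarrow> square_integrable (\<lambda>x. f x - g x)"
  using square_integrable_add[of f "\<lambda>x. - g x"] square_integrable_minus[of g] by simp

lemma square_integrable_zero: "square_integrable (\<lambda>x. 0)"
  by (simp add: square_integrable_def)

lemma square_integrable_locally_integrable:
  assumes "square_integrable f"
  shows "locally_integrable f"
proof (rule locally_integrable_bound)
  show "locally_integrable (\<lambda>x. 1 + (f x)\<^sup>2)"
    using square_integrable_square[OF assms]
    by (intro locally_integrable_add locally_integrable_continuous[of "\<lambda>x. 1"] locally_integrable_integrable) auto
  fix x
  have "2 * \<bar>f x\<bar> \<le> 1 + (f x)\<^sup>2" using sum_squares_bound[of 1 "\<bar>f x\<bar>"] by simp
  then show "\<bar>f x\<bar> \<le> \<bar>1 + (f x)\<^sup>2\<bar>" by (smt (verit) zero_le_power2)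
qed (use assms in measurable)

lemma test_function_square_integrable:
  assumes "test_function \<psi>"
  shows "square_integrable \<psi>"
proof (rule square_integrableI)
  show "integrable lborel (\<lambda>x. (\<psi> x)\<^sup>2)"
    using test_times_integrable[OF locally_integrable_continuous[OF test_function_continuous[OF assms]] assms]
    by (simp add: power2_eq_square)
qed (intro continuous_measurable test_function_continuous assms)

text \<open>Making the quotient a type of class \<open>real_inner\<close> and \<open>banach\<close> provides derivatives, integrals and
  uniform limits of curves in \<open>L\<^sup>2\<close>.\<close>

definition l2_rel :: "(real \<Rightarrow> real) \<Rightarrow> (real \<Rightarrow> real) \<Rightarrow> bool" where
  "l2_rel f g \<longleftrightarrow> square_integrable f \<and> square_integrable g \<and> (AE x in lborel. f x = g x)"

quotient_type l2 = "real \<Rightarrow> real" / partial: l2_rel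
proof (rule part_equivpI)
  show "\<exists>x. l2_rel x x"
    by (rule exI[of _ "\<lambda>x. 0"]) (simp add: l2_rel_def square_integrable_zero)
  show "symp l2_rel" by (auto simp: symp_def l2_rel_def)
  show "transp l2_rel"
  proof (rule transpI)
    fix f g h assume "l2_rel f g" "l2_rel g h"
    then have *: "square_integrable f" "square_integrable h" "AE x in lborel. f x = g x" "AE x in lborel. g x = h x"
      by (auto simp: l2_rel_def)
    have "AE x in lborel. f x = h x" using *(3,4) by eventually_elim simp
    then show "l2_rel f h" using * by (simp add: l2_rel_def)
  qed
qed

lemma l2_rel_combine:
  assumes "l2_rel f f'" "l2_rel g g'"
    and "\<And>f g. square_integrable f \<Longrightarrow> square_integrable g \<Longrightarrow> square_integrable (\<lambda>x. h (f x) (g x))"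
  shows "l2_rel (\<lambda>x. h (f x) (g x)) (\<lambda>x. h (f' x) (g' x))"
proof -
  have *: "square_integrable f" "square_integrable f'" "square_integrable g" "square_integrable g'"
    "AE x in lborel. f x = f' x" "AE x in lborel. g x = g' x"
    using assms(1,2) by (auto simp: l2_rel_def)
  have "AE x in lborel. h (f x) (g x) = h (f' x) (g' x)" using *(5,6) by eventually_elim simp
  then show ?thesis using assms(3) * by (simp add: l2_rel_def)
qed

instantiation l2 :: real_inner
begin

lift_definition zero_l2 :: l2 is "\<lambda>x. 0"
  by (simp add: l2_rel_def square_integrable_zero)

lift_definition plus_l2 :: "l2 \<Rightarrow> l2 \<Rightarrow> l2" is "\<lambda>f g x. f x + g x"
  by (rule l2_rel_combine[where h="\<lambda>a b. a + b"]) (auto intro: square_integrable_add)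

lift_definition minus_l2 :: "l2 \<Rightarrow> l2 \<Rightarrow> l2" is "\<lambda>f g x. f x - g x"
  by (rule l2_rel_combine[where h="\<lambda>a b. a - b"]) (auto intro: square_integrable_diff)

lift_definition uminus_l2 :: "l2 \<Rightarrow> l2" is "\<lambda>f x. - f x"
  subgoal for f g by (rule l2_rel_combine[of f g f g "\<lambda>a b. - a"]) (auto intro: square_integrable_minus)
  done

lift_definition scaleR_l2 :: "real \<Rightarrow> l2 \<Rightarrow> l2" is "\<lambda>c f x. c * f x"
  subgoal for c f g by (rule l2_rel_combine[of f g f g "\<lambda>a b. c * a"]) (auto intro: square_integrable_cmult)
  done

lift_definition inner_l2 :: "l2 \<Rightarrow> l2 \<Rightarrow> real" is "\<lambda>f g. LINT x|lborel. f x * g x"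
proof -
  fix f f' g g' assume *: "l2_rel f f'" "l2_rel g g'"
  then have [measurable]: "f \<in> borel_measurable borel" "f' \<in> borel_measurable borel"
    "g \<in> borel_measurable borel" "g' \<in> borel_measurable borel"
    by (auto simp: l2_rel_def square_integrable_def)
  show "(LINT x|lborel. f x * g x) = (LINT x|lborel. f' x * g' x)"
    using * by (intro integral_cong_AE) (auto simp: l2_rel_def)
qed

definition norm_l2 :: "l2 \<Rightarrow> real" where "norm_l2 f = sqrt (inner f f)"
definition dist_l2 :: "l2 \<Rightarrow> l2 \<Rightarrow> real" where "dist_l2 f g = norm (f - g)"
definition sgn_l2 :: "l2 \<Rightarrow> l2" where "sgn_l2 f = inverse (norm f) *\<^sub>R f"
definition uniformity_l2 :: "(l2 \<times> l2) filter" where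
  "uniformity_l2 = (INF e\<in>{0<..}. principal {(x, y). dist x y < e})"
definition open_l2 :: "l2 set \<Rightarrow> bool" where
  "open_l2 S \<longleftrightarrow> (\<forall>x\<in>S. \<forall>\<^sub>F (x', y) in uniformity. x' = x \<longrightarrow> y \<in> S)"

instance
proof
  fix a b c :: l2 and r s :: real
  show "a + b + c = a + (b + c)"
    by transfer (auto simp: l2_rel_def algebra_simps intro: square_integrable_add)
  show "a + b = b + a" by transfer (auto simp: l2_rel_def algebra_simps intro: square_integrable_add)
  show "0 + a = a" by transfer (auto simp: l2_rel_def)
  show "- a + a = 0" by transfer (auto simp: l2_rel_def square_integrable_zero)
  show "a - b = a + - b"
    by transfer (auto simp: l2_rel_def intro: square_integrable_add square_integrable_diff)
  show "r *\<^sub>R (a + b) = r *\<^sub>R a + r *\<^sub>R b"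
    by transfer (auto simp: l2_rel_def algebra_simps intro!: square_integrable_add square_integrable_cmult)
  show "(r + s) *\<^sub>R a = r *\<^sub>R a + s *\<^sub>R a"
    by transfer (auto simp: l2_rel_def algebra_simps intro!: square_integrable_add square_integrable_cmult)
  show "r *\<^sub>R s *\<^sub>R a = (r * s) *\<^sub>R a"
    by transfer (auto simp: l2_rel_def algebra_simps intro!: square_integrable_cmult)
  show "1 *\<^sub>R a = a" by transfer (auto simp: l2_rel_def)
  show "sgn a = inverse (norm a) *\<^sub>R a" by (rule sgn_l2_def)
  show "dist a b = norm (a - b)" by (rule dist_l2_def)
  show "uniformity = (INF e\<in>{0<..}. principal {(x, y :: l2). dist x y < e})"
    by (rule uniformity_l2_def)
  show "open S \<longleftrightarrow> (\<forall>x\<in>S. \<forall>\<^sub>F (x', y) in uniformity. x' = x \<longrightarrow> y \<in> S)" for S :: "l2 set"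
    by (rule open_l2_def)
  show "inner a b = inner b a" by transfer (simp add: mult.commute)
  show "inner (a + b) c = inner a c + inner b c"
    by transfer (simp add: l2_rel_def distrib_right square_integrable_mult)
  show "inner (r *\<^sub>R a) b = r * inner a b" by transfer (simp add: mult.assoc)
  show "0 \<le> inner a a" by transfer simp
  show "inner a a = 0 \<longleftrightarrow> a = 0"
  proof (transfer, goal_cases)
    case (1 f)
    then have f: "square_integrable f" by (simp add: l2_rel_def)
    then have "(LINT x|lborel. f x * f x) = 0 \<longleftrightarrow> (AE x in lborel. f x * f x = 0)"
      by (intro integral_nonneg_eq_0_iff_AE square_integrable_mult) auto
    then show ?case using f by (simp add: l2_rel_def square_integrable_zero)
  qed
  show "norm a = sqrt (inner a a)" by (rule norm_l2_def)
qed

end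

lemma l2_cases: obtains f where "square_integrable f" "a = abs_l2 f"
proof
  have "l2_rel (rep_l2 a) (rep_l2 a)" by (rule Quotient3_rep_reflp[OF Quotient3_l2])
  then show "square_integrable (rep_l2 a)" by (simp add: l2_rel_def)
  show "a = abs_l2 (rep_l2 a)" by (simp add: Quotient3_abs_rep[OF Quotient3_l2])
qed

lemma rep_l2_square_integrable: "square_integrable (rep_l2 a)"
  using Quotient3_rep_reflp[OF Quotient3_l2] by (simp add: l2_rel_def)

lemma abs_rep_l2: "abs_l2 (rep_l2 a) = a"
  by (rule Quotient3_abs_rep[OF Quotient3_l2])

lemma abs_l2_eq_iff:
  "square_integrable f \<Longrightarrow> square_integrable g \<Longrightarrow> abs_l2 f = abs_l2 g \<longleftrightarrow> (AE x in lborel. f x = g x)"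
  using Quotient3_rel[OF Quotient3_l2, of f g] by (auto simp: l2_rel_def)

lemma abs_l2_diff:
  "square_integrable f \<Longrightarrow> square_integrable g \<Longrightarrow> abs_l2 f - abs_l2 g = abs_l2 (\<lambda>x. f x - g x)"
  by (rule minus_l2.abs_eq) (auto simp: l2_rel_def)

lemma abs_l2_scaleR: "square_integrable f \<Longrightarrow> c *\<^sub>R abs_l2 f = abs_l2 (\<lambda>x. c * f x)"
  by (rule scaleR_l2.abs_eq) (auto simp: l2_rel_def)

lemma inner_abs_l2:
  "square_integrable f \<Longrightarrow> square_integrable g \<Longrightarrow> inner (abs_l2 f) (abs_l2 g) = (LINT x|lborel. f x * g x)"
  by (rule inner_l2.abs_eq) (auto simp: l2_rel_def)

lemma norm_abs_l2: "square_integrable f \<Longrightarrow> (norm (abs_l2 f))\<^sup>2 = (LINT x|lborel. (f x)\<^sup>2)"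
  unfolding power2_norm_eq_inner by (simp add: inner_abs_l2 power2_eq_square)

lemma LINT_mult_le_norm:
  assumes f: "square_integrable f" and g: "square_integrable g"
  shows "\<bar>LINT x|lborel. f x * g x\<bar> \<le> norm (abs_l2 f) * norm (abs_l2 g)"
  using Cauchy_Schwarz_ineq2[of "abs_l2 f" "abs_l2 g"] by (simp add: inner_abs_l2 f g)

lemma square_integrable_abs: "square_integrable f \<Longrightarrow> square_integrable (\<lambda>x. \<bar>f x\<bar>)"
  by (auto simp: square_integrable_def)

lemma norm_abs_l2_abs:
  assumes "square_integrable f"
  shows "norm (abs_l2 (\<lambda>x. \<bar>f x\<bar>)) = norm (abs_l2 f)"
proof (rule power2_eq_imp_eq)
  show "(norm (abs_l2 (\<lambda>x. \<bar>f x\<bar>)))\<^sup>2 = (norm (abs_l2 f))\<^sup>2"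
    unfolding norm_abs_l2[OF assms] norm_abs_l2[OF square_integrable_abs[OF assms]] by simp
qed simp_all

lemma LINT_abs_mult_le_norm:
  assumes f: "square_integrable f" and g: "square_integrable g"
  shows "(LINT x|lborel. \<bar>f x * g x\<bar>) \<le> norm (abs_l2 f) * norm (abs_l2 g)"
  using LINT_mult_le_norm[OF square_integrable_abs[OF f] square_integrable_abs[OF g]]
  unfolding norm_abs_l2_abs[OF f] norm_abs_l2_abs[OF g] abs_mult by linarith

lemma norm_abs_l2_mono:
  assumes f: "square_integrable f" and g: "square_integrable g" and le: "\<And>x. \<bar>f x\<bar> \<le> \<bar>g x\<bar>"
  shows "norm (abs_l2 f) \<le> norm (abs_l2 g)"
proof -
  have "(LINT x|lborel. (f x)\<^sup>2) \<le> (LINT x|lborel. (g x)\<^sup>2)"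
    using f g le by (intro integral_mono square_integrable_square) (auto simp: abs_le_square_iff)
  then have "(norm (abs_l2 f))\<^sup>2 \<le> (norm (abs_l2 g))\<^sup>2"
    unfolding norm_abs_l2[OF f] norm_abs_l2[OF g] .
  then show ?thesis by (rule power2_le_imp_le) simp
qed

subsection \<open>Completeness\<close>

text \<open>Along a subsequence with summable increments the functions converge almost everywhere,
  since on each bounded interval the increments are summable in \<open>L\<^sup>1\<close>; Fatou's lemma then
  gives convergence in norm.\<close>

lemma l2_fast_Cauchy_AE:
  fixes f :: "nat \<Rightarrow> real \<Rightarrow> real"
  assumes f: "\<And>n. square_integrable (f n)"
    and d: "\<And>n. (LINT x|lborel. (f (Suc n) x - f n x)\<^sup>2) \<le> (1/4)^n"
  shows "AE x in lborel. convergent (\<lambda>n. f n x)"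
proof -
  have [measurable]: "f n \<in> borel_measurable borel" for n using f by measurable
  define D where "D n x = \<bar>f (Suc n) x - f n x\<bar>" for n x
  have [measurable]: "D n \<in> borel_measurable borel" for n unfolding D_def by measurable
  have "AE x in lborel. (\<Sum>n. ennreal (D n x * indicator {-real m..real m} x)) \<noteq> \<infinity>" for m :: nat
  proof (rule nn_integral_noteq_infinite)
    have b: "(\<integral>\<^sup>+x. ennreal (D n x * indicator {-real m..real m} x) \<partial>lborel) \<le> ennreal ((1/2)^n * (1 + 2 * real m))" for n
    proof -
      have sq: "integrable lborel (\<lambda>x. (f (Suc n) x - f n x)\<^sup>2)"
        by (intro square_integrable_square square_integrable_diff f)
      have pw: "D n x * indicator {-real m..real m} x
          \<le> 2^n * (f (Suc n) x - f n x)\<^sup>2 + (1/2)^n * indicator {-real m..real m} x" for x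
      proof -
        define q where "q = (f (Suc n) x - f n x)"
        \<comment> \<open>The weight \<open>2^n\<close> balances the bound \<open>(1/4)^n\<close> for the integral of \<open>q\<^sup>2\<close>: both terms contribute \<open>(1/2)^n\<close>.\<close>
        have "2 * (\<bar>q\<bar> * 1) \<le> 2^n * q\<^sup>2 + (1/2)^n"
        proof -
          have "0 \<le> (1/2)^n * (2^n * \<bar>q\<bar> - 1)\<^sup>2" by simp
          also have "\<dots> = 2^n * q\<^sup>2 - 2 * \<bar>q\<bar> + (1/2)^n"
            by (simp add: power2_eq_square field_simps power_divide)
          finally show ?thesis by simp
        qed
        moreover have "0 \<le> 2^n * q\<^sup>2" by simp
        ultimately show ?thesis unfolding D_def q_def[symmetric] by (auto simp: indicator_def)
      qed
      have "(\<integral>\<^sup>+x. ennreal (D n x * indicator {-real m..real m} x) \<partial>lborel)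
        \<le> (\<integral>\<^sup>+x. ennreal (2^n * (f (Suc n) x - f n x)\<^sup>2 + (1/2)^n * indicator {-real m..real m} x) \<partial>lborel)"
        by (intro nn_integral_mono ennreal_leI pw)
      also have "\<dots> = ennreal (LINT x|lborel. 2^n * (f (Suc n) x - f n x)\<^sup>2 + (1/2)^n * indicator {-real m..real m} x)"
        using sq by (intro nn_integral_eq_integral) auto
      also have "(LINT x|lborel. 2^n * (f (Suc n) x - f n x)\<^sup>2 + (1/2)^n * indicator {-real m..real m} x)
         = 2^n * (LINT x|lborel. (f (Suc n) x - f n x)\<^sup>2) + (1/2)^n * (2 * real m)"
        using sq by (subst Bochner_Integration.integral_add) auto
      also have "\<dots> \<le> 2^n * (1/4)^n + (1/2)^n * (2 * real m)"
        using d[of n] by simp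
      also have "(2::real)^n * (1/4)^n = (1/2)^n" by (simp add: power_mult_distrib[symmetric])
      finally show ?thesis by (simp add: algebra_simps ennreal_leI)
    qed
    have "(\<integral>\<^sup>+x. (\<Sum>n. ennreal (D n x * indicator {-real m..real m} x)) \<partial>lborel)
        = (\<Sum>n. \<integral>\<^sup>+x. ennreal (D n x * indicator {-real m..real m} x) \<partial>lborel)"
      by (intro nn_integral_suminf) measurable
    also have "\<dots> \<le> (\<Sum>n. ennreal ((1/2)^n * (1 + 2 * real m)))"
      by (intro suminf_le b) auto
    also have "\<dots> = ennreal (\<Sum>n. (1/2)^n * (1 + 2 * real m))"
      by (intro suminf_ennreal2 summable_mult2) (auto simp: summable_geometric)
    also have "\<dots> < \<infinity>" by simp
    finally show "(\<integral>\<^sup>+x. (\<Sum>n. ennreal (D n x * indicator {-real m..real m} x)) \<partial>lborel) \<noteq> \<infinity>" by simp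
  qed measurable
  then have "AE x in lborel. \<forall>m::nat. (\<Sum>n. ennreal (D n x * indicator {-real m..real m} x)) \<noteq> \<infinity>"
    unfolding AE_all_countable by blast
  then show ?thesis
  proof eventually_elim
    case (elim x)
    obtain m :: nat where m: "\<bar>x\<bar> < real m" using reals_Archimedean2 by blast
    then have "(\<Sum>n. ennreal (D n x)) \<noteq> top" using elim[rule_format, of m] by (simp add: indicator_def abs_less_iff)
    then have "summable (\<lambda>n. D n x)"
      by (intro summable_suminf_not_top) (auto simp: D_def)
    then have "summable (\<lambda>n. f (Suc n) x - f n x)" unfolding D_def by (rule summable_rabs_cancel)
    then have "convergent (\<lambda>n. \<Sum>i<n. f (Suc i) x - f i x)" by (simp add: summable_iff_convergent)
    then have "convergent (\<lambda>n. f n x - f 0 x)" by (simp add: sum_lessThan_telescope[of "\<lambda>n. f n x"])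
    then have "convergent (\<lambda>n. (f n x - f 0 x) + f 0 x)" by (intro convergent_add convergent_const)
    then show ?case by simp
  qed
qed

lemma l2_fast_Cauchy_converges:
  fixes X :: "nat \<Rightarrow> l2"
  assumes X: "\<And>m n. n \<le> m \<Longrightarrow> norm (X m - X n) \<le> (1/2)^n"
  shows "convergent X"
proof -
  define f where "f n = rep_l2 (X n)" for n
  have f: "square_integrable (f n)" for n by (simp add: f_def rep_l2_square_integrable)
  have fX: "X n = abs_l2 (f n)" for n by (simp add: f_def abs_rep_l2)
  have [measurable]: "f n \<in> borel_measurable borel" for n using f by measurable
  have dist: "(LINT x|lborel. (f m x - f n x)\<^sup>2) \<le> (1/4)^n" if "n \<le> m" for m n
  proof -
    have "(norm (X m - X n))\<^sup>2 \<le> ((1/2)^n)\<^sup>2" by (intro power_mono X that) simp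
    also have "((1/2)^n)\<^sup>2 = (1/4::real)^n"
      by (simp add: power2_eq_square power_mult_distrib[symmetric])
    finally show ?thesis
      by (simp add: fX abs_l2_diff f norm_abs_l2 square_integrable_diff)
  qed
  have conv: "AE x in lborel. convergent (\<lambda>n. f n x)"
    using dist by (intro l2_fast_Cauchy_AE f) simp
  define F where "F x = lim (\<lambda>n. f n x)" for x
  have [measurable]: "F \<in> borel_measurable borel" unfolding F_def by measurable
  have AEF: "AE x in lborel. (\<lambda>n. f n x) \<longlonglongrightarrow> F x"
    using conv by eventually_elim (simp add: F_def convergent_LIMSEQ_iff)
  have fatou: "(\<integral>\<^sup>+x. ennreal ((F x - f n x)\<^sup>2) \<partial>lborel) \<le> ennreal ((1/4)^n)" for n
  proof -
    have "(\<integral>\<^sup>+x. ennreal ((F x - f n x)\<^sup>2) \<partial>lborel)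
        = (\<integral>\<^sup>+x. liminf (\<lambda>m. ennreal ((f m x - f n x)\<^sup>2)) \<partial>lborel)"
    proof (rule nn_integral_cong_AE)
      show "AE x in lborel. ennreal ((F x - f n x)\<^sup>2) = liminf (\<lambda>m. ennreal ((f m x - f n x)\<^sup>2))"
        using AEF
      proof eventually_elim
        case (elim x)
        then have "(\<lambda>m. ennreal ((f m x - f n x)\<^sup>2)) \<longlonglongrightarrow> ennreal ((F x - f n x)\<^sup>2)"
          by (intro tendsto_ennrealI tendsto_intros)
        then show ?case using lim_imp_Liminf[OF sequentially_bot] by metis
      qed
    qed
    also have "\<dots> \<le> liminf (\<lambda>m. \<integral>\<^sup>+x. ennreal ((f m x - f n x)\<^sup>2) \<partial>lborel)"
      by (rule nn_integral_liminf) measurable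
    also have "\<dots> \<le> liminf (\<lambda>m. ennreal ((1/4)^n))"
    proof (rule Liminf_mono)
      show "eventually (\<lambda>m. (\<integral>\<^sup>+x. ennreal ((f m x - f n x)\<^sup>2) \<partial>lborel) \<le> ennreal ((1/4)^n)) sequentially"
        using eventually_ge_at_top[of n]
      proof eventually_elim
        case (elim m)
        have "(\<integral>\<^sup>+x. ennreal ((f m x - f n x)\<^sup>2) \<partial>lborel) = ennreal (LINT x|lborel. (f m x - f n x)\<^sup>2)"
          by (intro nn_integral_eq_integral square_integrable_square square_integrable_diff f) auto
        then show ?case using dist[OF elim] by (simp add: ennreal_leI)
      qed
    qed
    finally show ?thesis by (simp add: Liminf_const)
  qed
  have sqd: "square_integrable (\<lambda>x. F x - f n x)" for n
  proof (rule square_integrableI)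
    show "integrable lborel (\<lambda>x. (F x - f n x)\<^sup>2)"
    proof (rule integrableI_nonneg)
      show "(\<integral>\<^sup>+x. ennreal ((F x - f n x)\<^sup>2) \<partial>lborel) < \<infinity>"
        using fatou[of n] by (simp add: le_less_trans[OF _ ennreal_less_top])
    qed auto
  qed measurable
  have F: "square_integrable F"
    using square_integrable_add[OF sqd[of 0] f[of 0]] by simp
  have "(norm (X n - abs_l2 F))\<^sup>2 \<le> ((1/2)^n)\<^sup>2" for n
  proof -
    have "ennreal (LINT x|lborel. (F x - f n x)\<^sup>2) = (\<integral>\<^sup>+x. ennreal ((F x - f n x)\<^sup>2) \<partial>lborel)"
      by (rule nn_integral_eq_integral[symmetric]) (auto intro: square_integrable_square sqd)
    then have "ennreal (LINT x|lborel. (F x - f n x)\<^sup>2) \<le> ennreal ((1/4)^n)"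
      using fatou[of n] by (simp only:)
    then have le: "(LINT x|lborel. (F x - f n x)\<^sup>2) \<le> (1/4)^n"
      by (subst (asm) ennreal_le_iff) auto
    have "(norm (abs_l2 F - X n))\<^sup>2 = (LINT x|lborel. (F x - f n x)\<^sup>2)"
      by (simp add: fX abs_l2_diff f F norm_abs_l2 sqd)
    also note le
    also have "(1/4::real)^n = ((1/2)^n)\<^sup>2"
      by (simp add: power2_eq_square power_mult_distrib[symmetric])
    finally show ?thesis by (simp add: norm_minus_commute)
  qed
  then have "norm (X n - abs_l2 F) \<le> (1/2)^n" for n by (rule power2_le_imp_le) simp
  then have "(\<lambda>n. X n - abs_l2 F) \<longlonglongrightarrow> 0"
    by (intro Lim_null_comparison[OF _ LIMSEQ_power_zero[of "1/2::real"]]) auto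
  then show ?thesis using LIM_zero_iff convergent_def by metis
qed

instance l2 :: complete_space
proof
  fix X :: "nat \<Rightarrow> l2" assume C: "Cauchy X"
  have "\<exists>M. \<forall>m\<ge>M. \<forall>n\<ge>M. norm (X m - X n) < (1/2)^k" for k :: nat
    using CauchyD[OF C, of "(1/2)^k"] by simp
  then obtain M where M: "\<And>k m n. m \<ge> M k \<Longrightarrow> n \<ge> M k \<Longrightarrow> norm (X m - X n) < (1/2)^k"
    by metis
  define r where "r n = (\<Sum>i\<le>n. M i + 1)" for n
  have r: "strict_mono r" by (rule strict_monoI_Suc) (simp add: r_def)
  have rM: "r n \<ge> M n" for n
  proof -
    have "M n + 1 \<le> (\<Sum>i\<le>n. M i + 1)" by (rule member_le_sum) auto
    then show ?thesis by (simp add: r_def)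
  qed
  have "convergent (X \<circ> r)"
  proof (rule l2_fast_Cauchy_converges)
    fix m n :: nat assume "n \<le> m"
    then have "r m \<ge> M n" using rM[of n] strict_mono_leD[OF r] by (meson order.trans)
    then show "norm ((X \<circ> r) m - (X \<circ> r) n) \<le> (1/2)^n"
      using M[OF _ rM[of n]] by (auto intro: less_imp_le)
  qed
  then obtain L where "(X \<circ> r) \<longlonglongrightarrow> L" by (auto simp: convergent_def)
  then show "convergent X"
    using Cauchy_converges_subseq[OF C r] by (auto simp: convergent_def)
qed

instance l2 :: banach ..

lemma inner_integral:
  fixes X :: "real \<Rightarrow> l2"
  assumes "continuous_on UNIV X"
  shows "inner (integral {a..b} X) g = integral {a..b} (\<lambda>t. inner (X t) g)"
proof -
  have "X integrable_on {a..b}"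
    by (rule integrable_continuous_interval[OF continuous_on_subset[OF assms]]) auto
  from integral_linear[OF this bounded_linear_inner_left[of g]]
  show ?thesis by (simp add: o_def)
qed

lemma curve_integrable: "continuous_on UNIV X \<Longrightarrow> X integrable_on {a..b}" for X :: "real \<Rightarrow> 'a::banach"
  by (rule integrable_continuous_interval[OF continuous_on_subset]) auto

section \<open>Weak derivatives of square-integrable functions\<close>

text \<open>The graph of the weak derivative on \<open>H\<^sup>1\<close>. As a relation it is closed under time integrals
  (\<open>l2_deriv_integral\<close>).\<close>

definition l2_deriv :: "l2 \<Rightarrow> l2 \<Rightarrow> bool" where
  "l2_deriv f g \<longleftrightarrow> (\<forall>\<psi>. test_function \<psi> \<longrightarrow> inner f (abs_l2 (deriv \<psi>)) = - inner g (abs_l2 \<psi>))"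

lemma l2_orthogonal_to_tests_imp_zero:
  assumes "\<And>\<psi>. test_function \<psi> \<Longrightarrow> inner f (abs_l2 \<psi>) = 0"
  shows "f = 0"
proof -
  obtain h where h: "square_integrable h" "f = abs_l2 h" by (rule l2_cases)
  have "AE x in lborel. h x = 0"
  proof (rule du_Bois_Reymond)
    show "locally_integrable h" by (rule square_integrable_locally_integrable[OF h(1)])
    show "(LINT x|lborel. h x * \<psi> x) = 0" if "test_function \<psi>" for \<psi>
      using assms[OF that] by (simp add: h inner_abs_l2 test_function_square_integrable that)
  qed
  then show ?thesis
    using abs_l2_eq_iff[OF h(1) square_integrable_zero] h(2) zero_l2.abs_eq by simp
qed

lemma l2_eq_if_tests:
  assumes "\<And>\<psi>. test_function \<psi> \<Longrightarrow> inner f (abs_l2 \<psi>) = inner g (abs_l2 \<psi>)"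
  shows "f = g"
  using l2_orthogonal_to_tests_imp_zero[of "f - g"] assms by (simp add: inner_diff_left)

lemma l2_deriv_integral:
  fixes X Y :: "real \<Rightarrow> l2"
  assumes X: "continuous_on UNIV X" and Y: "continuous_on UNIV Y"
    and d: "\<And>s. l2_deriv (X s) (Y s)"
  shows "l2_deriv (integral {a..b} X) (integral {a..b} Y)"
  unfolding l2_deriv_def
proof (intro allI impI)
  fix \<psi> :: "real \<Rightarrow> real" assume \<psi>: "test_function \<psi>"
  have "(\<lambda>t. inner (X t) (abs_l2 (deriv \<psi>))) = (\<lambda>t. - inner (Y t) (abs_l2 \<psi>))"
    using d \<psi> by (auto simp: l2_deriv_def)
  then show "inner (integral {a..b} X) (abs_l2 (deriv \<psi>)) = - inner (integral {a..b} Y) (abs_l2 \<psi>)"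
    by (simp add: inner_integral X Y)
qed

lemma is_primitive_imp_l2_deriv:
  assumes "is_primitive f g" "square_integrable f" "square_integrable g"
  shows "l2_deriv (abs_l2 f) (abs_l2 g)"
  using is_primitive_imp_weak_derivative[OF assms(1)]
  by (simp add: l2_deriv_def has_weak_derivative_def inner_abs_l2 assms test_function_square_integrable test_function_deriv)

lemma l2_deriv_imp_primitive:
  assumes "l2_deriv (abs_l2 f) (abs_l2 g)" and f: "square_integrable f" and g: "square_integrable g"
  obtains F where "is_primitive F g" "square_integrable F" "AE x in lborel. f x = F x" "abs_l2 F = abs_l2 f"
proof -
  have "has_weak_derivative f g"
    using assms
    by (simp add: l2_deriv_def has_weak_derivative_def inner_abs_l2 assms test_function_square_integrable
        test_function_deriv square_integrable_locally_integrable)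
  then obtain F where F: "is_primitive F g" "AE x in lborel. f x = F x"
    using weak_derivative_imp_AE_primitive by blast
  have [measurable]: "F \<in> borel_measurable borel"
    by (rule continuous_measurable[OF is_primitive_continuous[OF F(1)]])
  have "integrable lborel (\<lambda>x. (F x)\<^sup>2)"
  proof (rule integrable_cong_AE_imp[OF square_integrable_square[OF f]])
    show "AE x in lborel. (f x)\<^sup>2 = (F x)\<^sup>2" using F(2) by eventually_elim simp
  qed measurable
  then have sq: "square_integrable F" by (intro square_integrableI) measurable
  then have "abs_l2 F = abs_l2 f" using abs_l2_eq_iff[OF sq f] F(2) by auto
  then show ?thesis using that F sq by blast
qed

lemma is_primitive_square_integrable_mult:
  assumes f: "is_primitive f f'" "square_integrable f" "square_integrable f'"
    and g: "is_primitive g g'" "square_integrable g" "square_integrable g'"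
  shows "is_primitive (\<lambda>x. f x * g x) (\<lambda>x. f x * g' x + f' x * g x)"
    "integrable lborel (\<lambda>x. f x * g' x + f' x * g x)" "integrable lborel (\<lambda>x. f x * g x)"
  by (intro is_primitive_mult f g Bochner_Integration.integrable_add square_integrable_mult)+

text \<open>The product of the two primitives is integrable and has an integrable derivative, so that the
  integral of the derivative is \<open>0\<close>.\<close>

lemma l2_integration_by_parts:
  assumes "l2_deriv f f'" "l2_deriv g g'"
  shows "inner f g' + inner f' g = 0"
proof -
  have f1: "square_integrable (rep_l2 f')" and g1: "square_integrable (rep_l2 g')"
    by (rule rep_l2_square_integrable)+
  obtain F where F: "is_primitive F (rep_l2 f')" "square_integrable F" "abs_l2 F = f"
    by (rule l2_deriv_imp_primitive[of "rep_l2 f" "rep_l2 f'"])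
      (simp_all add: abs_rep_l2 assms rep_l2_square_integrable)
  obtain G where G: "is_primitive G (rep_l2 g')" "square_integrable G" "abs_l2 G = g"
    by (rule l2_deriv_imp_primitive[of "rep_l2 g" "rep_l2 g'"])
      (simp_all add: abs_rep_l2 assms rep_l2_square_integrable)
  note p = is_primitive_square_integrable_mult[OF F(1,2) f1 G(1,2) g1]
  have "(LINT x|lborel. F x * rep_l2 g' x + rep_l2 f' x * G x) = 0"
    by (rule is_primitive_integral_zero[OF p])
  then have "(LINT x|lborel. F x * rep_l2 g' x) + (LINT x|lborel. rep_l2 f' x * G x) = 0"
    using Bochner_Integration.integral_add[OF square_integrable_mult[OF F(2) g1] square_integrable_mult[OF f1 G(2)]]
    by simp
  then have "inner (abs_l2 F) (abs_l2 (rep_l2 g')) + inner (abs_l2 (rep_l2 f')) (abs_l2 G) = 0"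
    by (simp only: inner_abs_l2[OF F(2) g1] inner_abs_l2[OF f1 G(2)])
  then show ?thesis by (simp only: F(3) G(3) abs_rep_l2)
qed

lemma H1_tendsto:
  assumes f: "is_primitive f f'" "square_integrable f" "square_integrable f'"
  shows "(f \<longlongrightarrow> 0) at_top" "(f \<longlongrightarrow> 0) at_bot"
proof -
  note p = is_primitive_square_integrable_mult[OF f f]
  have "((\<lambda>x. sqrt (f x * f x)) \<longlongrightarrow> sqrt 0) at_top" "((\<lambda>x. sqrt (f x * f x)) \<longlongrightarrow> sqrt 0) at_bot"
    by (intro tendsto_real_sqrt is_primitive_tendsto_at_top[OF p] is_primitive_tendsto_at_bot[OF p])+
  then show "(f \<longlongrightarrow> 0) at_top" "(f \<longlongrightarrow> 0) at_bot"
    by (simp_all add: tendsto_rabs_zero_iff)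
qed

text \<open>The square is a primitive of \<open>2 f f'\<close>.\<close>

lemma H1_sup_bound:
  assumes f: "is_primitive f f'" "square_integrable f" "square_integrable f'"
  shows "(f x)\<^sup>2 \<le> 2 * norm (abs_l2 f) * norm (abs_l2 f')"
proof -
  note p = is_primitive_square_integrable_mult[OF f f]
  have "\<bar>f x * f x\<bar> \<le> (LINT y|lborel. \<bar>f y * f' y + f' y * f y\<bar>)"
    by (rule is_primitive_abs_le[OF p])
  also have "\<dots> = 2 * (LINT y|lborel. \<bar>f y * f' y\<bar>)"
    by (simp add: mult.commute abs_mult flip: mult_2)
  also have "\<dots> \<le> 2 * (norm (abs_l2 f) * norm (abs_l2 f'))"
    using LINT_abs_mult_le_norm[OF f(2,3)] by simp
  finally show ?thesis by (simp add: power2_eq_square)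
qed

section \<open>States of finite energy\<close>

definition dU :: "real \<Rightarrow> real" where
  "dU y = (y ^ 3 - y) / 2"

lemma U_has_derivative: "(U has_real_derivative dU y) (at y)"
  unfolding U_def dU_def
  by (auto intro!: derivative_eq_intros simp: power2_eq_square power3_eq_cube field_simps)

lemma deriv_U: "deriv U = dU"
  using DERIV_imp_deriv[OF U_has_derivative] by blast

lemma continuous_U: "continuous_on A U" unfolding U_def by (intro continuous_intros)
lemma continuous_dU: "continuous_on A dU" unfolding dU_def by (intro continuous_intros) auto

lemma U_nonneg: "0 \<le> U y" by (simp add: U_def)

lemma dU_squared: "(dU y)\<^sup>2 = 2 * y\<^sup>2 * U y"
  unfolding dU_def U_def by (simp add: power2_eq_square power3_eq_cube field_simps)

lemma abs_poly_bound:
  fixes a b :: real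
  assumes "\<bar>a\<bar> \<le> K" "\<bar>b\<bar> \<le> K"
  shows "\<bar>a * b\<bar> \<le> K\<^sup>2"
  using mult_mono[of "\<bar>a\<bar>" K "\<bar>b\<bar>" K] assms by (simp add: abs_mult power2_eq_square)

lemma dU_Lipschitz:
  assumes "\<bar>a\<bar> \<le> K" "\<bar>b\<bar> \<le> K"
  shows "\<bar>dU a - dU b\<bar> \<le> (3 * K\<^sup>2 + 1) / 2 * \<bar>a - b\<bar>"
proof -
  have "dU a - dU b = (a * a + a * b + b * b - 1) / 2 * (a - b)"
    by (simp add: dU_def power3_eq_cube field_simps)
  moreover have "\<bar>a * a + a * b + b * b - 1\<bar> \<le> 3 * K\<^sup>2 + 1"
    using abs_poly_bound[OF assms(1,1)] abs_poly_bound[OF assms] abs_poly_bound[OF assms(2,2)] by linarith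
  ultimately have "\<bar>dU a - dU b\<bar> = \<bar>a * a + a * b + b * b - 1\<bar> / 2 * \<bar>a - b\<bar>"
    "\<bar>a * a + a * b + b * b - 1\<bar> / 2 \<le> (3 * K\<^sup>2 + 1) / 2" by (simp_all only: abs_mult abs_divide) simp_all
  then show ?thesis by (simp only: mult_right_mono abs_ge_zero)
qed

lemma U_Taylor:
  assumes "\<bar>a\<bar> \<le> K" "\<bar>b\<bar> \<le> K"
  shows "\<bar>U a - U b - dU b * (a - b)\<bar> \<le> (3 * K\<^sup>2 + 1) / 2 * (a - b)\<^sup>2"
proof -
  have "U a - U b - dU b * (a - b) = (a * a + 2 * (a * b) + 3 * (b * b) - 2) / 8 * (a - b)\<^sup>2"
    by (simp add: dU_def U_def power2_eq_square power3_eq_cube field_simps)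
  moreover have "\<bar>a * a + 2 * (a * b) + 3 * (b * b) - 2\<bar> \<le> 6 * K\<^sup>2 + 2"
    using abs_poly_bound[OF assms(1,1)] abs_poly_bound[OF assms] abs_poly_bound[OF assms(2,2)]
    by linarith
  then have "\<bar>(a * a + 2 * (a * b) + 3 * (b * b) - 2) / 8\<bar> \<le> (3 * K\<^sup>2 + 1) / 2"
    using zero_le_power2[of K] by (simp del: zero_le_power2)
  ultimately show ?thesis by (simp only: abs_mult abs_power2 mult_right_mono zero_le_power2)
qed

text \<open>The function \<open>W\<close> is a primitive of \<open>y\<^sup>2 - 1 = \<plusminus>2 sqrt (2 U)\<close>.  It turns the inequality
  \<open>a b \<le> (a\<^sup>2 + b\<^sup>2) / 2\<close> into a lower bound for the energy of a transition.\<close>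

definition W :: "real \<Rightarrow> real" where
  "W y = y ^ 3 / 3 - y"

lemma W_has_derivative: "(W has_real_derivative y\<^sup>2 - 1) (at y)"
  unfolding W_def by (auto intro!: derivative_eq_intros)

lemma continuous_W: "continuous_on A W" unfolding W_def by (intro continuous_intros) auto

lemma is_primitive_W: "is_primitive u p \<Longrightarrow> is_primitive (\<lambda>x. W (u x)) (\<lambda>x. ((u x)\<^sup>2 - 1) * p x)"
  by (rule is_primitive_compose[OF _ W_has_derivative]) (auto intro!: continuous_intros)

lemma energy_density_bound: "\<bar>(y\<^sup>2 - 1) * q\<bar> \<le> 2 * (q\<^sup>2 / 2 + U y)"
proof -
  have "0 \<le> (q - (y\<^sup>2 - 1) / 2)\<^sup>2" "0 \<le> (q + (y\<^sup>2 - 1) / 2)\<^sup>2" by simp_all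
  then have "(y\<^sup>2 - 1) * q \<le> q\<^sup>2 + (y\<^sup>2 - 1)\<^sup>2 / 4" "- ((y\<^sup>2 - 1) * q) \<le> q\<^sup>2 + (y\<^sup>2 - 1)\<^sup>2 / 4"
    by (simp_all add: power2_eq_square field_simps)
  moreover have "q\<^sup>2 + (y\<^sup>2 - 1)\<^sup>2 / 4 = 2 * (q\<^sup>2 / 2 + U y)"
    by (simp add: U_def power2_eq_square field_simps)
  ultimately show ?thesis by (simp add: abs_le_iff)
qed

lemma Bogomolny_bound:
  assumes up: "is_primitive u p" and sq: "locally_integrable (\<lambda>x. (p x)\<^sup>2 / 2 + U (u x))" and "x \<le> y"
  shows "\<bar>W (u y) - W (u x)\<bar> \<le> 2 * (LINT z:{x..y}|lborel. (p z)\<^sup>2 / 2 + U (u z))"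
proof -
  note pr = is_primitive_W[OF up]
  have "\<bar>W (u y) - W (u x)\<bar> = \<bar>LINT z:{x..y}|lborel. ((u z)\<^sup>2 - 1) * p z\<bar>"
    by (simp add: is_primitive_integral[OF pr \<open>x \<le> y\<close>])
  also have "\<dots> \<le> (LINT z:{x..y}|lborel. \<bar>((u z)\<^sup>2 - 1) * p z\<bar>)"
    by (rule LINT_abs_le[OF is_primitive_locally_integrable[OF pr] \<open>x \<le> y\<close>])
  also have "\<dots> \<le> (LINT z:{x..y}|lborel. 2 * ((p z)\<^sup>2 / 2 + U (u z)))"
    by (intro set_integral_mono locally_integrableD locally_integrable_abs
        is_primitive_locally_integrable[OF pr] locally_integrable_cmult sq energy_density_bound)
  also have "\<dots> = 2 * (LINT z:{x..y}|lborel. (p z)\<^sup>2 / 2 + U (u z))" by (rule set_integral_mult_right)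
  finally show ?thesis .
qed

text \<open>For \<open>|y| \<ge> 2\<close> the cubic \<open>W\<close> grows at least like \<open>|y|/3\<close>.\<close>

lemma W_bound_imp:
  assumes "\<bar>W y\<bar> \<le> B"
  shows "\<bar>y\<bar> \<le> 2 + 3 * B"
proof (cases "\<bar>y\<bar> \<le> 2")
  case True
  then show ?thesis using assms by linarith
next
  case False
  then have "2\<^sup>2 \<le> \<bar>y\<bar>\<^sup>2" by (intro power_mono) auto
  then have y2: "4 \<le> y\<^sup>2" by simp
  have "W y = y * (y\<^sup>2 / 3 - 1)" by (simp add: W_def power2_eq_square power3_eq_cube field_simps)
  then have "\<bar>W y\<bar> = \<bar>y\<bar> * (y\<^sup>2 / 3 - 1)" using y2 by (simp add: abs_mult)
  moreover have "\<bar>y\<bar> * (1/3) \<le> \<bar>y\<bar> * (y\<^sup>2 / 3 - 1)" using y2 by (intro mult_left_mono) auto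
  ultimately show ?thesis using assms by linarith
qed

definition pot_energy :: "(real \<Rightarrow> real) \<Rightarrow> (real \<Rightarrow> real) \<Rightarrow> real" where
  "pot_energy u p = (LINT x|lborel. (p x)\<^sup>2 / 2 + U (u x))"

text \<open>At infinity \<open>W(u)\<close> has a value of modulus \<open>2/3\<close>, from which the energy bounds its deviation.\<close>

lemma sup_bound:
  assumes up: "is_primitive u p" and e: "integrable lborel (\<lambda>x. (p x)\<^sup>2 / 2 + U (u x))"
    and r: "(u \<longlongrightarrow> r) at_top" "r \<in> {-1, 1}"
  shows "\<bar>u x\<bar> \<le> 4 + 6 * pot_energy u p"
proof -
  have "((\<lambda>y. \<bar>W (u y) - W (u x)\<bar>) \<longlongrightarrow> \<bar>W r - W (u x)\<bar>) at_top"
    using continuous_on_tendsto_compose[OF continuous_W[of UNIV] r(1)] by (intro tendsto_intros) simp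
  moreover have "eventually (\<lambda>y. \<bar>W (u y) - W (u x)\<bar> \<le> 2 * pot_energy u p) at_top"
    using eventually_ge_at_top[of x]
  proof eventually_elim
    case (elim y)
    have "\<bar>W (u y) - W (u x)\<bar> \<le> 2 * (LINT z:{x..y}|lborel. (p z)\<^sup>2 / 2 + U (u z))"
      by (rule Bogomolny_bound[OF up locally_integrable_integrable[OF e] elim])
    also have "(LINT z:{x..y}|lborel. (p z)\<^sup>2 / 2 + U (u z)) \<le> pot_energy u p"
      unfolding pot_energy_def set_lebesgue_integral_def using e
      by (intro integral_mono integrable_mult_indicator) (auto simp: indicator_def U_nonneg)
    finally show ?case by simp
  qed
  ultimately have "\<bar>W r - W (u x)\<bar> \<le> 2 * pot_energy u p"
    by (rule tendsto_upperbound) simp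
  moreover have "\<bar>W r\<bar> = 2/3" using r(2) by (auto simp: W_def)
  ultimately have "\<bar>W (u x)\<bar> \<le> 2/3 + 2 * pot_energy u p" by linarith
  from W_bound_imp[OF this] show ?thesis by simp
qed

lemma weak_deriv_is_primitive:
  assumes "continuous_on UNIV u" "\<exists>g. has_weak_derivative u g"
  shows "is_primitive u (weak_deriv u)"
  unfolding weak_deriv_def
  by (rule weak_derivative_continuous_imp_primitive[OF someI_ex[OF assms(2)] assms(1)])

lemma finite_energyD:
  assumes s: "(u, v) \<in> finite_energy_states l r"
  defines "p \<equiv> weak_deriv u"
  shows "continuous_on UNIV u" "is_primitive u p" "square_integrable p" "square_integrable v"
    "integrable lborel (\<lambda>x. U (u x))" "(u \<longlongrightarrow> l) at_bot" "(u \<longlongrightarrow> r) at_top"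
    "integrable lborel (\<lambda>x. (p x)\<^sup>2 / 2 + U (u x))"
    "potential_energy u = ennreal (pot_energy u p)"
    "energy (u, v) = ennreal (pot_energy u p + (LINT x|lborel. (v x)\<^sup>2) / 2)"
proof -
  show c: "continuous_on UNIV u" and "(u \<longlongrightarrow> l) at_bot" "(u \<longlongrightarrow> r) at_top"
    using s by (auto simp: finite_energy_states_def)
  show pr: "is_primitive u p"
    using s unfolding p_def by (intro weak_deriv_is_primitive) (auto simp: finite_energy_states_def)
  have [measurable]: "u \<in> borel_measurable borel" by (rule continuous_measurable[OF c])
  have [measurable]: "p \<in> borel_measurable borel"
    by (rule locally_integrable_measurable[OF is_primitive_locally_integrable[OF pr]])
  have [measurable]: "v \<in> borel_measurable borel" using s by (auto simp: finite_energy_states_def)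
  have [measurable]: "(\<lambda>x. U (u x)) \<in> borel_measurable borel" unfolding U_def by measurable
  have fin: "(\<integral>\<^sup>+x. ennreal ((p x)\<^sup>2 / 2 + U (u x)) \<partial>lborel) < \<infinity>" "(\<integral>\<^sup>+x. ennreal ((v x)\<^sup>2 / 2) \<partial>lborel) < \<infinity>"
    using s by (auto simp: finite_energy_states_def energy_def potential_energy_def p_def)
  show ie: "integrable lborel (\<lambda>x. (p x)\<^sup>2 / 2 + U (u x))"
    using fin(1) by (intro integrableI_nonneg) (auto simp: U_nonneg)
  have iv: "integrable lborel (\<lambda>x. (v x)\<^sup>2 / 2)"
    using fin(2) by (intro integrableI_nonneg) auto
  have "integrable lborel (\<lambda>x. 2 * ((p x)\<^sup>2 / 2 + U (u x)))" by (rule integrable_mult_right[OF ie])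
  then show "square_integrable p" by (rule square_integrable_bound) (auto simp: U_nonneg)
  have "integrable lborel (\<lambda>x. 2 * ((v x)\<^sup>2 / 2))" by (rule integrable_mult_right[OF iv])
  then show "square_integrable v" by (rule square_integrable_bound) auto
  show "integrable lborel (\<lambda>x. U (u x))"
    by (rule Bochner_Integration.integrable_bound[OF ie]) (auto simp: U_nonneg)
  show pe: "potential_energy u = ennreal (pot_energy u p)"
    unfolding potential_energy_def pot_energy_def p_def[symmetric]
    using nn_integral_eq_integral[OF ie] by (simp add: U_nonneg)
  have "(\<integral>\<^sup>+x. ennreal (1/2 * (v x)\<^sup>2) \<partial>lborel) = ennreal ((LINT x|lborel. (v x)\<^sup>2) / 2)"
    using nn_integral_eq_integral[OF iv] by simp
  moreover have "pot_energy u p \<ge> 0" unfolding pot_energy_def by (intro integral_nonneg_AE) (simp add: U_nonneg)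
  ultimately show "energy (u, v) = ennreal (pot_energy u p + (LINT x|lborel. (v x)\<^sup>2) / 2)"
    by (simp add: energy_def pe ennreal_plus)
qed

text \<open>In \<open>8 U(y) = (y - \<sigma>)\<^sup>2 (y + \<sigma>)\<^sup>2\<close> the second factor is at least \<open>1\<close>.\<close>

lemma U_near_vacuum:
  assumes "\<sigma> \<in> {-1, 1}" "\<bar>y - \<sigma>\<bar> \<le> 1"
  shows "(y - \<sigma>)\<^sup>2 \<le> 8 * U y"
proof -
  have "1 \<le> (y + \<sigma>)\<^sup>2"
    using assms by (auto simp: abs_le_iff one_le_power) (smt (verit) one_le_power power2_minus)
  then have "(y - \<sigma>)\<^sup>2 * 1 \<le> (y - \<sigma>)\<^sup>2 * (y + \<sigma>)\<^sup>2" by (intro mult_left_mono) auto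
  also have "\<dots> = 8 * U y"
    using assms(1) by (auto simp: U_def power2_eq_square algebra_simps)
  finally show ?thesis by simp
qed

text \<open>Near each end both fields are close to the same vacuum, and the potential controls the distances
  to it; on the remaining compact interval the difference is bounded.\<close>

lemma finite_energy_diff_square_integrable:
  assumes c: "continuous_on UNIV u" "continuous_on UNIV w"
    and i: "integrable lborel (\<lambda>x. U (u x))" "integrable lborel (\<lambda>x. U (w x))"
    and l: "(u \<longlongrightarrow> l) at_bot" "(w \<longlongrightarrow> l) at_bot" "l \<in> {-1, 1}"
    and r: "(u \<longlongrightarrow> r) at_top" "(w \<longlongrightarrow> r) at_top" "r \<in> {-1, 1}"
  shows "square_integrable (\<lambda>x. u x - w x)"
proof -
  have "eventually (\<lambda>x. dist (u x) l < 1 \<and> dist (w x) l < 1) at_bot"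
    using l by (intro eventually_conj tendstoD) auto
  then obtain A where A: "\<And>x. x \<le> A \<Longrightarrow> \<bar>u x - l\<bar> \<le> 1 \<and> \<bar>w x - l\<bar> \<le> 1"
    unfolding eventually_at_bot_linorder dist_real_def by force
  have "eventually (\<lambda>x. dist (u x) r < 1 \<and> dist (w x) r < 1) at_top"
    using r by (intro eventually_conj tendstoD) auto
  then obtain B where B: "\<And>x. x \<ge> B \<Longrightarrow> \<bar>u x - r\<bar> \<le> 1 \<and> \<bar>w x - r\<bar> \<le> 1"
    unfolding eventually_at_top_linorder dist_real_def by force
  have "compact ((\<lambda>x. u x - w x) ` {A..B})"
    using c by (intro compact_continuous_image continuous_intros) (auto intro: continuous_on_subset)
  then have "bounded ((\<lambda>x. u x - w x) ` {A..B})" by (rule compact_imp_bounded)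
  then obtain K where K: "\<And>x. x \<in> {A..B} \<Longrightarrow> \<bar>u x - w x\<bar> \<le> K"
    unfolding bounded_real by blast
  show ?thesis
  proof (rule square_integrable_bound)
    show "integrable lborel (\<lambda>x. 16 * (U (u x) + U (w x)) + indicator {A..B} x * K\<^sup>2)"
    proof -
      have "emeasure lborel {A..B} < \<infinity>" unfolding emeasure_lborel_Icc_eq by simp
      then have "integrable lborel (indicator {A..B} :: real \<Rightarrow> real)"
        by (intro integrable_real_indicator) simp_all
      then show ?thesis
        using i by (intro Bochner_Integration.integrable_add integrable_mult_left integrable_mult_right)
    qed
    show "(\<lambda>x. u x - w x) \<in> borel_measurable borel"
      using c by (intro continuous_measurable continuous_intros)
    fix x
    have far: "(u x - w x)\<^sup>2 \<le> 16 * (U (u x) + U (w x))" if "\<bar>u x - \<sigma>\<bar> \<le> 1" "\<bar>w x - \<sigma>\<bar> \<le> 1" "\<sigma> \<in> {-1, 1}" for \<sigma>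
    proof -
      have "0 \<le> ((u x - \<sigma>) + (w x - \<sigma>))\<^sup>2" by simp
      then have "(u x - w x)\<^sup>2 \<le> 2 * (u x - \<sigma>)\<^sup>2 + 2 * (w x - \<sigma>)\<^sup>2"
        by (simp add: power2_eq_square algebra_simps)
      also have "\<dots> \<le> 2 * (8 * U (u x)) + 2 * (8 * U (w x))"
        using that by (intro add_mono mult_left_mono U_near_vacuum) auto
      finally show ?thesis by simp
    qed
    have nn: "0 \<le> indicat_real {A..B} x * K\<^sup>2" by simp
    consider "x \<le> A" | "x \<ge> B" | "x \<in> {A..B}" by fastforce
    then show "(u x - w x)\<^sup>2 \<le> 16 * (U (u x) + U (w x)) + indicator {A..B} x * K\<^sup>2"
    proof cases
      case 1
      then have "(u x - w x)\<^sup>2 \<le> 16 * (U (u x) + U (w x))"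
        by (intro far[OF conjunct1[OF A] conjunct2[OF A] l(3)])
      then show ?thesis using nn by linarith
    next
      case 2
      then have "(u x - w x)\<^sup>2 \<le> 16 * (U (u x) + U (w x))"
        by (intro far[OF conjunct1[OF B] conjunct2[OF B] r(3)])
      then show ?thesis using nn by linarith
    next
      case 3
      have "\<bar>u x - w x\<bar>\<^sup>2 \<le> K\<^sup>2" using K[OF 3] by (intro power_mono) auto
      then have "(u x - w x)\<^sup>2 \<le> K\<^sup>2" by simp
      then show ?thesis using 3 U_nonneg[of "u x"] U_nonneg[of "w x"] by simp
    qed
  qed
qed

lemma dU_square_integrable:
  assumes c: "continuous_on UNIV u" and i: "integrable lborel (\<lambda>x. U (u x))" and K: "\<And>x. \<bar>u x\<bar> \<le> K"
  shows "square_integrable (\<lambda>x. dU (u x))"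
proof (rule square_integrable_bound)
  show "integrable lborel (\<lambda>x. (2 * K\<^sup>2) * U (u x))" using i by simp
  show "(\<lambda>x. dU (u x)) \<in> borel_measurable borel"
    by (intro continuous_measurable continuous_on_compose2[OF continuous_dU c]) auto
  fix x
  have "(u x)\<^sup>2 \<le> K\<^sup>2" using power_mono[OF K, of x 2] by simp
  then show "(dU (u x))\<^sup>2 \<le> (2 * K\<^sup>2) * U (u x)"
    unfolding dU_squared by (intro mult_right_mono) (auto simp: U_nonneg)
qed

lemma Lipschitz_dU_norm:
  assumes uK: "\<And>x. \<bar>u x\<bar> \<le> K" and wK: "\<And>x. \<bar>w x\<bar> \<le> K"
    and sq: "square_integrable (\<lambda>x. w x - u x)" "square_integrable (\<lambda>x. dU (u x))" "square_integrable (\<lambda>x. dU (w x))"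
  shows "norm (abs_l2 (\<lambda>x. dU (w x)) - abs_l2 (\<lambda>x. dU (u x)))
    \<le> (3 * K\<^sup>2 + 1) / 2 * norm (abs_l2 (\<lambda>x. w x - u x))"
proof -
  define C where "C = (3 * K\<^sup>2 + 1) / 2"
  have C: "C \<ge> 0" by (simp add: C_def add_nonneg_pos less_imp_le)
  have "norm (abs_l2 (\<lambda>x. dU (w x) - dU (u x))) \<le> norm (abs_l2 (\<lambda>x. C * (w x - u x)))"
  proof (rule norm_abs_l2_mono)
    show "\<bar>dU (w x) - dU (u x)\<bar> \<le> \<bar>C * (w x - u x)\<bar>" for x
      using dU_Lipschitz[OF wK[of x] uK[of x]] C by (simp add: abs_mult C_def)
  qed (intro square_integrable_diff square_integrable_cmult sq)+
  also have "abs_l2 (\<lambda>x. C * (w x - u x)) = C *\<^sub>R abs_l2 (\<lambda>x. w x - u x)"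
    by (simp add: abs_l2_scaleR sq)
  finally show ?thesis
    using C unfolding C_def[symmetric] by (simp add: abs_l2_diff sq)
qed

lemma U_integral_Taylor:
  assumes uK: "\<And>x. \<bar>u x\<bar> \<le> K" and wK: "\<And>x. \<bar>w x\<bar> \<le> K" and w: "continuous_on UNIV w"
    and iU: "integrable lborel (\<lambda>x. U (u x))"
    and sq: "square_integrable (\<lambda>x. w x - u x)" "square_integrable (\<lambda>x. dU (u x))"
  shows "integrable lborel (\<lambda>x. U (w x))"
    "\<bar>(LINT x|lborel. U (w x)) - (LINT x|lborel. U (u x)) - inner (abs_l2 (\<lambda>x. dU (u x))) (abs_l2 (\<lambda>x. w x - u x))\<bar>
      \<le> (3 * K\<^sup>2 + 1) / 2 * (norm (abs_l2 (\<lambda>x. w x - u x)))\<^sup>2"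
proof -
  define C where "C = (3 * K\<^sup>2 + 1) / 2"
  define R where "R x = U (w x) - U (u x) - dU (u x) * (w x - u x)" for x
  have i: "integrable lborel (\<lambda>x. dU (u x) * (w x - u x))"
    by (rule square_integrable_mult[OF sq(2,1)])
  have R: "\<bar>R x\<bar> \<le> C * (w x - u x)\<^sup>2" for x
    unfolding R_def C_def by (rule U_Taylor[OF wK uK])
  have iC: "integrable lborel (\<lambda>x. C * (w x - u x)\<^sup>2)"
    by (rule integrable_mult_right[OF square_integrable_square[OF sq(1)]])
  have [measurable]: "(\<lambda>x. U (w x)) \<in> borel_measurable borel"
    by (rule continuous_measurable[OF continuous_on_compose2[OF continuous_U w]]) auto
  have [measurable]: "R \<in> borel_measurable borel"
    unfolding R_def using borel_measurable_integrable[OF iU] borel_measurable_integrable[OF i] by measurable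
  have iR: "integrable lborel R"
    by (rule Bochner_Integration.integrable_bound[OF iC]) (auto intro!: AE_I2 order.trans[OF R abs_ge_self])
  have "integrable lborel (\<lambda>x. R x + (U (u x) + dU (u x) * (w x - u x)))"
    by (intro Bochner_Integration.integrable_add iR iU i)
  then show iW: "integrable lborel (\<lambda>x. U (w x))" by (simp add: R_def)
  have "(LINT x|lborel. R x) = (LINT x|lborel. U (w x)) - (LINT x|lborel. U (u x)) - (LINT x|lborel. dU (u x) * (w x - u x))"
    unfolding R_def Bochner_Integration.integral_diff[OF Bochner_Integration.integrable_diff[OF iW iU] i]
      Bochner_Integration.integral_diff[OF iW iU] ..
  moreover have "\<bar>LINT x|lborel. R x\<bar> \<le> (LINT x|lborel. \<bar>R x\<bar>)"
    using integral_norm_bound[of lborel R] by simp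
  moreover have "(LINT x|lborel. \<bar>R x\<bar>) \<le> (LINT x|lborel. C * (w x - u x)\<^sup>2)"
    by (rule integral_mono[OF integrable_abs[OF iR] iC R])
  moreover have "(LINT x|lborel. C * (w x - u x)\<^sup>2) = C * (norm (abs_l2 (\<lambda>x. w x - u x)))\<^sup>2"
    unfolding norm_abs_l2[OF sq(1)] by simp
  ultimately show "\<bar>(LINT x|lborel. U (w x)) - (LINT x|lborel. U (u x)) - inner (abs_l2 (\<lambda>x. dU (u x))) (abs_l2 (\<lambda>x. w x - u x))\<bar>
      \<le> (3 * K\<^sup>2 + 1) / 2 * (norm (abs_l2 (\<lambda>x. w x - u x)))\<^sup>2"
    unfolding inner_abs_l2[OF sq(2,1)] C_def by linarith
qed

section \<open>Solutions as curves in the Hilbert space\<close>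

locale kg_solution =
  fixes \<Phi> :: "real \<Rightarrow> state" and l r :: real
  assumes l: "l \<in> {-1, 1}" and r: "r \<in> {-1, 1}"
    and states: "\<And>t. \<Phi> t \<in> finite_energy_states l r"
    and cont: "continuous_in_time \<Phi>" and sol: "solves_in_distributions \<Phi>"
begin

text \<open>A field with values near the vacua is not square-integrable, so the curve \<open>D\<close> records the
  displacement from the field at time \<open>0\<close>. The curves \<open>P\<close>, \<open>V\<close>, \<open>N\<close> are the gradient, the velocity
  and the nonlinearity \<open>U'(\<phi>)\<close>; \<open>UI\<close>, \<open>pe\<close>, \<open>en\<close> are the integral of \<open>U(\<phi>)\<close>, the potential energy
  and the energy.\<close>

definition u :: "real \<Rightarrow> real \<Rightarrow> real" where "u t = fst (\<Phi> t)"
definition v :: "real \<Rightarrow> real \<Rightarrow> real" where "v t = snd (\<Phi> t)"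
definition p :: "real \<Rightarrow> real \<Rightarrow> real" where "p t = weak_deriv (u t)"
definition D :: "real \<Rightarrow> l2" where "D t = abs_l2 (\<lambda>x. u t x - u 0 x)"
definition V :: "real \<Rightarrow> l2" where "V t = abs_l2 (v t)"
definition P :: "real \<Rightarrow> l2" where "P t = abs_l2 (p t)"
definition N :: "real \<Rightarrow> l2" where "N t = abs_l2 (\<lambda>x. dU (u t x))"
definition UI :: "real \<Rightarrow> real" where "UI t = (LINT x|lborel. U (u t x))"
definition pe :: "real \<Rightarrow> real" where "pe t = (norm (P t))\<^sup>2 / 2 + UI t"
definition en :: "real \<Rightarrow> real" where "en t = pe t + (norm (V t))\<^sup>2 / 2"

lemma state_eq: "\<Phi> t = (u t, v t)" by (simp add: u_def v_def)

lemma state_mem: "(u t, v t) \<in> finite_energy_states l r"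
  using states[of t] state_eq by simp

lemmas state_facts = finite_energyD[OF state_mem, folded p_def]

lemma u_continuous: "continuous_on UNIV (u t)" by (rule state_facts)
lemma u_primitive: "is_primitive (u t) (p t)" by (rule state_facts)
lemma p_sq: "square_integrable (p t)" by (rule state_facts)
lemma v_sq: "square_integrable (v t)" by (rule state_facts)
lemma U_u_integrable: "integrable lborel (\<lambda>x. U (u t x))" by (rule state_facts)
lemma energy_density_integrable: "integrable lborel (\<lambda>x. (p t x)\<^sup>2 / 2 + U (u t x))" by (rule state_facts)
lemma u_at_bot: "(u t \<longlongrightarrow> l) at_bot" by (rule state_facts)
lemma u_at_top: "(u t \<longlongrightarrow> r) at_top" by (rule state_facts)

lemma UI_nonneg: "UI t \<ge> 0"
  unfolding UI_def by (intro integral_nonneg_AE) (simp add: U_nonneg)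

lemma pe_eq: "pe t = pot_energy (u t) (p t)"
proof -
  have "integrable lborel (\<lambda>x. (p t x)\<^sup>2 / 2)" using square_integrable_square[OF p_sq] by simp
  then have "pot_energy (u t) (p t) = (LINT x|lborel. (p t x)\<^sup>2 / 2) + (LINT x|lborel. U (u t x))"
    unfolding pot_energy_def using U_u_integrable by (rule Bochner_Integration.integral_add)
  then show ?thesis by (simp add: pe_def P_def norm_abs_l2 p_sq UI_def)
qed

lemma energy_eq: "energy (\<Phi> t) = ennreal (en t)"
  using state_facts(10)[of t] by (simp add: state_eq en_def pe_eq V_def norm_abs_l2 v_sq)

lemma pe_nonneg: "pe t \<ge> 0" using UI_nonneg by (simp add: pe_def)

lemma en_nonneg: "en t \<ge> 0" using pe_nonneg by (simp add: en_def)

lemma u_bound: "\<bar>u t x\<bar> \<le> 4 + 6 * pe t"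
  unfolding pe_eq by (rule sup_bound[OF u_primitive energy_density_integrable u_at_top r])

lemma u_diff_sq: "square_integrable (\<lambda>x. u s x - u t x)"
  by (rule finite_energy_diff_square_integrable[OF u_continuous u_continuous U_u_integrable U_u_integrable
     u_at_bot u_at_bot l u_at_top u_at_top r])

lemma D_diff: "D s - D t = abs_l2 (\<lambda>x. u s x - u t x)"
  unfolding D_def by (simp add: abs_l2_diff u_diff_sq)

lemma P_diff: "P s - P t = abs_l2 (\<lambda>x. p s x - p t x)"
  unfolding P_def by (simp add: abs_l2_diff p_sq)

lemma u_diff_primitive: "is_primitive (\<lambda>x. u s x - u t x) (\<lambda>x. p s x - p t x)"
  by (intro is_primitive_diff u_primitive)

lemma D_deriv: "l2_deriv (D s - D t) (P s - P t)"
  unfolding D_diff P_diff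
  by (intro is_primitive_imp_l2_deriv u_diff_primitive u_diff_sq square_integrable_diff p_sq)

lemma u_diff_sup: "(u s x - u t x)\<^sup>2 \<le> 2 * norm (D s - D t) * norm (P s - P t)"
  unfolding D_diff P_diff
  by (rule H1_sup_bound[OF u_diff_primitive u_diff_sq square_integrable_diff[OF p_sq p_sq]])

lemma dU_sq: "square_integrable (\<lambda>x. dU (u t x))"
  by (rule dU_square_integrable[OF u_continuous U_u_integrable u_bound])

lemma N_Lipschitz:
  assumes "\<And>x. \<bar>u s x\<bar> \<le> K" "\<And>x. \<bar>u t x\<bar> \<le> K"
  shows "norm (N s - N t) \<le> (3 * K\<^sup>2 + 1) / 2 * norm (D s - D t)"
  unfolding N_def D_diff
  by (rule Lipschitz_dU_norm[OF assms(2,1) u_diff_sq dU_sq dU_sq])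

lemma UI_Taylor:
  assumes "\<And>x. \<bar>u s x\<bar> \<le> K" "\<And>x. \<bar>u t x\<bar> \<le> K"
  shows "\<bar>UI s - UI t - inner (N t) (D s - D t)\<bar> \<le> (3 * K\<^sup>2 + 1) / 2 * (norm (D s - D t))\<^sup>2"
  unfolding UI_def N_def D_diff
  by (rule U_integral_Taylor(2)[OF assms(2,1) u_continuous U_u_integrable u_diff_sq dU_sq])

subsection \<open>Continuity in time\<close>

lemma L2_norm_sq_eq: "square_integrable f \<Longrightarrow> L2_norm_sq f = ennreal ((norm (abs_l2 f))\<^sup>2)"
  unfolding L2_norm_sq_def
  by (subst nn_integral_eq_integral) (auto simp: norm_abs_l2 square_integrable_square)

lemma H1_L2_diff:
  "H1_L2_norm_sq (\<Phi> s - \<Phi> t) = ennreal ((norm (D s - D t))\<^sup>2 + (norm (P s - P t))\<^sup>2 + (norm (V s - V t))\<^sup>2)"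
proof -
  have "\<Phi> s - \<Phi> t = (\<lambda>x. u s x - u t x, \<lambda>x. v s x - v t x)"
    by (simp add: state_eq minus_prod_def fun_diff_def)
  moreover have "L2_norm_sq (weak_deriv (\<lambda>x. u s x - u t x)) = L2_norm_sq (\<lambda>x. p s x - p t x)"
  proof -
    have "is_primitive (\<lambda>x. u s x - u t x) (weak_deriv (\<lambda>x. u s x - u t x))"
      using is_primitive_imp_weak_derivative[OF u_diff_primitive]
      by (intro weak_deriv_is_primitive is_primitive_continuous[OF u_diff_primitive]) blast
    then have "AE x in lborel. weak_deriv (\<lambda>x. u s x - u t x) x = p s x - p t x"
      by (rule is_primitive_unique[OF _ u_diff_primitive])
    then show ?thesis unfolding L2_norm_sq_def by (intro nn_integral_cong_AE) (auto elim!: eventually_mono)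
  qed
  moreover have "abs_l2 (\<lambda>x. v s x - v t x) = V s - V t" by (simp add: V_def abs_l2_diff v_sq)
  ultimately show ?thesis
    by (simp add: H1_L2_norm_sq_def L2_norm_sq_eq u_diff_sq square_integrable_diff p_sq v_sq
        D_diff P_diff ennreal_plus)
qed

lemma curves_tendsto:
  "((\<lambda>s. D s) \<longlongrightarrow> D t) (at t)" "((\<lambda>s. P s) \<longlongrightarrow> P t) (at t)" "((\<lambda>s. V s) \<longlongrightarrow> V t) (at t)"
proof -
  let ?f = "\<lambda>s. (norm (D s - D t))\<^sup>2 + (norm (P s - P t))\<^sup>2 + (norm (V s - V t))\<^sup>2"
  have "((\<lambda>s. ennreal (?f s)) \<longlongrightarrow> ennreal 0) (at t)"
    using cont by (simp add: continuous_in_time_def H1_L2_diff)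
  then have f: "(?f \<longlongrightarrow> 0) (at t)" by (rule tendsto_ennreal_iff[THEN iffD1, rotated 2]) auto
  have sq: "(X \<longlongrightarrow> X t) (at t)" if le: "\<And>s. (norm (X s - X t))\<^sup>2 \<le> ?f s" for X :: "real \<Rightarrow> l2"
  proof -
    have "((\<lambda>s. (norm (X s - X t))\<^sup>2) \<longlongrightarrow> 0) (at t)"
      by (rule tendsto_sandwich[OF _ _ tendsto_const f]) (auto intro: always_eventually le)
    then have "((\<lambda>s. sqrt ((norm (X s - X t))\<^sup>2)) \<longlongrightarrow> sqrt 0) (at t)" by (rule tendsto_real_sqrt)
    then have "((\<lambda>s. norm (X s - X t)) \<longlongrightarrow> 0) (at t)" by simp
    then show ?thesis by (rule Lim_null[THEN iffD2, OF tendsto_norm_zero_cancel])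
  qed
  show "((\<lambda>s. D s) \<longlongrightarrow> D t) (at t)" by (rule sq) auto
  show "((\<lambda>s. P s) \<longlongrightarrow> P t) (at t)" by (rule sq) auto
  show "((\<lambda>s. V s) \<longlongrightarrow> V t) (at t)" by (rule sq) auto
qed

lemma D_continuous: "continuous_on A D" and P_continuous: "continuous_on A P"
  and V_continuous: "continuous_on A V"
  by (intro continuous_at_imp_continuous_on ballI, simp add: isCont_def curves_tendsto)+

text \<open>A small displacement in \<open>H\<^sup>1\<close> is small uniformly. A bound that is global in time has to wait for
  the conservation of energy, whose proof uses this one.\<close>

lemma u_locally_bounded: "\<exists>K. eventually (\<lambda>s. \<forall>x. \<bar>u s x\<bar> \<le> K) (nhds t)"
proof -
  have "((\<lambda>s. 2 * norm (D s - D t) * norm (P s - P t)) \<longlongrightarrow> 2 * norm (D t - D t) * norm (P t - P t)) (at t)"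
    by (intro tendsto_intros curves_tendsto)
  then have "eventually (\<lambda>s. 2 * norm (D s - D t) * norm (P s - P t) < 1) (at t)"
    by (rule order_tendstoD) simp
  then have "eventually (\<lambda>s. 2 * norm (D s - D t) * norm (P s - P t) < 1) (nhds t)"
    by (simp add: eventually_nhds_conv_at)
  then have "eventually (\<lambda>s. \<forall>x. \<bar>u s x\<bar> \<le> 4 + 6 * pe t + 1) (nhds t)"
  proof eventually_elim
    case (elim s)
    show ?case
    proof
      fix x
      have "\<bar>u s x - u t x\<bar>\<^sup>2 \<le> 1\<^sup>2" using u_diff_sup[of s x t] elim by simp
      then have "\<bar>u s x - u t x\<bar> \<le> 1" by (rule power2_le_imp_le) simp
      then show "\<bar>u s x\<bar> \<le> 4 + 6 * pe t + 1" using u_bound[of t x] by linarith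
    qed
  qed
  then show ?thesis by blast
qed

lemma N_tendsto: "((\<lambda>s. N s) \<longlongrightarrow> N t) (at t)"
proof -
  obtain K where K: "eventually (\<lambda>s. \<forall>x. \<bar>u s x\<bar> \<le> K) (nhds t)" using u_locally_bounded by blast
  have Kt: "\<forall>x. \<bar>u t x\<bar> \<le> K" by (rule eventually_nhds_x_imp_x[OF K])
  have "eventually (\<lambda>s. norm (N s - N t) \<le> (3 * K\<^sup>2 + 1) / 2 * norm (D s - D t)) (at t)"
    unfolding eventually_at_filter using K
  proof eventually_elim
    case (elim s)
    then show ?case using N_Lipschitz[of s K t] Kt by blast
  qed
  moreover have "((\<lambda>s. (3 * K\<^sup>2 + 1) / 2 * norm (D s - D t)) \<longlongrightarrow> (3 * K\<^sup>2 + 1) / 2 * norm (D t - D t)) (at t)"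
    by (intro tendsto_intros curves_tendsto)
  then have "((\<lambda>s. (3 * K\<^sup>2 + 1) / 2 * norm (D s - D t)) \<longlongrightarrow> 0) (at t)" by simp
  ultimately have "((\<lambda>s. N s - N t) \<longlongrightarrow> 0) (at t)" by (rule Lim_null_comparison)
  then show ?thesis by (rule Lim_null[THEN iffD2])
qed

lemma N_continuous: "continuous_on A N"
  by (intro continuous_at_imp_continuous_on ballI) (simp add: isCont_def N_tendsto)

subsection \<open>The equation tested in space\<close>

lemma u_test:
  assumes "test_function \<psi>"
  shows "(LINT x|lborel. u t x * \<psi> x) = (LINT x|lborel. u 0 x * \<psi> x) + inner (D t) (abs_l2 \<psi>)"
proof -
  have "inner (D t) (abs_l2 \<psi>) = (LINT x|lborel. (u t x - u 0 x) * \<psi> x)"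
    unfolding D_def by (simp add: inner_abs_l2 u_diff_sq test_function_square_integrable assms)
  also have "\<dots> = (LINT x|lborel. u t x * \<psi> x) - (LINT x|lborel. u 0 x * \<psi> x)"
    unfolding left_diff_distrib
    by (intro Bochner_Integration.integral_diff test_times_integrable assms
        locally_integrable_continuous u_continuous)
  finally show ?thesis by simp
qed

lemma inner_curve_continuous:
  "continuous_on UNIV X \<Longrightarrow> continuous_on UNIV (\<lambda>t. inner (X t) g)" for X :: "real \<Rightarrow> l2"
  by (intro continuous_intros)

text \<open>The part of the field that is constant in time drops out because \<open>a'\<close> has integral \<open>0\<close>.\<close>

lemma D_weak_derivative:
  assumes \<psi>: "test_function \<psi>"
  shows "has_weak_derivative (\<lambda>t. inner (D t) (abs_l2 \<psi>)) (\<lambda>t. inner (V t) (abs_l2 \<psi>))"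
  unfolding has_weak_derivative_def
proof (intro conjI allI impI)
  show lD: "locally_integrable (\<lambda>t. inner (D t) (abs_l2 \<psi>))"
    and "locally_integrable (\<lambda>t. inner (V t) (abs_l2 \<psi>))"
    by (intro locally_integrable_continuous inner_curve_continuous D_continuous V_continuous)+
  fix a :: "real \<Rightarrow> real" assume a: "test_function a"
  define c where "c = (LINT x|lborel. u 0 x * \<psi> x)"
  have d: "deriv (\<lambda>s. a s * \<psi> x) t = deriv a t * \<psi> x" for t x
    by (rule DERIV_imp_deriv) (auto intro!: derivative_eq_intros test_function_has_derivative a)
  have "- (LINT t|lborel. LINT x|lborel. u t x * deriv (\<lambda>s. a s * \<psi> x) t)
      = (LINT t|lborel. LINT x|lborel. v t x * (a t * \<psi> x))"
    using sol[unfolded solves_in_distributions_def, rule_format, OF test_function_tensor[OF a \<psi>], THEN conjunct1]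
    unfolding u_def v_def fst_conv snd_conv .
  moreover have "(LINT x|lborel. u t x * deriv (\<lambda>s. a s * \<psi> x) t)
      = c * deriv a t + inner (D t) (abs_l2 \<psi>) * deriv a t" for t
  proof -
    have "(LINT x|lborel. u t x * deriv (\<lambda>s. a s * \<psi> x) t) = (LINT x|lborel. deriv a t * (u t x * \<psi> x))"
      unfolding d by (simp add: mult_ac)
    also have "\<dots> = deriv a t * (c + inner (D t) (abs_l2 \<psi>))"
      unfolding c_def u_test[OF \<psi>, of t, symmetric] by simp
    finally show ?thesis by (simp add: algebra_simps)
  qed
  moreover have "(LINT x|lborel. v t x * (a t * \<psi> x)) = inner (V t) (abs_l2 \<psi>) * a t" for t
  proof -
    have "(LINT x|lborel. v t x * (a t * \<psi> x)) = (LINT x|lborel. a t * (v t x * \<psi> x))"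
      by (simp add: mult_ac)
    then show ?thesis unfolding V_def by (simp add: inner_abs_l2 v_sq test_function_square_integrable \<psi>)
  qed
  moreover have "(LINT t|lborel. c * deriv a t + inner (D t) (abs_l2 \<psi>) * deriv a t)
     = (LINT t|lborel. c * deriv a t) + (LINT t|lborel. inner (D t) (abs_l2 \<psi>) * deriv a t)"
    by (intro Bochner_Integration.integral_add test_times_integrable lD test_function_deriv a
       locally_integrable_continuous) auto
  moreover have "(LINT t|lborel. c * deriv a t) = 0"
    using is_primitive_imp_weak_derivative[OF is_primitive_const[of c]] a
    by (simp add: has_weak_derivative_def)
  ultimately show "(LINT t|lborel. inner (D t) (abs_l2 \<psi>) * deriv a t) = - (LINT t|lborel. inner (V t) (abs_l2 \<psi>) * a t)"
    by auto
qed

lemma V_weak_derivative: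
  assumes \<psi>: "test_function \<psi>"
  shows "has_weak_derivative (\<lambda>t. inner (V t) (abs_l2 \<psi>))
    (\<lambda>t. - inner (P t) (abs_l2 (deriv \<psi>)) - inner (N t) (abs_l2 \<psi>))"
  unfolding has_weak_derivative_def
proof (intro conjI allI impI)
  show "locally_integrable (\<lambda>t. inner (V t) (abs_l2 \<psi>))"
    by (intro locally_integrable_continuous inner_curve_continuous V_continuous)
  show "locally_integrable (\<lambda>t. - inner (P t) (abs_l2 (deriv \<psi>)) - inner (N t) (abs_l2 \<psi>))"
    by (intro locally_integrable_continuous continuous_intros inner_curve_continuous P_continuous N_continuous)
  fix a :: "real \<Rightarrow> real" assume a: "test_function a"
  note d\<psi> = test_function_deriv[OF \<psi>]
  note d2\<psi> = test_function_deriv[OF d\<psi>]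
  have d: "deriv (\<lambda>s. a s * \<psi> x) t = deriv a t * \<psi> x" for t x
    by (rule DERIV_imp_deriv) (auto intro!: derivative_eq_intros test_function_has_derivative a)
  have d1: "deriv (\<lambda>y. c * g y) = (\<lambda>y. c * deriv g y)" if "test_function g" for g :: "real \<Rightarrow> real" and c
    by (rule ext, rule DERIV_imp_deriv) (auto intro!: derivative_eq_intros test_function_has_derivative that)
  have d2: "(deriv ^^ 2) (\<lambda>y. a t * \<psi> y) x = a t * deriv (deriv \<psi>) x" for t x
    by (simp add: numeral_2_eq_2 d1 \<psi> d\<psi>)
  have "- (LINT t|lborel. LINT x|lborel. v t x * deriv (\<lambda>s. a s * \<psi> x) t)
      = (LINT t|lborel. LINT x|lborel. u t x * (deriv ^^ 2) (\<lambda>y. a t * \<psi> y) x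
          - deriv U (u t x) * (a t * \<psi> x))"
    using sol[unfolded solves_in_distributions_def, rule_format, OF test_function_tensor[OF a \<psi>], THEN conjunct2]
    unfolding u_def v_def fst_conv snd_conv .
  moreover have "(LINT x|lborel. v t x * deriv (\<lambda>s. a s * \<psi> x) t) = inner (V t) (abs_l2 \<psi>) * deriv a t" for t
  proof -
    have "(LINT x|lborel. v t x * deriv (\<lambda>s. a s * \<psi> x) t) = (LINT x|lborel. deriv a t * (v t x * \<psi> x))"
      unfolding d by (simp add: mult_ac)
    then show ?thesis unfolding V_def by (simp add: inner_abs_l2 v_sq test_function_square_integrable \<psi>)
  qed
  moreover have "(LINT x|lborel. u t x * (deriv ^^ 2) (\<lambda>y. a t * \<psi> y) x - deriv U (u t x) * (a t * \<psi> x))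
     = (- inner (P t) (abs_l2 (deriv \<psi>)) - inner (N t) (abs_l2 \<psi>)) * a t" for t
  proof -
    have i1: "integrable lborel (\<lambda>x. u t x * deriv (deriv \<psi>) x)"
      by (intro test_times_integrable locally_integrable_continuous u_continuous d2\<psi>)
    have i2: "integrable lborel (\<lambda>x. dU (u t x) * \<psi> x)"
      by (intro test_times_integrable square_integrable_locally_integrable dU_sq \<psi>)
    have "(LINT x|lborel. u t x * (deriv ^^ 2) (\<lambda>y. a t * \<psi> y) x - deriv U (u t x) * (a t * \<psi> x))
      = (LINT x|lborel. a t * (u t x * deriv (deriv \<psi>) x - dU (u t x) * \<psi> x))"
      unfolding d2 deriv_U by (simp add: algebra_simps)
    also have "\<dots> = a t * ((LINT x|lborel. u t x * deriv (deriv \<psi>) x) - (LINT x|lborel. dU (u t x) * \<psi> x))"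
      using i1 i2 by simp
    also have "(LINT x|lborel. u t x * deriv (deriv \<psi>) x) = - (LINT x|lborel. p t x * deriv \<psi> x)"
      using is_primitive_imp_weak_derivative[OF u_primitive] d\<psi> by (simp add: has_weak_derivative_def)
    finally show ?thesis
      unfolding P_def N_def
      by (simp add: inner_abs_l2 p_sq dU_sq test_function_square_integrable \<psi> d\<psi> mult.commute)
  qed
  ultimately show "(LINT t|lborel. inner (V t) (abs_l2 \<psi>) * deriv a t)
     = - (LINT t|lborel. (- inner (P t) (abs_l2 (deriv \<psi>)) - inner (N t) (abs_l2 \<psi>)) * a t)"
    by simp
qed

lemma D_integral:
  assumes "s \<le> t"
  shows "D t - D s = integral {s..t} V"
proof (rule l2_eq_if_tests)
  fix \<psi> :: "real \<Rightarrow> real" assume \<psi>: "test_function \<psi>"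
  have "is_primitive (\<lambda>t. inner (D t) (abs_l2 \<psi>)) (\<lambda>t. inner (V t) (abs_l2 \<psi>))"
    by (intro weak_derivative_continuous_imp_primitive D_weak_derivative \<psi> inner_curve_continuous D_continuous)
  from is_primitive_integral[OF this assms] LINT_eq_integral(1)[OF is_primitive_locally_integrable[OF this]]
  show "inner (D t - D s) (abs_l2 \<psi>) = inner (integral {s..t} V) (abs_l2 \<psi>)"
    by (simp add: inner_integral V_continuous inner_diff_left)
qed

text \<open>Integrating the equation in time removes the derivative of \<open>V\<close>: the time integral of \<open>P\<close>
  has a weak derivative in \<open>L\<^sup>2\<close>.\<close>

lemma P_integral_deriv:
  assumes "s \<le> t"
  shows "l2_deriv (integral {s..t} P) (V t - V s + integral {s..t} N)"
  unfolding l2_deriv_def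
proof (intro allI impI)
  fix \<psi> :: "real \<Rightarrow> real" assume \<psi>: "test_function \<psi>"
  have pr: "is_primitive (\<lambda>t. inner (V t) (abs_l2 \<psi>))
    (\<lambda>t. - inner (P t) (abs_l2 (deriv \<psi>)) - inner (N t) (abs_l2 \<psi>))"
    by (intro weak_derivative_continuous_imp_primitive V_weak_derivative \<psi> inner_curve_continuous V_continuous)
  have i: "(\<lambda>t. inner (P t) (abs_l2 (deriv \<psi>))) integrable_on {s..t}" "(\<lambda>t. inner (N t) (abs_l2 \<psi>)) integrable_on {s..t}"
    by (intro curve_integrable inner_curve_continuous P_continuous N_continuous)+
  have "inner (V t) (abs_l2 \<psi>) - inner (V s) (abs_l2 \<psi>)
     = integral {s..t} (\<lambda>t. - inner (P t) (abs_l2 (deriv \<psi>)) - inner (N t) (abs_l2 \<psi>))"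
    using is_primitive_integral[OF pr assms] LINT_eq_integral(1)[OF is_primitive_locally_integrable[OF pr]] by simp
  also have "\<dots> = - integral {s..t} (\<lambda>t. inner (P t) (abs_l2 (deriv \<psi>))) - integral {s..t} (\<lambda>t. inner (N t) (abs_l2 \<psi>))"
    using i by (subst Henstock_Kurzweil_Integration.integral_diff) (auto intro: integrable_neg)
  finally show "inner (integral {s..t} P) (abs_l2 (deriv \<psi>)) = - inner (V t - V s + integral {s..t} N) (abs_l2 \<psi>)"
    by (simp add: inner_integral P_continuous N_continuous inner_diff_left inner_add_left)
qed

text \<open>Integration by parts extends the equation from test functions to all \<open>g\<close> in \<open>H\<^sup>1\<close>.\<close>

lemma V_diff_inner:
  assumes g: "l2_deriv g g'" and "s \<le> t"
  shows "inner (V t - V s) g = - inner (integral {s..t} P) g' - inner (integral {s..t} N) g"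
  using l2_integration_by_parts[OF P_integral_deriv[OF \<open>s \<le> t\<close>] g] by (simp add: inner_add_left)

end

section \<open>Conservation of energy and the virial identity\<close>

lemma has_vector_derivative_slope:
  fixes f :: "real \<Rightarrow> 'a::real_normed_vector"
  shows "(f has_vector_derivative f') (at x) \<longleftrightarrow> ((\<lambda>y. (f y - f x) /\<^sub>R (y - x)) \<longlongrightarrow> f') (at x)"
proof -
  have "(f has_vector_derivative f') (at x)
     \<longleftrightarrow> ((\<lambda>y. norm ((f y - f x) - (y - x) *\<^sub>R f') / norm (y - x)) \<longlongrightarrow> 0) (at x)"
    unfolding has_vector_derivative_def has_derivative_iff_norm
    by (simp add: bounded_linear_scaleR_left)
  also have "\<dots> \<longleftrightarrow> ((\<lambda>y. norm ((f y - f x) /\<^sub>R (y - x) - f')) \<longlongrightarrow> 0) (at x)"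
  proof (rule tendsto_cong)
    show "eventually (\<lambda>y. norm ((f y - f x) - (y - x) *\<^sub>R f') / norm (y - x) = norm ((f y - f x) /\<^sub>R (y - x) - f')) (at x)"
      unfolding eventually_at_filter
    proof (rule always_eventually, intro allI impI)
      fix y :: real assume "y \<noteq> x"
      then have "(f y - f x) /\<^sub>R (y - x) - f' = ((f y - f x) - (y - x) *\<^sub>R f') /\<^sub>R (y - x)"
        by (simp add: scaleR_diff_right)
      then show "norm ((f y - f x) - (y - x) *\<^sub>R f') / norm (y - x) = norm ((f y - f x) /\<^sub>R (y - x) - f')"
        by (simp add: divide_inverse mult.commute)
    qed
  qed
  also have "\<dots> \<longleftrightarrow> ((\<lambda>y. (f y - f x) /\<^sub>R (y - x)) \<longlongrightarrow> f') (at x)"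
    by (simp add: tendsto_norm_zero_iff LIM_zero_iff)
  finally show ?thesis .
qed

lemma integral_from_has_vector_derivative:
  fixes X :: "real \<Rightarrow> 'a::banach"
  assumes "continuous_on UNIV X" "a < t"
  shows "((\<lambda>s. integral {a..s} X) has_vector_derivative X t) (at t)"
proof -
  have "((\<lambda>s. integral {a..s} X) has_vector_derivative X t) (at t within {a..t+1})"
    using assms by (intro integral_has_vector_derivative) (auto intro: continuous_on_subset)
  moreover have "at t within {a..t+1} = at t"
    using assms by (intro at_within_interior) (simp add: interior_atLeastAtMost_real)
  ultimately show ?thesis by simp
qed

lemma moving_integral_has_vector_derivative:
  fixes X :: "real \<Rightarrow> 'a::banach"
  assumes X: "continuous_on UNIV X" and h: "h > 0"
  shows "((\<lambda>s. integral {s..s+h} X) has_vector_derivative X (t + h) - X t) (at t)"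
proof -
  define a where "a = t - 1"
  have i: "X integrable_on {c..d}" for c d
    by (rule integrable_continuous_interval[OF continuous_on_subset[OF X]]) auto
  have shift: "((\<lambda>s. integral {a..s + h} X) has_vector_derivative X (t + h)) (at t)"
  proof -
    have "((\<lambda>s. integral {a..s} X) has_vector_derivative X (t + h)) (at (t + h))"
      using h by (intro integral_from_has_vector_derivative X) (auto simp: a_def)
    moreover have "((\<lambda>s. s + h) has_vector_derivative 1) (at t)"
      by (auto intro!: derivative_eq_intros)
    ultimately show ?thesis
      using vector_diff_chain_at[of "\<lambda>s. s + h" 1 t "\<lambda>s. integral {a..s} X" "X (t + h)"] by (simp add: o_def)
  qed
  have "((\<lambda>s. integral {a..s + h} X - integral {a..s} X) has_vector_derivative X (t + h) - X t) (at t)"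
    by (intro has_vector_derivative_diff shift integral_from_has_vector_derivative X) (simp add: a_def)
  then show ?thesis
  proof (rule has_vector_derivative_transform_within_open[of _ _ _ "{a<..}"])
    fix s assume "s \<in> {a<..}"
    then have "integral {a..s} X + integral {s..s+h} X = integral {a..s+h} X"
      using h by (intro Henstock_Kurzweil_Integration.integral_combine i) auto
    then show "integral {a..s + h} X - integral {a..s} X = integral {s..s+h} X"
      by (metis add_diff_cancel_left')
  qed (auto simp: a_def)
qed

text \<open>Uniformity in \<open>t\<close> allows the limit \<open>h \<longrightarrow> 0\<close> in the energy identity for time averages.\<close>

lemma average_uniform_limit:
  fixes X :: "real \<Rightarrow> 'a::banach"
  assumes X: "continuous_on UNIV X"
  shows "uniform_limit {a..b} (\<lambda>h t. integral {t..t+h} X /\<^sub>R h) X (at_right 0)"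
proof (rule uniform_limitI)
  fix e :: real assume "e > 0"
  have "uniformly_continuous_on {a..b+1} X"
    using X by (intro compact_uniformly_continuous) (auto intro: continuous_on_subset)
  then obtain d where d: "d > 0"
    "\<And>s t. s \<in> {a..b+1} \<Longrightarrow> t \<in> {a..b+1} \<Longrightarrow> dist s t < d \<Longrightarrow> dist (X s) (X t) < e / 2"
    unfolding uniformly_continuous_on_def using \<open>e > 0\<close> half_gt_zero by metis
  have "\<forall>t\<in>{a..b}. dist (integral {t..t+h} X /\<^sub>R h) (X t) < e" if h: "0 < h" "h < min d 1" for h
  proof
    fix t assume t: "t \<in> {a..b}"
    have i: "X integrable_on {t..t+h}"
      by (rule integrable_continuous_interval[OF continuous_on_subset[OF X]]) auto
    have "norm (integral {t..t+h} (\<lambda>s. X s - X t)) \<le> e / 2 * (t + h - t)"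
    proof (rule integral_bound)
      show "norm (X s - X t) \<le> e / 2" if "s \<in> {t..t+h}" for s
      proof -
        have "dist (X s) (X t) < e / 2"
          by (rule d(2)) (use that t h in \<open>auto simp: dist_real_def\<close>)
        then show ?thesis by (simp add: dist_norm)
      qed
      show "continuous_on {t..t + h} (\<lambda>s. X s - X t)"
        by (intro continuous_on_diff continuous_on_const continuous_on_subset[OF X]) simp
    qed (use h in simp)
    also have "integral {t..t+h} (\<lambda>s. X s - X t) = integral {t..t+h} X - h *\<^sub>R X t"
      using i h by (subst Henstock_Kurzweil_Integration.integral_diff) auto
    finally have J: "norm (integral {t..t+h} X - h *\<^sub>R X t) \<le> e / 2 * h" by simp
    have eq: "integral {t..t+h} X /\<^sub>R h - X t = (integral {t..t+h} X - h *\<^sub>R X t) /\<^sub>R h"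
      using h by (simp add: scaleR_diff_right)
    have "norm (integral {t..t+h} X /\<^sub>R h - X t) = norm (integral {t..t+h} X - h *\<^sub>R X t) / h"
      unfolding eq norm_scaleR using h(1) by (simp add: divide_inverse_commute)
    also have "\<dots> \<le> e / 2"
      using h(1) J by (subst pos_divide_le_eq) auto
    finally have "norm (integral {t..t+h} X /\<^sub>R h - X t) \<le> e / 2" .
    then show "dist (integral {t..t+h} X /\<^sub>R h) (X t) < e"
      using \<open>e > 0\<close> by (simp add: dist_norm)
  qed
  then show "eventually (\<lambda>h. \<forall>t\<in>{a..b}. dist (integral {t..t+h} X /\<^sub>R h) (X t) < e) (at_right 0)"
    unfolding eventually_at_right_field using d(1)
    by (intro exI[of _ "min d 1"]) auto
qed

context kg_solution
begin

lemma D_has_vector_derivative: "(D has_vector_derivative V t) (at t)"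
proof -
  have "((\<lambda>s. D (t - 1) + integral {t - 1..s} V) has_vector_derivative 0 + V t) (at t)"
    by (intro has_vector_derivative_add has_vector_derivative_const
        integral_from_has_vector_derivative V_continuous) simp
  then have "((\<lambda>s. D (t - 1) + integral {t - 1..s} V) has_vector_derivative V t) (at t)" by simp
  then show ?thesis
    by (rule has_vector_derivative_transform_within_open[of _ _ _ "{t-1<..}"])
       (auto simp: D_integral[symmetric])
qed

text \<open>The Taylor remainder is quadratic in the displacement, which is itself differentiable in \<open>L\<^sup>2\<close>.\<close>

lemma UI_has_derivative: "(UI has_real_derivative inner (N t) (V t)) (at t)"
proof -
  obtain K where K: "eventually (\<lambda>s. \<forall>x. \<bar>u s x\<bar> \<le> K) (nhds t)" using u_locally_bounded by blast
  have Kt: "\<forall>x. \<bar>u t x\<bar> \<le> K" by (rule eventually_nhds_x_imp_x[OF K])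
  define C where "C = (3 * K\<^sup>2 + 1) / 2"
  have slope: "((\<lambda>s. (D s - D t) /\<^sub>R (s - t)) \<longlongrightarrow> V t) (at t)"
    by (rule D_has_vector_derivative[unfolded has_vector_derivative_slope])
  define R where "R s = UI s - UI t - inner (N t) (D s - D t)" for s
  have "((\<lambda>s. C * norm ((D s - D t) /\<^sub>R (s - t)) * norm (D s - D t)) \<longlongrightarrow> C * norm (V t) * norm (D t - D t)) (at t)"
    by (intro tendsto_intros slope curves_tendsto)
  then have lim: "((\<lambda>s. C * norm ((D s - D t) /\<^sub>R (s - t)) * norm (D s - D t)) \<longlongrightarrow> 0) (at t)" by simp
  have ev: "eventually (\<lambda>s. norm (R s / (s - t)) \<le> C * norm ((D s - D t) /\<^sub>R (s - t)) * norm (D s - D t)) (at t)"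
    unfolding eventually_at_filter using K
  proof eventually_elim
    case (elim s)
    show ?case
    proof (intro impI)
      assume "s \<noteq> t"
      have "\<bar>R s\<bar> \<le> C * (norm (D s - D t))\<^sup>2" unfolding R_def C_def using elim Kt by (intro UI_Taylor) auto
      then have "\<bar>R s\<bar> / \<bar>s - t\<bar> \<le> C * (norm (D s - D t))\<^sup>2 / \<bar>s - t\<bar>" by (rule divide_right_mono) simp
      then show "norm (R s / (s - t)) \<le> C * norm ((D s - D t) /\<^sub>R (s - t)) * norm (D s - D t)"
        by (simp add: power2_eq_square divide_inverse mult_ac abs_mult)
    qed
  qed
  have "((\<lambda>s. R s / (s - t)) \<longlongrightarrow> 0) (at t)"
    by (rule Lim_null_comparison[OF ev lim])
  moreover have "((\<lambda>s. inner (N t) ((D s - D t) /\<^sub>R (s - t))) \<longlongrightarrow> inner (N t) (V t)) (at t)"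
    by (intro tendsto_intros slope)
  ultimately have "((\<lambda>s. R s / (s - t) + inner (N t) ((D s - D t) /\<^sub>R (s - t))) \<longlongrightarrow> 0 + inner (N t) (V t)) (at t)"
    by (rule tendsto_add)
  moreover have "R s / (s - t) + inner (N t) ((D s - D t) /\<^sub>R (s - t)) = (UI s - UI t) /\<^sub>R (s - t)" for s
    unfolding R_def by (simp add: divide_inverse algebra_simps)
  ultimately have "((\<lambda>s. (UI s - UI t) /\<^sub>R (s - t)) \<longlongrightarrow> inner (N t) (V t)) (at t)" by simp
  then show ?thesis
    unfolding has_real_derivative_iff_has_vector_derivative has_vector_derivative_slope .
qed

text \<open>For the time averages over \<open>[t, t + h]\<close> the equation holds in \<open>L\<^sup>2\<close>, so the energy identity for
  them follows from integration by parts in space.\<close>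

lemma averaged_energy_derivative:
  assumes h: "h > 0"
  shows "((\<lambda>t. ((norm (integral {t..t+h} V /\<^sub>R h))\<^sup>2 + (norm (integral {t..t+h} P /\<^sub>R h))\<^sup>2) / 2 + UI t)
    has_real_derivative
      inner (N t) (V t) - inner (integral {t..t+h} V /\<^sub>R h) (integral {t..t+h} N /\<^sub>R h)) (at t)"
proof -
  let ?I = "\<lambda>X s. integral {s..s+h} X"
  have d: "((\<lambda>s. inner (?I X s) (?I X s)) has_real_derivative 2 * inner (?I X t) (X (t+h) - X t)) (at t)"
    if "continuous_on UNIV X" for X :: "real \<Rightarrow> l2"
    using bounded_bilinear.has_vector_derivative[OF bounded_bilinear_inner
        moving_integral_has_vector_derivative[OF that h] moving_integral_has_vector_derivative[OF that h]]
    unfolding has_real_derivative_iff_has_vector_derivative by (simp add: inner_commute)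
  have sq: "(norm (?I X s /\<^sub>R h))\<^sup>2 = (1/h\<^sup>2) * inner (?I X s) (?I X s)" for X :: "real \<Rightarrow> l2" and s
    using h by (simp add: power2_norm_eq_inner[symmetric] power_divide divide_inverse power_mult_distrib power_inverse)
  have IV: "?I V s = D (s + h) - D s" for s using h by (simp add: D_integral)
  have parts: "inner (?I V t) (V (t+h) - V t) + inner (?I P t) (P (t+h) - P t) = - inner (?I V t) (?I N t)"
    using V_diff_inner[OF D_deriv[of "t + h" t], of t "t + h"] h by (simp add: IV inner_commute)
  have double: "(c * (2 * x) + c * (2 * y)) / 2 = c * (x + y)" for c x y :: real
    by (simp add: algebra_simps)
  have "((\<lambda>t. ((norm (?I V t /\<^sub>R h))\<^sup>2 + (norm (?I P t /\<^sub>R h))\<^sup>2) / 2 + UI t) has_real_derivative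
     ((1/h\<^sup>2) * (2 * inner (?I V t) (V (t+h) - V t)) + (1/h\<^sup>2) * (2 * inner (?I P t) (P (t+h) - P t))) / 2
       + inner (N t) (V t)) (at t)"
    unfolding sq
    by (intro DERIV_add DERIV_cdivide DERIV_cmult d V_continuous P_continuous UI_has_derivative)
  also have "((1/h\<^sup>2) * (2 * inner (?I V t) (V (t+h) - V t)) + (1/h\<^sup>2) * (2 * inner (?I P t) (P (t+h) - P t))) / 2
     = (1/h\<^sup>2) * (inner (?I V t) (V (t+h) - V t) + inner (?I P t) (P (t+h) - P t))"
    by (rule double)
  also have "\<dots> = - inner (?I V t /\<^sub>R h) (?I N t /\<^sub>R h)"
    unfolding parts by (simp add: power2_eq_square divide_inverse)
  finally show ?thesis by simp
qed

lemma bounded_curve: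
  fixes X :: "real \<Rightarrow> l2"
  assumes "continuous_on UNIV X"
  shows "bounded (X ` {a..b})"
  using compact_continuous_image[OF continuous_on_subset[OF assms subset_UNIV] compact_Icc]
  by (rule compact_imp_bounded)

text \<open>As \<open>h \<longrightarrow> 0\<close> the energy of the averages converges to the energy, and its derivative converges to
  \<open>0\<close> uniformly on \<open>[a, b]\<close>.\<close>

lemma energy_conserved_interval:
  assumes "a < b"
  shows "en b = en a"
proof -
  define e where "e h t = ((norm (integral {t..t+h} V /\<^sub>R h))\<^sup>2 + (norm (integral {t..t+h} P /\<^sub>R h))\<^sup>2) / 2 + UI t" for h t
  have lim: "uniform_limit {a..b} (\<lambda>h t. integral {t..t+h} X /\<^sub>R h) X (at_right 0)"
    if "continuous_on UNIV X" for X :: "real \<Rightarrow> l2" by (rule average_uniform_limit[OF that])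
  have plim: "((\<lambda>h. integral {t..t+h} X /\<^sub>R h) \<longlongrightarrow> X t) (at_right 0)"
    if "continuous_on UNIV X" "t \<in> {a..b}" for X :: "real \<Rightarrow> l2" and t
    using tendsto_uniform_limitI[OF lim[OF that(1)] that(2)] .
  have e: "((\<lambda>h. e h t) \<longlongrightarrow> en t) (at_right 0)" if "t \<in> {a..b}" for t
  proof -
    have "((\<lambda>h. e h t) \<longlongrightarrow> ((norm (V t))\<^sup>2 + (norm (P t))\<^sup>2) / 2 + UI t) (at_right 0)"
      unfolding e_def
      by (rule tendsto_add[OF tendsto_divide[OF tendsto_add[OF tendsto_power[OF tendsto_norm[OF plim]]
            tendsto_power[OF tendsto_norm[OF plim]]] tendsto_const] tendsto_const])
         (simp_all add: V_continuous P_continuous that del: atLeastAtMost_iff)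
    then show ?thesis by (simp add: en_def pe_def add_divide_distrib add_ac)
  qed
  have ul: "uniform_limit {a..b} (\<lambda>h t. inner (integral {t..t+h} V /\<^sub>R h) (integral {t..t+h} N /\<^sub>R h))
      (\<lambda>t. inner (V t) (N t)) (at_right 0)"
    by (rule bounded_bilinear.bounded_uniform_limit[OF bounded_bilinear_inner lim[OF V_continuous]
        lim[OF N_continuous] bounded_curve[OF N_continuous] bounded_curve[OF V_continuous]])
  have small: "\<bar>en b - en a\<bar> \<le> (b - a) * \<epsilon>" if "\<epsilon> > 0" for \<epsilon>
  proof -
    have ev: "eventually (\<lambda>h. \<bar>e h b - e h a\<bar> \<le> (b - a) * \<epsilon>) (at_right 0)"
      using uniform_limitD[OF ul that] eventually_at_right_less[of 0]
    proof eventually_elim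
      case (elim h)
      have der: "(e h has_real_derivative
          inner (N t) (V t) - inner (integral {t..t+h} V /\<^sub>R h) (integral {t..t+h} N /\<^sub>R h)) (at t)" for t
        unfolding e_def[abs_def] by (rule averaged_energy_derivative[OF elim(2)])
      obtain z where "a < z \<and> z < b \<and> e h b - e h a = (b - a) *
          (inner (N z) (V z) - inner (integral {z..z+h} V /\<^sub>R h) (integral {z..z+h} N /\<^sub>R h))"
        by (rule exE[OF MVT2[OF \<open>a < b\<close> der]])
      then have z: "a < z" "z < b" "e h b - e h a = (b - a) *
          (inner (N z) (V z) - inner (integral {z..z+h} V /\<^sub>R h) (integral {z..z+h} N /\<^sub>R h))" by simp_all
      have "\<bar>inner (N z) (V z) - inner (integral {z..z+h} V /\<^sub>R h) (integral {z..z+h} N /\<^sub>R h)\<bar> \<le> \<epsilon>"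
      proof -
        have "dist (inner (integral {z..z+h} V /\<^sub>R h) (integral {z..z+h} N /\<^sub>R h)) (inner (V z) (N z)) < \<epsilon>"
          by (rule bspec[OF elim(1)]) (use z(1,2) in simp)
        then show ?thesis unfolding dist_real_def inner_commute[of "N z"] by linarith
      qed
      then show ?case using \<open>a < b\<close> unfolding z(3) abs_mult by (intro mult_mono) auto
    qed
    have "((\<lambda>h. \<bar>e h b - e h a\<bar>) \<longlongrightarrow> \<bar>en b - en a\<bar>) (at_right 0)"
      using \<open>a < b\<close> by (intro tendsto_rabs tendsto_diff e) auto
    from tendsto_upperbound[OF this ev] show ?thesis by simp
  qed
  have "\<bar>en b - en a\<bar> \<le> 0 + \<epsilon>" if "\<epsilon> > 0" for \<epsilon>
    using small[of "\<epsilon> / (b - a)"] that \<open>a < b\<close> by simp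
  then have "\<bar>en b - en a\<bar> \<le> 0" by (rule field_le_epsilon)
  then show ?thesis by simp
qed

lemma energy_conserved: "en t = en s"
proof (cases s t rule: linorder_cases)
  case less
  then show ?thesis by (rule energy_conserved_interval)
next
  case greater
  then show ?thesis by (rule energy_conserved_interval[symmetric])
qed simp

lemma V_inner_has_derivative:
  assumes g: "l2_deriv g g'"
  shows "((\<lambda>s. inner (V s) g) has_real_derivative - inner (P t) g' - inner (N t) g) (at t)"
proof -
  define a where "a = t - 1"
  have eq: "inner (V s) g = inner (V a) g + - inner (integral {a..s} P) g' - inner (integral {a..s} N) g" if "a < s" for s
    using V_diff_inner[OF g, of a s] that by (simp add: inner_diff_left)
  have d: "((\<lambda>s. inner (integral {a..s} X) k) has_real_derivative inner (X t) k) (at t)"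
    if "continuous_on UNIV X" for X :: "real \<Rightarrow> l2" and k
    unfolding has_real_derivative_iff_has_vector_derivative
    by (rule bounded_linear.has_vector_derivative[OF bounded_linear_inner_left
        integral_from_has_vector_derivative[OF that]]) (simp add: a_def)
  have "((\<lambda>s. inner (V a) g + - inner (integral {a..s} P) g' - inner (integral {a..s} N) g) has_real_derivative
     0 + - inner (P t) g' - inner (N t) g) (at t)"
    by (rule DERIV_diff[OF DERIV_add[OF DERIV_const DERIV_minus[OF d[OF P_continuous]]] d[OF N_continuous]])
  then have "((\<lambda>s. inner (V s) g) has_real_derivative 0 + - inner (P t) g' - inner (N t) g) (at t)"
  proof (rule has_field_derivative_transform_within_open[of _ _ _ "{a<..}"])
    show "inner (V a) g + - inner (integral {a..s} P) g' - inner (integral {a..s} N) g = inner (V s) g"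
      if "s \<in> {a<..}" for s using eq[of s] that by simp
  qed (auto simp: a_def)
  then show ?thesis by simp
qed

text \<open>The velocity is not differentiable in \<open>L\<^sup>2\<close>. Its increments are therefore paired with the fixed
  \<open>H\<^sup>1\<close> function \<open>D t - D a\<close>, while the rest \<open>D s - D t\<close> vanishes at \<open>s = t\<close> and has an \<open>L\<^sup>2\<close>
  derivative there.\<close>

lemma virial_derivative:
  "((\<lambda>s. inner (V s) (D s - D a)) has_real_derivative
     (norm (V t))\<^sup>2 - inner (P t) (P t - P a) - inner (N t) (D t - D a)) (at t)"
proof -
  have "((\<lambda>s. inner (V s) (D s - D t)) has_real_derivative (norm (V t))\<^sup>2) (at t)"
  proof -
    have "((\<lambda>s. (D s - D t) /\<^sub>R (s - t)) \<longlongrightarrow> V t) (at t)"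
      by (rule D_has_vector_derivative[unfolded has_vector_derivative_slope])
    then have "((\<lambda>s. inner (V s) ((D s - D t) /\<^sub>R (s - t))) \<longlongrightarrow> inner (V t) (V t)) (at t)"
      by (intro tendsto_intros curves_tendsto)
    then show ?thesis
      unfolding has_real_derivative_iff_has_vector_derivative has_vector_derivative_slope
      by (simp add: power2_norm_eq_inner)
  qed
  from DERIV_add[OF this V_inner_has_derivative[OF D_deriv[of t a]]]
  have "((\<lambda>s. inner (V s) (D s - D t) + inner (V s) (D t - D a)) has_real_derivative
     (norm (V t))\<^sup>2 + (- inner (P t) (P t - P a) - inner (N t) (D t - D a))) (at t)" .
  moreover have "inner (V s) (D s - D t) + inner (V s) (D t - D a) = inner (V s) (D s - D a)" for s
    by (simp add: inner_add_right[symmetric])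
  ultimately have "((\<lambda>s. inner (V s) (D s - D a)) has_real_derivative
     (norm (V t))\<^sup>2 + (- inner (P t) (P t - P a) - inner (N t) (D t - D a))) (at t)" by simp
  then show ?thesis by (rule DERIV_cong) simp
qed

lemma virial_identity:
  assumes "a \<le> b"
  shows "((\<lambda>t. (norm (V t))\<^sup>2 - inner (P t) (P t - P a) - inner (N t) (D t - D a))
     has_integral inner (V b) (D b - D a)) {a..b}"
proof -
  have "((\<lambda>t. (norm (V t))\<^sup>2 - inner (P t) (P t - P a) - inner (N t) (D t - D a))
     has_integral inner (V b) (D b - D a) - inner (V a) (D a - D a)) {a..b}"
    by (rule fundamental_theorem_of_calculus[OF assms
        has_vector_derivative_at_within[OF virial_derivative[unfolded has_real_derivative_iff_has_vector_derivative]]])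
  then show ?thesis by simp
qed

end

section \<open>The kink and its energy\<close>

lemma kink_G_eq:
  assumes "\<psi> \<in> {-1<..<1}"
  shows "kink_G \<psi> = 2 * artanh \<psi>"
proof -
  have sub: "x \<in> {-1<..<1}" if "min 0 \<psi> \<le> x" "x \<le> max 0 \<psi>" for x using that assms by auto
  have sq: "1 / sqrt (2 * U y) = 2 / (1 - y\<^sup>2)" if "y \<in> {-1<..<1}" for y
  proof -
    have "y\<^sup>2 < 1" using that by (auto simp: abs_square_less_1 abs_less_iff)
    then have s: "sqrt (2 * U y) = (1 - y\<^sup>2) / 2"
      by (intro real_sqrt_unique) (auto simp: U_def power_divide)
    show ?thesis unfolding s by simp
  qed
  have "(LBINT y=ereal 0..ereal \<psi>. 1 / sqrt (2 * U y)) = 2 * artanh \<psi> - 2 * artanh 0"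
  proof (rule interval_integral_FTC_finite)
    have "continuous_on {min 0 \<psi>..max 0 \<psi>} (\<lambda>y. 2 / (1 - y\<^sup>2))"
    proof (intro continuous_intros ballI)
      fix y assume "y \<in> {min 0 \<psi>..max 0 \<psi>}"
      then have "y\<^sup>2 < 1" using sub[of y] by (simp add: abs_square_less_1 abs_less_iff)
      then show "1 - y\<^sup>2 \<noteq> 0" by simp
    qed
    then show "continuous_on {min 0 \<psi>..max 0 \<psi>} (\<lambda>y. 1 / sqrt (2 * U y))"
      by (rule continuous_on_eq) (use sq sub in auto)
    fix x assume "min 0 \<psi> \<le> x" "x \<le> max 0 \<psi>"
    then have x: "x \<in> {-1<..<1}" by (rule sub)
    have "((\<lambda>x. 2 * artanh x) has_real_derivative 2 * (1 / (1 - x\<^sup>2))) (at x)"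
      using x by (intro DERIV_cmult artanh_real_has_field_derivative) auto
    then have "((\<lambda>x. 2 * artanh x) has_real_derivative 1 / sqrt (2 * U x)) (at x)"
      using sq[OF x] by simp
    then show "((\<lambda>x. 2 * artanh x) has_vector_derivative 1 / sqrt (2 * U x)) (at x within {min 0 \<psi>..max 0 \<psi>})"
      by (simp add: has_real_derivative_iff_has_vector_derivative has_vector_derivative_at_within)
  qed
  then show ?thesis by (simp add: kink_G_def zero_ereal_def)
qed

text \<open>Since \<open>1 / sqrt (2 U(y)) = 2 / (1 - y\<^sup>2)\<close>, the function \<open>G\<close> is \<open>2 artanh\<close>.\<close>

lemma kink_eq: "kink x = tanh (x / 2)"
  unfolding kink_def
proof (rule inv_into_f_eq)
  have G: "kink_G (tanh y) = 2 * y" for y :: real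
    using tanh_real_bounds[of y] by (simp add: kink_G_eq artanh_tanh_real)
  show "inj_on kink_G {-1<..<1}"
  proof (rule inj_onI)
    fix a b :: real assume ab: "a \<in> {-1<..<1}" "b \<in> {-1<..<1}" "kink_G a = kink_G b"
    then have "ln ((1 + a) / (1 - a)) = ln ((1 + b) / (1 - b))" by (simp add: kink_G_eq artanh_def)
    then have "(1 + a) / (1 - a) = (1 + b) / (1 - b)" using ab by (subst (asm) ln_inj_iff) auto
    then show "a = b" using ab by (simp add: field_simps)
  qed
  show "tanh (x / 2) \<in> {-1<..<1}" by (rule tanh_real_bounds)
  show "kink_G (tanh (x / 2)) = x" using G[of "x / 2"] by simp
qed

lemma kink_has_derivative: "(kink has_real_derivative (1 - (tanh (x / 2))\<^sup>2) / 2) (at x)"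
proof -
  have "((\<lambda>x. tanh (x / 2)) has_real_derivative (1 - (tanh (x / 2))\<^sup>2) / 2) (at x)"
    by (auto intro!: derivative_eq_intros)
  then show ?thesis unfolding kink_eq[abs_def] .
qed

text \<open>For the kink both terms of the energy density are equal, with sum \<open>(1 - tanh\<^sup>2(x/2))\<^sup>2 / 4\<close>, which
  has the primitive \<open>(tanh(x/2) - tanh\<^sup>3(x/2)/3) / 2\<close>.\<close>

lemma potential_energy_kink: "potential_energy kink = ennreal (2/3)"
proof -
  define q where "q x = (1 - (tanh (x / 2))\<^sup>2) / 2" for x :: real
  have cq: "continuous_on UNIV q" unfolding q_def by (intro continuous_intros) auto
  have kq: "is_primitive kink q"
    unfolding q_def by (rule is_primitive_C1[OF kink_has_derivative]) (use cq in \<open>simp add: q_def\<close>)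
  let ?f = "\<lambda>x::real. (1 - (tanh (x / 2))\<^sup>2)\<^sup>2 / 4"
  let ?F = "\<lambda>x::real. (tanh (x / 2) - (tanh (x / 2)) ^ 3 / 3) / 2"
  have half: "filterlim (\<lambda>x::real. x / 2) at_top at_top" "filterlim (\<lambda>x::real. x / 2) at_bot at_bot"
    unfolding filterlim_at_top filterlim_at_bot
    by (auto intro: eventually_mono[OF eventually_ge_at_top[of "2 * _"]]
        eventually_mono[OF eventually_le_at_bot[of "2 * _"]])
  have T: "((\<lambda>x::real. tanh (x / 2)) \<longlongrightarrow> 1) at_top" "((\<lambda>x::real. tanh (x / 2)) \<longlongrightarrow> -1) at_bot"
    by (rule filterlim_compose[OF tanh_real_at_top half(1)] filterlim_compose[OF tanh_real_at_bot half(2)])+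
  have top: "(?F \<longlongrightarrow> (1 - 1 ^ 3 / 3) / 2) at_top" by (intro tendsto_intros T) auto
  have bot: "(?F \<longlongrightarrow> (-1 - (-1) ^ 3 / 3) / 2) at_bot" by (intro tendsto_intros T) auto
  have D: "(?F has_real_derivative ?f x) (at x)" for x
    by (auto intro!: derivative_eq_intros simp: power2_eq_square power3_eq_cube field_simps)
  have "set_integrable lborel (einterval (-\<infinity>) \<infinity>) ?f"
    "(LBINT x=-\<infinity>..\<infinity>. ?f x) = (1 - 1 ^ 3 / 3) / 2 - (-1 - (-1) ^ 3 / 3) / 2"
    using D top bot
    by (intro interval_integral_FTC_nonneg[where F="?F"]; auto simp: ereal_tendsto_simps intro!: continuous_intros)+
  then have i: "integrable lborel ?f" and v: "(LINT x|lborel. ?f x) = 2/3"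
    by (auto simp: set_integrable_def interval_lebesgue_integral_def set_lebesgue_integral_def)
  have "is_primitive kink (weak_deriv kink)"
    by (rule weak_deriv_is_primitive[OF is_primitive_continuous[OF kq]])
       (use is_primitive_imp_weak_derivative[OF kq] in blast)
  then have "AE x in lborel. weak_deriv kink x = q x" by (rule is_primitive_unique[OF _ kq])
  then have "potential_energy kink = (\<integral>\<^sup>+x. ennreal ((1 - (tanh (x / 2))\<^sup>2)\<^sup>2 / 4) \<partial>lborel)"
    unfolding potential_energy_def
  proof (intro nn_integral_cong_AE, eventually_elim)
    case (elim x)
    have "1 / 2 * (q x)\<^sup>2 + U (kink x) = (1 - (tanh (x / 2))\<^sup>2)\<^sup>2 / 4"
      by (simp add: q_def U_def kink_eq power_divide)
    then show ?case by (simp only: elim)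
  qed
  also have "\<dots> = ennreal (LINT x|lborel. ?f x)"
    by (rule nn_integral_eq_integral[OF i]) simp
  also have "(LINT x|lborel. ?f x) = 2/3" by (rule v)
  finally show ?thesis .
qed

section \<open>A kink cluster is asymptotically static\<close>

context kg_solution
begin

text \<open>Between consecutive points the field passes from one vacuum to the other, which costs at
  least the energy of a kink.  If the total energy is no larger, nothing remains for the kinetic
  energy.\<close>

lemma transitions_le_pot_energy:
  fixes x :: "nat \<Rightarrow> real"
  assumes x: "\<And>k. k < n \<Longrightarrow> x k \<le> x (Suc k)"
  shows "(\<Sum>k<n. \<bar>W (u t (x (Suc k))) - W (u t (x k))\<bar>) \<le> 2 * pe t"
proof -
  define e where "e y = (p t y)\<^sup>2 / 2 + U (u t y)" for y
  have le: "locally_integrable e"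
    unfolding e_def by (rule locally_integrable_integrable[OF energy_density_integrable])
  have "x 0 \<le> x m \<and> (\<Sum>k<m. \<bar>W (u t (x (Suc k))) - W (u t (x k))\<bar>) \<le> 2 * (LINT y:{x 0..x m}|lborel. e y)"
    if "m \<le> n" for m
    using that
  proof (induction m)
    case 0
    then show ?case using LINT_combine[OF le order.refl order.refl, of "x 0"] by simp
  next
    case (Suc m)
    then have m: "x m \<le> x (Suc m)" and IH: "x 0 \<le> x m"
      "(\<Sum>k<m. \<bar>W (u t (x (Suc k))) - W (u t (x k))\<bar>) \<le> 2 * (LINT y:{x 0..x m}|lborel. e y)"
      using x by auto
    have "\<bar>W (u t (x (Suc m))) - W (u t (x m))\<bar> \<le> 2 * (LINT y:{x m..x (Suc m)}|lborel. e y)"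
      unfolding e_def by (rule Bogomolny_bound[OF u_primitive le[unfolded e_def] m])
    then show ?case using IH m LINT_combine[OF le IH(1) m] by simp
  qed
  from this[of n] have "(\<Sum>k<n. \<bar>W (u t (x (Suc k))) - W (u t (x k))\<bar>) \<le> 2 * (LINT y:{x 0..x n}|lborel. e y)"
    by simp
  also have "(LINT y:{x 0..x n}|lborel. e y) \<le> pe t"
    unfolding pe_eq pot_energy_def set_lebesgue_integral_def e_def using energy_density_integrable
    by (intro integral_mono integrable_mult_indicator) (auto simp: indicator_def U_nonneg)
  finally show ?thesis by simp
qed

lemma cluster_imp_static:
  fixes x :: "nat \<Rightarrow> real \<Rightarrow> real"
  assumes E: "en 0 \<le> real n * (2/3)"
    and ord: "\<And>t k. k < n \<Longrightarrow> x k t \<le> x (Suc k) t"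
    and lim: "\<And>k. k \<le> n \<Longrightarrow> ((\<lambda>t. u t (x k t)) \<longlongrightarrow> (-1) ^ k) at_top"
  shows "((\<lambda>t. (norm (V t))\<^sup>2) \<longlongrightarrow> 0) at_top"
proof -
  define S where "S t = (\<Sum>k<n. \<bar>W (u t (x (Suc k) t)) - W (u t (x k t))\<bar>)" for t
  have Wl: "((\<lambda>t. W (u t (x k t))) \<longlongrightarrow> W ((-1) ^ k)) at_top" if "k \<le> n" for k
    using continuous_on_tendsto_compose[OF continuous_W[of UNIV] lim[OF that]] by simp
  have jump: "\<bar>W ((-1) ^ Suc k) - W ((-1) ^ k)\<bar> = 4/3" for k
    by (cases "even k") (simp_all add: W_def)
  have "(S \<longlongrightarrow> (\<Sum>k<n. \<bar>W ((-1) ^ Suc k) - W ((-1) ^ k)\<bar>)) at_top"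
    unfolding S_def by (intro tendsto_sum tendsto_rabs tendsto_diff Wl) auto
  then have "(S \<longlongrightarrow> real n * (4/3)) at_top" by (simp only: jump) simp
  then have "((\<lambda>t. real n * (4/3) - S t) \<longlongrightarrow> real n * (4/3) - real n * (4/3)) at_top"
    by (intro tendsto_diff tendsto_const)
  then have l0: "((\<lambda>t. real n * (4/3) - S t) \<longlongrightarrow> 0) at_top" by simp
  have b: "(norm (V t))\<^sup>2 \<le> real n * (4/3) - S t" for t
  proof -
    have "S t \<le> 2 * pe t" unfolding S_def by (rule transitions_le_pot_energy) (rule ord)
    moreover have "en t = en 0" by (rule energy_conserved)
    ultimately show ?thesis using E unfolding en_def by simp
  qed
  show ?thesis
    by (rule tendsto_sandwich[OF _ _ tendsto_const l0]; rule always_eventually; intro allI b) simp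
qed

lemma L2_norm_sq_v: "L2_norm_sq (snd (\<Phi> t)) = ennreal ((norm (V t))\<^sup>2)"
  using L2_norm_sq_eq[OF v_sq] by (simp add: V_def v_def)

lemma static_iff: "((\<lambda>t. L2_norm_sq (snd (\<Phi> t))) \<longlongrightarrow> 0) at_top \<longleftrightarrow> ((\<lambda>t. (norm (V t))\<^sup>2) \<longlongrightarrow> 0) at_top"
  unfolding L2_norm_sq_v using tendsto_ennreal_iff[of "\<lambda>t. (norm (V t))\<^sup>2" at_top 0] by simp

lemma energy_le_iff: "energy (\<Phi> 0) \<le> of_nat n * potential_energy kink \<longleftrightarrow> en 0 \<le> real n * (2/3)"
proof -
  have "of_nat n * potential_energy kink = ennreal (real n * (2/3))"
    unfolding potential_energy_kink ennreal_of_nat_eq_real_of_nat by (rule ennreal_mult[symmetric]) auto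
  then show ?thesis by (simp only: energy_eq) (simp add: ennreal_le_iff)
qed

end

lemma solutionE:
  assumes "solution \<Phi>"
  obtains l r where "kg_solution \<Phi> l r"
  using assms unfolding solution_def kg_solution_def by blast

lemma kink_n_cluster_imp_static:
  assumes "kink_n_cluster n \<Phi>"
  shows "((\<lambda>t. L2_norm_sq (snd (\<Phi> t))) \<longlongrightarrow> 0) at_top"
proof -
  obtain l r where "kg_solution \<Phi> l r"
    using assms solutionE unfolding kink_n_cluster_def by blast
  then interpret kg_solution \<Phi> l r .
  obtain x :: "nat \<Rightarrow> real \<Rightarrow> real" where x: "\<forall>t. \<forall>k<n. x k t \<le> x (Suc k) t"
    "\<forall>k\<le>n. ((\<lambda>t. fst (\<Phi> t) (x k t)) \<longlongrightarrow> (-1) ^ k) at_top"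
    using assms unfolding kink_n_cluster_def by blast
  have "en 0 \<le> real n * (2/3)" using assms energy_le_iff unfolding kink_n_cluster_def by blast
  then have "((\<lambda>t. (norm (V t))\<^sup>2) \<longlongrightarrow> 0) at_top"
    by (rule cluster_imp_static[where x=x]) (use x in \<open>auto simp: u_def\<close>)
  then show ?thesis by (simp add: static_iff)
qed

section \<open>Almost static profiles\<close>

definition alternates :: "(real \<Rightarrow> real) \<Rightarrow> real \<Rightarrow> real \<Rightarrow> nat \<Rightarrow> (nat \<Rightarrow> real) \<Rightarrow> bool" where
  "alternates f \<sigma> \<delta> n x \<longleftrightarrow>
     (\<forall>k<n. x k \<le> x (Suc k)) \<and> (\<forall>k\<le>n. \<bar>f (x k) - \<sigma> * (-1) ^ k\<bar> \<le> \<delta>)"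

lemma U_even: "U (- y) = U y" by (simp add: U_def)

lemma U_antimono:
  assumes "\<bar>y\<bar> \<le> z" "z \<le> 1"
  shows "U z \<le> U y"
proof -
  have "y\<^sup>2 \<le> z\<^sup>2" using power_mono[OF assms(1), of 2] by simp
  moreover have "z\<^sup>2 \<le> 1" using assms power_mono[of z 1 2] by simp
  ultimately have "(1 - z\<^sup>2)\<^sup>2 \<le> (1 - y\<^sup>2)\<^sup>2" by (intro power_mono) auto
  then show ?thesis by (simp add: U_def)
qed

text \<open>On the side \<open>y \<ge> 1/2\<close> the potential behaves like a convex function with minimum at \<open>1\<close>.\<close>

lemma U_convexity:
  assumes "1/2 \<le> y"
  shows "U y \<le> (y - 1) * dU y" "(y - 1)\<^sup>2 \<le> 4 * U y"
proof -
  have "(y - 1) * dU y - U y = (y - 1)\<^sup>2 * ((1 + y) * (3 * y - 1)) / 8"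
    by (simp add: dU_def U_def power2_eq_square power3_eq_cube field_simps)
  moreover have "0 \<le> (y - 1)\<^sup>2 * ((1 + y) * (3 * y - 1)) / 8"
    using assms by (intro divide_nonneg_nonneg mult_nonneg_nonneg) auto
  ultimately show "U y \<le> (y - 1) * dU y" by linarith
  have "4 * U y - (y - 1)\<^sup>2 = (y - 1)\<^sup>2 * ((1 + y)\<^sup>2 - 2) / 2"
    by (simp add: U_def power2_eq_square field_simps)
  moreover have "(3/2)\<^sup>2 \<le> (1 + y)\<^sup>2" using assms by (intro power_mono) auto
  then have "0 \<le> (y - 1)\<^sup>2 * ((1 + y)\<^sup>2 - 2) / 2"
    by (intro divide_nonneg_nonneg mult_nonneg_nonneg) (auto simp: power_divide)
  ultimately show "(y - 1)\<^sup>2 \<le> 4 * U y" by linarith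
qed

text \<open>For \<open>\<eta> = 0\<close> these are the static solutions of finite energy.\<close>

locale almost_static =
  fixes \<phi> \<phi>' \<phi>'' :: "real \<Rightarrow> real" and \<eta> M :: real
  assumes \<phi>: "is_primitive \<phi> \<phi>'" and \<phi>': "is_primitive \<phi>' \<phi>''"
    and sq: "square_integrable \<phi>'" and iU: "integrable lborel (\<lambda>x. U (\<phi> x))"
    and sqf: "square_integrable (\<lambda>x. \<phi>'' x - dU (\<phi> x))"
    and \<eta>: "norm (abs_l2 (\<lambda>x. \<phi>'' x - dU (\<phi> x))) \<le> \<eta>"
    and M: "pot_energy \<phi> \<phi>' \<le> M"
begin

definition f :: "real \<Rightarrow> real" where "f x = \<phi>'' x - dU (\<phi> x)"
definition e :: "real \<Rightarrow> real" where "e x = (\<phi>' x)\<^sup>2 / 2 + U (\<phi> x)"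
definition \<theta> :: real where "\<theta> = norm (abs_l2 \<phi>') * \<eta>"

lemma sq_f: "square_integrable f" using sqf by (simp add: f_def[abs_def])
lemma norm_f: "norm (abs_l2 f) \<le> \<eta>" using \<eta> by (simp add: f_def[abs_def])
lemma \<eta>_nonneg: "0 \<le> \<eta>" using norm_f norm_ge_zero order.trans by blast
lemma \<theta>_nonneg: "0 \<le> \<theta>" by (simp add: \<theta>_def \<eta>_nonneg)
lemma e_nonneg: "0 \<le> e x" by (simp add: e_def U_nonneg)

lemma continuous_\<phi>: "continuous_on A \<phi>"
  using is_primitive_continuous[OF \<phi>] continuous_on_subset by blast
lemma continuous_\<phi>': "continuous_on A \<phi>'"
  using is_primitive_continuous[OF \<phi>'] continuous_on_subset by blast

lemma \<phi>_has_derivative: "(\<phi> has_real_derivative \<phi>' x) (at x)"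
  by (rule is_primitive_has_derivative[OF \<phi> continuous_\<phi>'])

lemma integrable_e: "integrable lborel e"
  unfolding e_def using square_integrable_square[OF sq] iU by simp

lemma li_e: "locally_integrable e" by (rule locally_integrable_integrable[OF integrable_e])

lemma LINT_le_M: "(\<And>x. 0 \<le> g x) \<Longrightarrow> (\<And>x. g x \<le> e x) \<Longrightarrow> integrable lborel g \<Longrightarrow> (LINT x|lborel. g x) \<le> M"
  using integral_mono[of lborel g e] integrable_e M by (simp add: pot_energy_def e_def[abs_def])

lemma M_nonneg: "0 \<le> M"
  using LINT_le_M[of "\<lambda>x. 0"] e_nonneg by simp

text \<open>The quantity \<open>\<phi>'\<^sup>2/2 - U(\<phi>)\<close> is constant for static solutions; its derivative is \<open>\<phi>' f\<close>.\<close>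

lemma almost_equipartition: "\<bar>(\<phi>' x)\<^sup>2 / 2 - U (\<phi> x)\<bar> \<le> \<theta>"
proof -
  have "is_primitive (\<lambda>x. 1/2 * (\<phi>' x * \<phi>' x) - U (\<phi> x))
     (\<lambda>x. 1/2 * (\<phi>' x * \<phi>'' x + \<phi>'' x * \<phi>' x) - dU (\<phi> x) * \<phi>' x)"
    by (rule is_primitive_diff[OF is_primitive_cmult[OF is_primitive_mult[OF \<phi>' \<phi>']]
        is_primitive_compose[OF \<phi> U_has_derivative continuous_dU]])
  moreover have "1/2 * (\<phi>' x * \<phi>'' x + \<phi>'' x * \<phi>' x) - dU (\<phi> x) * \<phi>' x = \<phi>' x * f x" for x
    by (simp add: f_def algebra_simps)
  ultimately have pr: "is_primitive (\<lambda>x. (\<phi>' x)\<^sup>2 / 2 - U (\<phi> x)) (\<lambda>x. \<phi>' x * f x)"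
    by (simp add: power2_eq_square)
  have "\<bar>(\<phi>' x)\<^sup>2 / 2 - U (\<phi> x)\<bar> \<le> (LINT y|lborel. \<bar>\<phi>' y * f y\<bar>)"
    using square_integrable_square[OF sq] iU
    by (intro is_primitive_abs_le[OF pr square_integrable_mult[OF sq sq_f]]) simp
  also have "\<dots> \<le> norm (abs_l2 \<phi>') * norm (abs_l2 f)" by (rule LINT_abs_mult_le_norm[OF sq sq_f])
  also have "\<dots> \<le> \<theta>" unfolding \<theta>_def by (intro mult_left_mono norm_f) simp
  finally show ?thesis .
qed

text \<open>Let \<open>w = \<phi> - \<sigma>\<close>. Testing the equation with \<open>w\<close> gives
  \<open>\<integral> \<phi>'\<^sup>2 + w U'(\<phi>) = [w \<phi>'] - \<integral> w f\<close>, whose left side dominates the energy by convexity of \<open>U\<close> near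
  the vacuum. At the ends \<open>|w| \<le> \<delta>\<close> and, by almost-equipartition, \<open>|\<phi>'| \<le> 1\<close>.\<close>

lemma near_vacuum:
  assumes ab: "a \<le> b" and \<sigma>: "\<sigma> \<in> {-1, 1}" and \<delta>: "0 \<le> \<delta>" "\<delta> \<le> 1/2" and \<theta>: "\<theta> \<le> 1/4"
    and near: "\<And>x. x \<in> {a..b} \<Longrightarrow> 1 - \<delta> \<le> \<sigma> * \<phi> x"
    and ends: "\<bar>\<phi> a - \<sigma>\<bar> \<le> \<delta>" "\<bar>\<phi> b - \<sigma>\<bar> \<le> \<delta>"
  shows "(LINT x:{a..b}|lborel. e x) \<le> 2 * \<delta> + 2 * sqrt M * \<eta>"
proof -
  have ss: "\<sigma> * \<sigma> = 1" using \<sigma> by auto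
  define w where "w x = \<phi> x - \<sigma>" for x
  have wp: "is_primitive w \<phi>'" unfolding w_def using is_primitive_add_const[OF \<phi>, of "-\<sigma>"] by simp
  note pr = is_primitive_mult[OF wp \<phi>']
  have bd: "\<bar>w z * \<phi>' z\<bar> \<le> \<delta>" if z: "\<bar>\<phi> z - \<sigma>\<bar> \<le> \<delta>" for z
  proof -
    have "\<bar>\<phi> z - \<sigma>\<bar> = \<bar>\<sigma> * \<phi> z - 1\<bar>" using \<sigma> by auto
    then have "\<bar>\<sigma> * \<phi> z - 1\<bar> \<le> 1/2" using z \<delta> by linarith
    then have "\<bar>\<sigma> * \<phi> z - 1\<bar> \<le> 1/2" "\<bar>\<sigma> * \<phi> z + 1\<bar> \<le> 5/2" by linarith+
    then have "\<bar>\<sigma> * \<phi> z - 1\<bar>\<^sup>2 \<le> (1/2)\<^sup>2" "\<bar>\<sigma> * \<phi> z + 1\<bar>\<^sup>2 \<le> (5/2)\<^sup>2" by (intro power_mono; simp)+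
    then have "(\<sigma> * \<phi> z - 1)\<^sup>2 * (\<sigma> * \<phi> z + 1)\<^sup>2 \<le> (1/2)\<^sup>2 * (5/2)\<^sup>2" by (intro mult_mono) auto
    moreover have "(\<sigma> * \<phi> z - 1)\<^sup>2 * (\<sigma> * \<phi> z + 1)\<^sup>2 = 8 * U (\<phi> z)"
      using \<sigma> by (auto simp: U_def power2_eq_square algebra_simps)
    ultimately have "U (\<phi> z) \<le> 1/4" by (simp add: power2_eq_square)
    then have "(\<phi>' z)\<^sup>2 \<le> 1" using almost_equipartition[of z] \<theta> by linarith
    then have "\<bar>\<phi>' z\<bar> \<le> 1" by (simp add: abs_square_le_1)
    then have "\<bar>w z\<bar> * \<bar>\<phi>' z\<bar> \<le> \<delta> * 1" using z \<delta> by (intro mult_mono) (auto simp: w_def)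
    then show ?thesis by (simp add: abs_mult)
  qed
  define w1 where "w1 x = indicator {a..b} x * w x" for x
  have w1U: "(w1 x)\<^sup>2 \<le> 4 * U (\<phi> x)" for x
  proof (cases "x \<in> {a..b}")
    case True
    then have "1/2 \<le> \<sigma> * \<phi> x" using near[OF True] \<delta> by linarith
    from U_convexity(2)[OF this] have "(\<sigma> * \<phi> x - 1)\<^sup>2 \<le> 4 * U (\<sigma> * \<phi> x)" .
    then show ?thesis using True \<sigma> by (auto simp: w1_def w_def U_even power2_eq_square algebra_simps)
  qed (simp add: w1_def U_nonneg)
  have sqw: "square_integrable w1"
  proof (rule square_integrable_bound[OF _ _ w1U])
    show "integrable lborel (\<lambda>x. 4 * U (\<phi> x))" by (rule integrable_mult_right[OF iU])
    have [measurable]: "w \<in> borel_measurable borel" by (rule continuous_measurable[OF is_primitive_continuous[OF wp]])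
    show "w1 \<in> borel_measurable borel" unfolding w1_def by measurable
  qed
  have "(norm (abs_l2 w1))\<^sup>2 \<le> 4 * M"
  proof -
    have "(norm (abs_l2 w1))\<^sup>2 \<le> (LINT x|lborel. 4 * U (\<phi> x))"
      unfolding norm_abs_l2[OF sqw]
      by (intro integral_mono square_integrable_square[OF sqw] integrable_mult_right[OF iU] w1U)
    also have "\<dots> = 4 * (LINT x|lborel. U (\<phi> x))" by simp
    also have "(LINT x|lborel. U (\<phi> x)) \<le> M" by (rule LINT_le_M) (auto simp: U_nonneg e_def iU)
    finally show ?thesis by simp
  qed
  then have "norm (abs_l2 w1) \<le> sqrt (4 * M)" by (rule real_le_rsqrt)
  then have nw: "norm (abs_l2 w1) \<le> 2 * sqrt M" by (simp add: real_sqrt_mult)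
  have iwf: "integrable lborel (\<lambda>x. w1 x * f x)" by (rule square_integrable_mult[OF sqw sq_f])
  have lwf: "locally_integrable (\<lambda>x. w1 x * f x)" by (rule locally_integrable_integrable[OF iwf])
  have wf: "- (LINT x:{a..b}|lborel. w1 x * f x) \<le> 2 * sqrt M * \<eta>"
  proof -
    have "- (LINT x:{a..b}|lborel. w1 x * f x) \<le> (LINT x:{a..b}|lborel. \<bar>w1 x * f x\<bar>)"
      using LINT_abs_le[OF lwf ab] by linarith
    also have "\<dots> \<le> (LINT x|lborel. \<bar>w1 x * f x\<bar>)"
      unfolding set_lebesgue_integral_def using iwf
      by (intro integral_mono integrable_mult_indicator) (auto simp: indicator_def)
    also have "\<dots> \<le> norm (abs_l2 w1) * norm (abs_l2 f)" by (rule LINT_abs_mult_le_norm[OF sqw sq_f])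
    also have "\<dots> \<le> 2 * sqrt M * \<eta>" using nw norm_f M_nonneg by (intro mult_mono) auto
    finally show ?thesis .
  qed
  have lp: "locally_integrable (\<lambda>x. w x * \<phi>'' x + \<phi>' x * \<phi>' x)" by (rule is_primitive_locally_integrable[OF pr])
  have "(LINT x:{a..b}|lborel. e x) \<le> (LINT x:{a..b}|lborel. (w x * \<phi>'' x + \<phi>' x * \<phi>' x) - w1 x * f x)"
  proof (rule set_integral_mono)
    fix x assume x: "x \<in> {a..b}"
    then have "1/2 \<le> \<sigma> * \<phi> x" using near[OF x] \<delta> by linarith
    from U_convexity(1)[OF this] have "U (\<phi> x) \<le> w x * dU (\<phi> x)"
      using \<sigma> by (auto simp: w_def U_even dU_def algebra_simps)
    moreover have "(w x * \<phi>'' x + \<phi>' x * \<phi>' x) - w1 x * f x = (\<phi>' x)\<^sup>2 + w x * dU (\<phi> x)"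
      using x by (simp add: w1_def f_def power2_eq_square algebra_simps)
    ultimately show "e x \<le> (w x * \<phi>'' x + \<phi>' x * \<phi>' x) - w1 x * f x"
      unfolding e_def using zero_le_power2[of "\<phi>' x"] by linarith
  qed (intro locally_integrableD li_e locally_integrable_diff lp lwf)+
  also have "\<dots> = (LINT x:{a..b}|lborel. w x * \<phi>'' x + \<phi>' x * \<phi>' x) - (LINT x:{a..b}|lborel. w1 x * f x)"
    by (intro set_integral_diff locally_integrableD lp lwf)
  also have "(LINT x:{a..b}|lborel. w x * \<phi>'' x + \<phi>' x * \<phi>' x) = w b * \<phi>' b - w a * \<phi>' a"
    by (rule is_primitive_integral[OF pr ab])
  finally show ?thesis using bd[OF ends(1)] bd[OF ends(2)] wf by linarith
qed

text \<open>By almost-equipartition \<open>\<phi>'\<close> has no zero in \<open>[c, d]\<close>, hence a constant sign, and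
  \<open>\<phi>'\<^sup>2/2 + U(\<phi>)\<close> exceeds \<open>|\<phi>'| sqrt (2 U(\<phi>))\<close> by at most \<open>\<theta>\<close>. The integral of the latter is
  \<open>|W(\<phi>(d)) - W(\<phi>(c))|/2\<close>. The length of \<open>[c, d]\<close> is at most \<open>M / U(1 - \<delta>)\<close>, as the potential
  is at least \<open>U(1 - \<delta>)\<close> there.\<close>

lemma crossing:
  assumes cd: "c \<le> d" and \<sigma>: "\<sigma> \<in> {-1, 1}" and \<delta>: "0 < \<delta>" "\<delta> < 1" and \<theta>: "\<theta> < U (1 - \<delta>)"
    and inside: "\<And>x. x \<in> {c..d} \<Longrightarrow> \<bar>\<phi> x\<bar> \<le> 1 - \<delta>"
    and ends: "\<sigma> * \<phi> c = 1 - \<delta>" "\<sigma> * \<phi> d = - (1 - \<delta>)"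
  shows "(LINT x:{c..d}|lborel. e x) \<le> 2/3 + \<theta> * M / U (1 - \<delta>)"
proof -
  define m where "m = U (1 - \<delta>)"
  have m: "0 < m" "\<theta> < m" using \<theta> \<theta>_nonneg by (auto simp: m_def)
  have Um: "m \<le> U (\<phi> x)" if "x \<in> {c..d}" for x
    unfolding m_def using inside[OF that] \<delta> by (intro U_antimono) auto
  have nz: "\<phi>' x \<noteq> 0" if "x \<in> {c..d}" for x
    using almost_equipartition[of x] Um[OF that] m by auto
  have neg: "\<sigma> * \<phi>' x < 0" if x: "x \<in> {c..d}" for x
  proof (rule ccontr)
    assume "\<not> \<sigma> * \<phi>' x < 0"
    then have pos: "0 < \<sigma> * \<phi>' x" using nz[OF x] \<sigma> by auto
    have conn: "connected ((\<lambda>x. \<sigma> * \<phi>' x) ` {c..d})"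
      by (intro connected_continuous_image continuous_intros continuous_\<phi>') simp
    have "0 \<le> \<sigma> * \<phi>' y" if y: "y \<in> {c..d}" for y
    proof (rule ccontr)
      assume "\<not> 0 \<le> \<sigma> * \<phi>' y"
      then have "0 \<in> {\<sigma> * \<phi>' y..\<sigma> * \<phi>' x}" using pos by auto
      then have "0 \<in> (\<lambda>x. \<sigma> * \<phi>' x) ` {c..d}"
        using connected_contains_Icc[OF conn imageI[OF y] imageI[OF x]] by blast
      then show False using nz \<sigma> by auto
    qed
    then have "0 \<le> (LINT x:{c..d}|lborel. \<sigma> * \<phi>' x)"
      unfolding set_lebesgue_integral_def by (intro integral_nonneg_AE) (auto simp: indicator_def)
    also have "\<dots> = \<sigma> * \<phi> d - \<sigma> * \<phi> c"
      by (rule is_primitive_integral[OF is_primitive_cmult[OF \<phi>] cd])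
    finally show False using ends \<delta> by simp
  qed
  have len: "(d - c) * m \<le> M"
  proof -
    have "(LINT x|lborel. indicator {c..d} x * m) \<le> M"
    proof (rule LINT_le_M)
      show "integrable lborel (\<lambda>x. indicator {c..d} x * m)"
        using cd by (intro integrable_mult_left integrable_real_indicator) auto
    qed (use m Um in \<open>auto simp: indicator_def e_def U_nonneg intro: add_increasing\<close>)
    then show ?thesis using cd by simp
  qed
  note prW = is_primitive_cmult[OF is_primitive_W[OF \<phi>], of "\<sigma>/2"]
  have lW: "locally_integrable (\<lambda>x. \<sigma>/2 * (((\<phi> x)\<^sup>2 - 1) * \<phi>' x))" by (rule is_primitive_locally_integrable[OF prW])
  have lc: "locally_integrable (\<lambda>x. \<theta>)" by (rule locally_integrable_continuous) simp
  have "(LINT x:{c..d}|lborel. e x) \<le> (LINT x:{c..d}|lborel. \<sigma>/2 * (((\<phi> x)\<^sup>2 - 1) * \<phi>' x) + \<theta>)"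
  proof (rule set_integral_mono)
    fix x assume x: "x \<in> {c..d}"
    define g where "g = (1 - (\<phi> x)\<^sup>2) / 2"
    define s where "s = - (\<sigma> * \<phi>' x)"
    have "\<bar>\<phi> x\<bar> \<le> 1" using inside[OF x] \<delta> by linarith
    then have g: "0 \<le> g" unfolding g_def by (simp add: abs_square_le_1)
    have s: "0 < s" using neg[OF x] by (simp add: s_def)
    have s2: "s\<^sup>2 = (\<phi>' x)\<^sup>2" using \<sigma> by (auto simp: s_def)
    have g2: "g\<^sup>2 = 2 * U (\<phi> x)" by (simp add: g_def U_def power_divide)
    have "(s - g)\<^sup>2 \<le> \<bar>s\<^sup>2 - g\<^sup>2\<bar>"
    proof -
      have "\<bar>s - g\<bar> * \<bar>s - g\<bar> \<le> \<bar>s - g\<bar> * \<bar>s + g\<bar>" using s g by (intro mult_left_mono) auto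
      also have "\<dots> = \<bar>s\<^sup>2 - g\<^sup>2\<bar>" unfolding abs_mult[symmetric] by (simp add: power2_eq_square algebra_simps)
      finally show ?thesis by (simp add: power2_eq_square)
    qed
    also have "\<dots> \<le> 2 * \<theta>" unfolding s2 g2 using almost_equipartition[of x] by linarith
    finally have "s\<^sup>2 / 2 + g\<^sup>2 / 2 \<le> s * g + \<theta>" by (simp add: power2_eq_square algebra_simps)
    moreover have "s * g = \<sigma>/2 * (((\<phi> x)\<^sup>2 - 1) * \<phi>' x)" by (simp add: s_def g_def field_simps)
    ultimately show "e x \<le> \<sigma>/2 * (((\<phi> x)\<^sup>2 - 1) * \<phi>' x) + \<theta>" unfolding e_def s2 g2 by simp
  qed (intro locally_integrableD li_e locally_integrable_add lW lc)+
  also have "\<dots> = (LINT x:{c..d}|lborel. \<sigma>/2 * (((\<phi> x)\<^sup>2 - 1) * \<phi>' x)) + (LINT x:{c..d}|lborel. \<theta>)"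
    by (intro set_integral_add locally_integrableD lW lc)
  also have "(LINT x:{c..d}|lborel. \<sigma>/2 * (((\<phi> x)\<^sup>2 - 1) * \<phi>' x)) = \<sigma>/2 * W (\<phi> d) - \<sigma>/2 * W (\<phi> c)"
    by (rule is_primitive_integral[OF prW cd])
  also have "(LINT x:{c..d}|lborel. \<theta>) = (d - c) * \<theta>"
    using cd by (simp add: set_lebesgue_integral_def)
  also have "\<sigma>/2 * W (\<phi> d) - \<sigma>/2 * W (\<phi> c) \<le> 2/3"
  proof -
    have odd: "\<sigma> * W y = W (\<sigma> * y)" for y using \<sigma> by (auto simp: W_def)
    have "\<sigma>/2 * W (\<phi> d) - \<sigma>/2 * W (\<phi> c) = (W (\<sigma> * \<phi> d) - W (\<sigma> * \<phi> c)) / 2"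
      by (simp add: odd[symmetric] algebra_simps)
    also have "\<dots> = (1 - \<delta>) - (1 - \<delta>) ^ 3 / 3"
      unfolding ends by (simp add: W_def power3_eq_cube field_simps)
    also have "\<dots> \<le> 2/3"
    proof -
      have "0 \<le> \<delta>\<^sup>2 * (3 - \<delta>)" using \<delta> by simp
      then show ?thesis by (simp add: power2_eq_square power3_eq_cube field_simps)
    qed
    finally show ?thesis .
  qed
  also have "(d - c) * \<theta> \<le> \<theta> * M / m"
  proof -
    have "(d - c) \<le> M / m" using len m by (simp add: pos_le_divide_eq)
    then have "(d - c) * \<theta> \<le> M / m * \<theta>" by (rule mult_right_mono[OF _ \<theta>_nonneg])
    then show ?thesis by (simp add: mult.commute)
  qed
  finally show ?thesis by (simp add: m_def)
qed

text \<open>An interior minimum of \<open>\<sigma> \<phi>\<close> between the vacua would be a critical point, which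
  almost-equipartition excludes.\<close>

lemma no_excursion:
  assumes \<sigma>: "\<sigma> \<in> {-1, 1}" and \<delta>: "0 < \<delta>" "\<delta> < 1" and \<theta>: "\<theta> < U (1 - \<delta>)"
    and ends: "1 - \<delta> \<le> \<sigma> * \<phi> a" "1 - \<delta> \<le> \<sigma> * \<phi> b"
    and above: "\<And>x. x \<in> {a..b} \<Longrightarrow> - (1 - \<delta>) < \<sigma> * \<phi> x"
    and x: "x \<in> {a..b}"
  shows "1 - \<delta> \<le> \<sigma> * \<phi> x"
proof (rule ccontr)
  assume neg: "\<not> 1 - \<delta> \<le> \<sigma> * \<phi> x"
  obtain z where z: "z \<in> {a..b}" "\<And>y. y \<in> {a..b} \<Longrightarrow> \<sigma> * \<phi> z \<le> \<sigma> * \<phi> y"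
  proof -
    have "\<exists>z\<in>{a..b}. \<forall>y\<in>{a..b}. \<sigma> * \<phi> z \<le> \<sigma> * \<phi> y"
      using x by (intro continuous_attains_inf continuous_intros continuous_\<phi>) auto
    then show ?thesis using that by blast
  qed
  have lt: "\<sigma> * \<phi> z < 1 - \<delta>" using z(2)[OF x] neg by linarith
  then have "z \<noteq> a" "z \<noteq> b" using ends by auto
  then have zi: "a < z" "z < b" using z(1) by auto
  have "\<sigma> * \<phi>' z = 0"
  proof (rule DERIV_local_min)
    show "((\<lambda>x. \<sigma> * \<phi> x) has_real_derivative \<sigma> * \<phi>' z) (at z)"
      by (intro DERIV_cmult \<phi>_has_derivative)
    show "0 < min (z - a) (b - z)" using zi by simp
    show "\<forall>y. \<bar>z - y\<bar> < min (z - a) (b - z) \<longrightarrow> \<sigma> * \<phi> z \<le> \<sigma> * \<phi> y"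
      using z(2) by (auto simp: abs_less_iff)
  qed
  then have "\<phi>' z = 0" using \<sigma> by auto
  moreover have "\<bar>\<phi> z\<bar> \<le> 1 - \<delta>" using lt above[OF z(1)] \<sigma> by auto
  then have "U (1 - \<delta>) \<le> U (\<phi> z)" using \<delta> by (intro U_antimono) auto
  ultimately show False using almost_equipartition[of z] \<theta> by simp
qed

text \<open>The induction step follows the profile from \<open>a\<close>, near \<open>\<sigma>\<close>, to the first point \<open>d\<close> near \<open>-\<sigma>\<close>. With
  \<open>c\<close> the last point before \<open>d\<close> that is near \<open>\<sigma>\<close>, the profile stays near the vacuum on \<open>[a, c]\<close>,
  crosses on \<open>[c, d]\<close>, and the induction hypothesis applies from \<open>d\<close> on with \<open>-\<sigma>\<close>.\<close>

lemma energy_or_alternates: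
  assumes \<delta>: "0 < \<delta>" "\<delta> \<le> 1/2" and \<theta>: "\<theta> \<le> 1/4" "\<theta> < U (1 - \<delta>)"
    and B: "\<tau> \<in> {-1, 1}" "\<bar>\<phi> B - \<tau>\<bar> \<le> \<delta>"
  defines "\<epsilon> \<equiv> 2 * \<delta> + 2 * sqrt M * \<eta> + \<theta> * M / U (1 - \<delta>)"
  shows "\<sigma> \<in> {-1, 1} \<Longrightarrow> a \<le> B \<Longrightarrow> \<bar>\<phi> a - \<sigma>\<bar> \<le> \<delta> \<Longrightarrow>
     (\<exists>x. alternates \<phi> \<sigma> \<delta> n x \<and> a \<le> x 0) \<or>
     (LINT x:{a..B}|lborel. e x) \<le> (real n - 1) * (2/3) + real n * \<epsilon>"
proof (induction n arbitrary: \<sigma> a)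
  case 0
  then have "alternates \<phi> \<sigma> \<delta> 0 (\<lambda>_. a)" by (simp add: alternates_def)
  then show ?case by (intro disjI1 exI[of _ "\<lambda>_. a"]) simp
next
  case (Suc n)
  note \<sigma> = \<open>\<sigma> \<in> {-1, 1}\<close>
  have \<delta>1: "\<delta> < 1" using \<delta> by simp
  have U1: "0 < U (1 - \<delta>)" using \<theta> \<theta>_nonneg by linarith
  have \<epsilon>2: "0 \<le> \<theta> * M / U (1 - \<delta>)" using \<theta>_nonneg M_nonneg U1 by simp
  have \<epsilon>0: "0 \<le> \<epsilon>" using \<delta> \<epsilon>2 M_nonneg \<eta>_nonneg by (simp add: \<epsilon>_def)
  have abs_eq: "\<bar>\<phi> x - \<sigma>\<bar> = \<bar>\<sigma> * \<phi> x - 1\<bar>" for x using \<sigma> by auto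
  have cs: "continuous_on A (\<lambda>x. \<sigma> * \<phi> x)" for A by (intro continuous_intros continuous_\<phi>)
  have sa: "1 - \<delta> \<le> \<sigma> * \<phi> a" using Suc.prems abs_eq[of a] by linarith
  define S where "S = {x \<in> {a..B}. \<sigma> * \<phi> x \<le> - (1 - \<delta>)}"
  show ?case
  proof (cases "S = {}")
    case True
    have above: "- (1 - \<delta>) < \<sigma> * \<phi> x" if "x \<in> {a..B}" for x using True that by (force simp: S_def)
    have "\<tau> = \<sigma>"
    proof (rule ccontr)
      assume "\<tau> \<noteq> \<sigma>"
      then have "\<tau> = - \<sigma>" using B(1) \<sigma> by auto
      then have "\<bar>\<sigma> * \<phi> B + 1\<bar> \<le> \<delta>" using B(2) \<sigma> by auto
      then show False using above[of B] Suc.prems by auto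
    qed
    then have Bs: "\<bar>\<phi> B - \<sigma>\<bar> \<le> \<delta>" using B by simp
    then have sB: "1 - \<delta> \<le> \<sigma> * \<phi> B" using abs_eq[of B] by linarith
    have "(LINT x:{a..B}|lborel. e x) \<le> 2 * \<delta> + 2 * sqrt M * \<eta>"
      by (rule near_vacuum[OF \<open>a \<le> B\<close> \<sigma> less_imp_le[OF \<delta>(1)] \<delta>(2) \<theta>(1)
            no_excursion[OF \<sigma> \<delta>(1) \<delta>1 \<theta>(2) sa sB above] Suc.prems(3) Bs])
    also have "\<dots> \<le> \<epsilon>" using \<epsilon>2 by (simp add: \<epsilon>_def)
    also have "\<dots> \<le> (real (Suc n) - 1) * (2/3) + real (Suc n) * \<epsilon>"
      using \<epsilon>0 by (simp add: algebra_simps)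
    finally show ?thesis by blast
  next
    case False
    have "compact S"
    proof -
      have "closed {x \<in> {a..B}. \<sigma> * \<phi> x \<le> - (1 - \<delta>)}"
        by (rule continuous_on_closed_Collect_le[OF cs continuous_on_const closed_atLeastAtMost])
      then show ?thesis unfolding S_def compact_eq_bounded_closed
        by (auto intro: bounded_subset[OF bounded_closed_interval[of a B]])
    qed
    then obtain d where d: "d \<in> S" "\<And>x. x \<in> S \<Longrightarrow> d \<le> x" using compact_attains_inf[OF _ False] by blast
    have dB: "a \<le> d" "d \<le> B" "\<sigma> * \<phi> d \<le> - (1 - \<delta>)" using d(1) by (auto simp: S_def)
    have sd: "\<sigma> * \<phi> d = - (1 - \<delta>)"
    proof -
      have "- (1 - \<delta>) \<le> \<sigma> * \<phi> a" using sa \<delta> by linarith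
      then obtain z where z: "a \<le> z" "z \<le> d" "\<sigma> * \<phi> z = - (1 - \<delta>)"
        using IVT2'[of "\<lambda>x. \<sigma> * \<phi> x" d "- (1 - \<delta>)" a, OF dB(3) _ dB(1) cs] by blast
      then have "z \<in> S" using dB by (auto simp: S_def)
      then have "z = d" using d(2) z(2) by fastforce
      then show ?thesis using z(3) by simp
    qed
    define T where "T = {x \<in> {a..d}. 1 - \<delta> \<le> \<sigma> * \<phi> x}"
    have "compact T"
    proof -
      have "closed {x \<in> {a..d}. 1 - \<delta> \<le> \<sigma> * \<phi> x}"
        by (rule continuous_on_closed_Collect_le[OF continuous_on_const cs closed_atLeastAtMost])
      then show ?thesis unfolding T_def compact_eq_bounded_closed
        by (auto intro: bounded_subset[OF bounded_closed_interval[of a d]])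
    qed
    moreover have "a \<in> T" using sa dB by (simp add: T_def)
    ultimately obtain c where c: "c \<in> T" "\<And>x. x \<in> T \<Longrightarrow> x \<le> c" using compact_attains_sup[of T] by blast
    have ac: "a \<le> c" "c \<le> d" "1 - \<delta> \<le> \<sigma> * \<phi> c" using c(1) by (auto simp: T_def)
    have sc: "\<sigma> * \<phi> c = 1 - \<delta>"
    proof -
      have "\<sigma> * \<phi> d \<le> 1 - \<delta>" using sd \<delta> by linarith
      then obtain z where z: "c \<le> z" "z \<le> d" "\<sigma> * \<phi> z = 1 - \<delta>"
        using IVT2'[of "\<lambda>x. \<sigma> * \<phi> x" d "1 - \<delta>" c, OF _ ac(3) ac(2) cs] by blast
      then have "z \<in> T" using ac by (auto simp: T_def)
      then have "z = c" using c(2) z(1) by fastforce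
      then show ?thesis using z(3) by simp
    qed
    have "c \<noteq> d" using sc sd \<delta> by auto
    then have "c < d" using ac by simp
    have above: "- (1 - \<delta>) < \<sigma> * \<phi> x" if "x \<in> {a..c}" for x
    proof (rule ccontr)
      assume "\<not> - (1 - \<delta>) < \<sigma> * \<phi> x"
      then have "x \<in> S" using that \<open>c < d\<close> dB by (auto simp: S_def)
      then show False using d(2) that \<open>c < d\<close> by fastforce
    qed
    have inside: "\<bar>\<phi> x\<bar> \<le> 1 - \<delta>" if x: "x \<in> {c..d}" for x
    proof -
      have "\<sigma> * \<phi> x \<le> 1 - \<delta>"
      proof (rule ccontr)
        assume *: "\<not> \<sigma> * \<phi> x \<le> 1 - \<delta>"
        then have "x \<in> T" using x ac by (auto simp: T_def)
        then have "x = c" using c(2) x by fastforce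
        then show False using * sc by simp
      qed
      moreover have "- (1 - \<delta>) \<le> \<sigma> * \<phi> x"
      proof (rule ccontr)
        assume *: "\<not> - (1 - \<delta>) \<le> \<sigma> * \<phi> x"
        then have "x \<in> S" using x ac dB by (auto simp: S_def)
        then have "x = d" using d(2) x by fastforce
        then show False using * sd by simp
      qed
      ultimately show ?thesis using \<sigma> by auto
    qed
    have c\<sigma>: "\<bar>\<phi> c - \<sigma>\<bar> \<le> \<delta>" using abs_eq[of c] sc \<delta> by simp
    have d\<sigma>: "\<bar>\<phi> d - (- \<sigma>)\<bar> \<le> \<delta>" using sd \<sigma> \<delta> by auto
    have m\<sigma>: "- \<sigma> \<in> {-1, 1}" using \<sigma> by auto
    from Suc.IH[OF m\<sigma> dB(2) d\<sigma>] show ?thesis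
    proof
      assume "\<exists>x. alternates \<phi> (- \<sigma>) \<delta> n x \<and> d \<le> x 0"
      then obtain y where y: "alternates \<phi> (- \<sigma>) \<delta> n y" "d \<le> y 0" by blast
      define x where "x k = (case k of 0 \<Rightarrow> a | Suc j \<Rightarrow> y j)" for k
      have alt: "alternates \<phi> \<sigma> \<delta> (Suc n) x"
        unfolding alternates_def
      proof (intro conjI allI impI)
        fix k assume "k < Suc n"
        then show "x k \<le> x (Suc k)"
          using y dB(1) by (cases k) (auto simp: x_def alternates_def)
      next
        fix k assume "k \<le> Suc n"
        then show "\<bar>\<phi> (x k) - \<sigma> * (-1) ^ k\<bar> \<le> \<delta>"
          using y(1) Suc.prems(3) by (cases k) (auto simp: x_def alternates_def)
      qed
      have "a \<le> x 0" by (simp add: x_def)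
      with alt show ?thesis by blast
    next
      assume IH: "(LINT x:{d..B}|lborel. e x) \<le> (real n - 1) * (2/3) + real n * \<epsilon>"
      have "(LINT x:{a..c}|lborel. e x) \<le> 2 * \<delta> + 2 * sqrt M * \<eta>"
        by (rule near_vacuum[OF ac(1) \<sigma> less_imp_le[OF \<delta>(1)] \<delta>(2) \<theta>(1)
              no_excursion[OF \<sigma> \<delta>(1) \<delta>1 \<theta>(2) sa ac(3) above] Suc.prems(3) c\<sigma>])
      moreover have "(LINT x:{c..d}|lborel. e x) \<le> 2/3 + \<theta> * M / U (1 - \<delta>)"
        by (rule crossing[OF ac(2) \<sigma> \<delta>(1) \<delta>1 \<theta>(2) inside sc sd])
      moreover have "(LINT x:{a..B}|lborel. e x)
         = (LINT x:{a..c}|lborel. e x) + (LINT x:{c..d}|lborel. e x) + (LINT x:{d..B}|lborel. e x)"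
        using LINT_combine[OF li_e ac(1,2)] LINT_combine[OF li_e dB(1,2)] by simp
      ultimately have "(LINT x:{a..B}|lborel. e x) \<le> \<epsilon> + 2/3 + ((real n - 1) * (2/3) + real n * \<epsilon>)"
        using IH by (simp add: \<epsilon>_def)
      also have "\<dots> = (real (Suc n) - 1) * (2/3) + real (Suc n) * \<epsilon>" by (simp add: field_simps)
      finally show ?thesis by blast
    qed
  qed
qed

lemma pot_energy_or_alternates:
  assumes \<delta>: "0 < \<delta>" "\<delta> \<le> 1/2" and \<theta>: "\<theta> \<le> 1/4" "\<theta> < U (1 - \<delta>)"
    and l: "(\<phi> \<longlongrightarrow> l) at_bot" "l \<in> {-1, 1}" and r: "(\<phi> \<longlongrightarrow> r) at_top" "r \<in> {-1, 1}"
    and none: "\<nexists>x. alternates \<phi> l \<delta> n x"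
  shows "pot_energy \<phi> \<phi>' \<le> (real n - 1) * (2/3) +
    real n * (2 * \<delta> + 2 * sqrt M * \<eta> + \<theta> * M / U (1 - \<delta>))"
proof -
  have "eventually (\<lambda>x. dist (\<phi> x) l < \<delta>) at_bot" "eventually (\<lambda>x. dist (\<phi> x) r < \<delta>) at_top"
    by (rule tendstoD[OF l(1) \<delta>(1)], rule tendstoD[OF r(1) \<delta>(1)])
  then obtain A B where A: "\<And>x. x \<le> A \<Longrightarrow> \<bar>\<phi> x - l\<bar> \<le> \<delta>" and B: "\<And>x. x \<ge> B \<Longrightarrow> \<bar>\<phi> x - r\<bar> \<le> \<delta>"
    unfolding eventually_at_bot_linorder eventually_at_top_linorder dist_real_def by (meson less_imp_le)
  obtain N :: nat where N: "\<bar>A\<bar> + \<bar>B\<bar> \<le> real N" using real_arch_simple by blast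
  have "eventually (\<lambda>k. (LINT x:{-real k..real k}|lborel. e x) \<le> (real n - 1) * (2/3) +
    real n * (2 * \<delta> + 2 * sqrt M * \<eta> + \<theta> * M / U (1 - \<delta>))) sequentially"
    using eventually_ge_at_top[of N]
  proof eventually_elim
    case (elim k)
    then have k: "real N \<le> real k" by simp
    have "\<bar>\<phi> (real k) - r\<bar> \<le> \<delta>" using k N by (intro B) linarith
    moreover have "\<bar>\<phi> (- real k) - l\<bar> \<le> \<delta>" using k N by (intro A) linarith
    ultimately show ?case
      using energy_or_alternates[OF \<delta> \<theta> r(2), of "real k" l "- real k" n] none l(2) by auto
  qed
  from tendsto_upperbound[OF LINT_symmetric_interval_tendsto[OF integrable_e] this]
  show ?thesis by (simp add: pot_energy_def e_def[abs_def])
qed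

end

section \<open>Time averages of an asymptotically static solution\<close>

lemma unit_average_bound:
  fixes X :: "real \<Rightarrow> l2"
  assumes X: "continuous_on UNIV X" and B: "\<And>s. s \<in> {t..t+1} \<Longrightarrow> norm (X s - c) \<le> B"
  shows "norm (integral {t..t+1} X - c) \<le> B"
proof -
  have i: "X integrable_on {t..t+1}"
    by (rule integrable_continuous_interval[OF continuous_on_subset[OF X subset_UNIV]])
  have "norm (integral {t..t+1} (\<lambda>s. X s - c)) \<le> B * (t + 1 - t)"
    by (rule integral_bound)
       (use B in \<open>auto intro!: continuous_on_diff continuous_on_subset[OF X subset_UNIV] continuous_on_const\<close>)
  moreover have "integral {t..t+1} (\<lambda>s. X s - c) = integral {t..t+1} X - c"
    using i by (subst Henstock_Kurzweil_Integration.integral_diff) auto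
  ultimately show ?thesis by simp
qed

context kg_solution
begin

text \<open>Conservation of energy gives bounds that hold at all times: \<open>P_max\<close> and \<open>N_max\<close> for the norms of
  \<open>P\<close> and \<open>N\<close>, and \<open>u_max\<close> for the field and for its averages. Here \<open>4 + 6 E\<close> is the bound of
  \<open>sup_bound\<close> and \<open>1 + 4 P_max\<close> bounds the difference of the field and an average. \<open>Lip\<close> is a Lipschitz
  constant of \<open>U'\<close> on \<open>[-u_max, u_max]\<close>.\<close>

definition E :: real where "E = en 0"
definition P_max :: real where "P_max = sqrt (2 * E)"
definition u_max :: real where "u_max = 5 + 6 * E + 4 * P_max"
definition Lip :: real where "Lip = (3 * u_max\<^sup>2 + 1) / 2"
definition N_max :: real where "N_max = sqrt (2 * u_max\<^sup>2 * E)"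

lemma E_nonneg: "0 \<le> E" by (simp add: E_def en_nonneg)
lemma P_max_nonneg: "0 \<le> P_max" by (simp add: P_max_def E_nonneg)
lemma Lip_nonneg: "0 \<le> Lip" 
  unfolding Lip_def by (intro divide_nonneg_pos add_nonneg_nonneg mult_nonneg_nonneg zero_le_power2) simp_all
lemma N_max_nonneg: "0 \<le> N_max" by (simp add: N_max_def E_nonneg)

lemma energy_identity: "(norm (P t))\<^sup>2 / 2 + UI t + (norm (V t))\<^sup>2 / 2 = E"
  using energy_conserved[of t 0] by (simp add: E_def en_def pe_def)

lemma UI_le_E: "UI t \<le> E"
proof -
  have "0 \<le> (norm (P t))\<^sup>2" "0 \<le> (norm (V t))\<^sup>2" by simp_all
  then show ?thesis using energy_identity[of t] by linarith
qed

lemma norm_P_le: "norm (P t) \<le> P_max"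
proof -
  have "0 \<le> (norm (V t))\<^sup>2" by simp
  then have "(norm (P t))\<^sup>2 \<le> 2 * E" using energy_identity[of t] UI_nonneg[of t] by linarith
  then show ?thesis unfolding P_max_def by (rule real_le_rsqrt)
qed

lemma u_le: "\<bar>u t x\<bar> \<le> 4 + 6 * E"
proof -
  have "0 \<le> (norm (V t))\<^sup>2" by simp
  then have "pe t \<le> E" using energy_identity[of t] unfolding pe_def by linarith
  then show ?thesis using u_bound[of t x] by linarith
qed

lemma u_le_max: "\<bar>u t x\<bar> \<le> u_max"
  using u_le[of t x] P_max_nonneg by (simp add: u_max_def)

lemma norm_N_le: "norm (N t) \<le> N_max"
proof -
  have K0: "0 \<le> u_max" using P_max_nonneg E_nonneg by (simp add: u_max_def)
  have "(norm (N t))\<^sup>2 = (LINT x|lborel. (dU (u t x))\<^sup>2)" unfolding N_def by (rule norm_abs_l2[OF dU_sq])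
  also have "\<dots> \<le> (LINT x|lborel. (2 * u_max\<^sup>2) * U (u t x))"
  proof (rule integral_mono[OF square_integrable_square[OF dU_sq] integrable_mult_right[OF U_u_integrable]])
    fix x
    have "\<bar>u t x\<bar>\<^sup>2 \<le> u_max\<^sup>2" by (intro power_mono u_le_max) simp
    then show "(dU (u t x))\<^sup>2 \<le> (2 * u_max\<^sup>2) * U (u t x)"
      unfolding dU_squared by (intro mult_right_mono) (auto simp: U_nonneg)
  qed
  also have "\<dots> = (2 * u_max\<^sup>2) * UI t" by (simp add: UI_def)
  also have "\<dots> \<le> (2 * u_max\<^sup>2) * E" by (intro mult_left_mono UI_le_E) simp
  finally show ?thesis unfolding N_max_def by (rule real_le_rsqrt)
qed

lemma D_diff_le:
  assumes V: "\<And>s. s \<in> {t..t+1} \<Longrightarrow> norm (V s) \<le> \<kappa>" and s: "s \<in> {t..t+1}"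
  shows "norm (D s - D t) \<le> \<kappa>"
proof -
  have "0 \<le> \<kappa>" using V[OF s] norm_ge_zero order.trans by blast
  have "norm (integral {t..s} V) \<le> \<kappa> * (s - t)"
    by (rule integral_bound) (use s V in \<open>auto intro: V_continuous\<close>)
  also have "\<dots> \<le> \<kappa> * 1" using s \<open>0 \<le> \<kappa>\<close> by (intro mult_left_mono) auto
  finally show ?thesis using D_integral[of t s] s by simp
qed

lemma UI_diff_le:
  assumes "norm (D s - D t) \<le> \<kappa>" "\<kappa> \<le> 1"
  shows "\<bar>UI s - UI t\<bar> \<le> (N_max + Lip) * \<kappa>"
proof -
  have k: "0 \<le> \<kappa>" using assms(1) norm_ge_zero order.trans by blast
  have "\<bar>inner (N t) (D s - D t)\<bar> \<le> norm (N t) * norm (D s - D t)" by (rule Cauchy_Schwarz_ineq2)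
  also have "\<dots> \<le> N_max * \<kappa>" using norm_N_le assms N_max_nonneg by (intro mult_mono) auto
  finally have 1: "\<bar>inner (N t) (D s - D t)\<bar> \<le> N_max * \<kappa>" .
  have "\<bar>UI s - UI t - inner (N t) (D s - D t)\<bar> \<le> Lip * (norm (D s - D t))\<^sup>2"
    unfolding Lip_def by (rule UI_Taylor) (rule u_le_max)+
  also have "\<dots> \<le> Lip * \<kappa>"
  proof (rule mult_left_mono[OF _ Lip_nonneg])
    have "(norm (D s - D t))\<^sup>2 \<le> \<kappa>\<^sup>2" using assms by (intro power_mono) auto
    also have "\<dots> \<le> \<kappa>" using k assms(2) by (simp add: power2_eq_square mult_left_le)
    finally show "(norm (D s - D t))\<^sup>2 \<le> \<kappa>" .
  qed
  finally show ?thesis using 1 by (simp add: algebra_simps)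
qed

text \<open>The virial identity, with conservation of energy, shows that averaging over a unit time
  interval loses no gradient energy.\<close>

lemma gradient_energy_of_average:
  assumes V: "\<And>s. s \<in> {t..t+1} \<Longrightarrow> norm (V s) \<le> \<kappa>" and \<kappa>: "\<kappa> \<le> 1"
  shows "E - UI t \<le> (norm (integral {t..t+1} P))\<^sup>2 / 2 + (3 + 3 * N_max + 2 * Lip) * \<kappa>"
proof -
  have k: "0 \<le> \<kappa>" by (rule order.trans[OF norm_ge_zero V[of t]]) simp
  have kk: "\<kappa>\<^sup>2 \<le> \<kappa>" using k \<kappa> by (simp add: power2_eq_square mult_left_le)
  have V2: "(norm (V s))\<^sup>2 \<le> \<kappa>" if "s \<in> {t..t+1}" for s
    using power_mono[OF V[OF that], of 2] kk by simp
  define G where "G s = (norm (V s))\<^sup>2 - inner (P s) (P s - P t) - inner (N s) (D s - D t)" for s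
  have vir: "(G has_integral inner (V (t+1)) (D (t+1) - D t)) {t..t+1}"
    unfolding G_def by (rule virial_identity) simp
  have iP: "((\<lambda>s. inner (P s) (P t)) has_integral inner (integral {t..t+1} P) (P t)) {t..t+1}"
    using integrable_integral[OF curve_integrable[OF inner_curve_continuous[OF P_continuous]], of "P t" t "t+1"]
    by (simp add: inner_integral P_continuous)
  have arith: "2 * (e - ut) - 2 * c - 2 * \<kappa> - m \<le> x"
    if "x = q - w + n" "q = 2 * (e - us) - w" "us \<le> ut + c" "w \<le> \<kappa>" "- m \<le> n"
    for e ut us c m n q w x :: real
    using that by simp
  have arith2: "x \<le> a + y"
    if "2 * x - c - d - m \<le> i - w" "- w \<le> k" "i \<le> a + b" "b \<le> x" "y = c + d + m + k"
    for a b c d i k m w x y :: real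
    using that by linarith
  have upper: "((\<lambda>s. inner (P s) (P t) - G s) has_integral
     inner (integral {t..t+1} P) (P t) - inner (V (t+1)) (D (t+1) - D t)) {t..t+1}"
    by (rule has_integral_diff[OF iP vir])
  have lower: "((\<lambda>s. 2 * (E - UI t) - 2 * (N_max + Lip) * \<kappa> - 2 * \<kappa> - N_max * \<kappa>) has_integral
      (2 * (E - UI t) - 2 * (N_max + Lip) * \<kappa> - 2 * \<kappa> - N_max * \<kappa>)) {t..t+1}"
    using has_integral_const_real[of "2 * (E - UI t) - 2 * (N_max + Lip) * \<kappa> - 2 * \<kappa> - N_max * \<kappa>" t "t+1"] by simp
  have "2 * (E - UI t) - 2 * (N_max + Lip) * \<kappa> - 2 * \<kappa> - N_max * \<kappa>
      \<le> inner (integral {t..t+1} P) (P t) - inner (V (t+1)) (D (t+1) - D t)"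
  proof (rule has_integral_le[OF lower upper])
    fix s assume s: "s \<in> {t..t+1}"
    have Ds: "norm (D s - D t) \<le> \<kappa>" by (rule D_diff_le[OF V s])
    have "\<bar>inner (N s) (D s - D t)\<bar> \<le> norm (N s) * norm (D s - D t)" by (rule Cauchy_Schwarz_ineq2)
    also have "\<dots> \<le> N_max * \<kappa>" using norm_N_le Ds N_max_nonneg by (intro mult_mono) auto
    finally have n: "- (N_max * \<kappa>) \<le> inner (N s) (D s - D t)" by linarith
    have "inner (P s) (P t) - G s = (norm (P s))\<^sup>2 - (norm (V s))\<^sup>2 + inner (N s) (D s - D t)"
      by (simp add: G_def inner_diff_right power2_norm_eq_inner)
    moreover have "(norm (P s))\<^sup>2 = 2 * (E - UI s) - (norm (V s))\<^sup>2"
      using energy_identity[of s] by (simp add: field_simps)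
    moreover have "UI s \<le> UI t + (N_max + Lip) * \<kappa>" using UI_diff_le[OF Ds \<kappa>] by linarith
    ultimately show "2 * (E - UI t) - 2 * (N_max + Lip) * \<kappa> - 2 * \<kappa> - N_max * \<kappa> \<le> inner (P s) (P t) - G s"
      using V2[OF s] n unfolding mult.assoc[of 2 "N_max + Lip" \<kappa>] by (rule arith)
  qed
  moreover have "- inner (V (t+1)) (D (t+1) - D t) \<le> \<kappa>"
  proof -
    have "\<bar>inner (V (t+1)) (D (t+1) - D t)\<bar> \<le> norm (V (t+1)) * norm (D (t+1) - D t)" by (rule Cauchy_Schwarz_ineq2)
    also have "\<dots> \<le> \<kappa> * \<kappa>" using V[of "t+1"] D_diff_le[of t \<kappa> "t+1", OF V] k by (intro mult_mono) auto
    finally show ?thesis using kk by (simp add: power2_eq_square)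
  qed
  moreover have "inner (integral {t..t+1} P) (P t) \<le> (norm (integral {t..t+1} P))\<^sup>2 / 2 + (norm (P t))\<^sup>2 / 2"
  proof -
    have "inner (integral {t..t+1} P) (P t) \<le> norm (integral {t..t+1} P) * norm (P t)" by (rule norm_cauchy_schwarz)
    moreover have "2 * norm (integral {t..t+1} P) * norm (P t) \<le> (norm (integral {t..t+1} P))\<^sup>2 + (norm (P t))\<^sup>2"
      by (rule sum_squares_bound)
    ultimately show ?thesis by linarith
  qed
  moreover have "(norm (P t))\<^sup>2 / 2 \<le> E - UI t" using energy_identity[of t] zero_le_power2[of "norm (V t)"] by linarith
  moreover have "(3 + 3 * N_max + 2 * Lip) * \<kappa> = 2 * (N_max + Lip) * \<kappa> + 2 * \<kappa> + N_max * \<kappa> + \<kappa>" by (simp add: algebra_simps)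
  ultimately show ?thesis by (rule arith2)
qed

text \<open>The profile is \<open>\<phi>(t)\<close> plus the average \<open>z\<close> of the displacements \<open>\<phi>(s) - \<phi>(t)\<close>. Its residual is
  \<open>V(t+1) - V(t)\<close> plus the average of \<open>U'(\<phi>(s))\<close> minus \<open>U'\<close> of the profile; all displacements are at
  most \<open>\<kappa>\<close> in \<open>L\<^sup>2\<close>, so each part is \<open>O(\<kappa>)\<close>. The distance to \<open>\<phi>(t)\<close> is uniformly small because \<open>z\<close>
  is small in \<open>L\<^sup>2\<close> and bounded in \<open>H\<^sup>1\<close>.\<close>

lemma averaged_profile:
  assumes V: "\<And>s. s \<in> {t..t+1} \<Longrightarrow> norm (V s) \<le> \<kappa>" and \<kappa>: "\<kappa> \<le> 1"
  shows "\<exists>\<phi> \<phi>' \<phi>''. almost_static \<phi> \<phi>' \<phi>'' ((2 + 2 * Lip) * \<kappa>) (2 * E + N_max + Lip) \<and>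
    (\<phi> \<longlongrightarrow> l) at_bot \<and> (\<phi> \<longlongrightarrow> r) at_top \<and>
    E \<le> pot_energy \<phi> \<phi>' + (3 + 4 * N_max + 3 * Lip) * \<kappa> \<and>
    (\<forall>x. (\<phi> x - u t x)\<^sup>2 \<le> 4 * P_max * \<kappa>)"
proof -
  have k: "0 \<le> \<kappa>" by (rule order.trans[OF norm_ge_zero V[of t]]) simp
  have kk: "\<kappa>\<^sup>2 \<le> \<kappa>" using k \<kappa> by (simp add: power2_eq_square mult_left_le)
  define PA where "PA = integral {t..t+1} P"
  define NA where "NA = integral {t..t+1} N"
  define zA where "zA = integral {t..t+1} (\<lambda>s. D s - D t)"
  define Q where "Q = V (t+1) - V t + NA"
  have DP: "continuous_on UNIV (\<lambda>s. D s - D t)" "continuous_on UNIV (\<lambda>s. P s - P t)"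
    by (intro continuous_on_diff continuous_on_const D_continuous P_continuous)+
  have PAt: "integral {t..t+1} (\<lambda>s. P s - P t) = PA - P t"
    unfolding PA_def using curve_integrable[OF P_continuous, of t "t+1"]
    by (subst Henstock_Kurzweil_Integration.integral_diff) auto
  have dz: "l2_deriv zA (PA - P t)"
    unfolding zA_def PAt[symmetric] by (rule l2_deriv_integral[OF DP D_deriv])
  have dP: "l2_deriv PA Q"
    unfolding PA_def Q_def NA_def by (rule P_integral_deriv) simp
  have nz: "norm zA \<le> \<kappa>"
    using unit_average_bound[OF DP(1), of t 0 \<kappa>] D_diff_le[OF V] by (simp add: zA_def)
  have nPA: "norm PA \<le> P_max"
    using unit_average_bound[OF P_continuous, of t 0 P_max] norm_P_le by (simp add: PA_def)
  have nNA: "norm (NA - N t) \<le> Lip * \<kappa>"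
    unfolding NA_def
  proof (rule unit_average_bound[OF N_continuous])
    fix s assume s: "s \<in> {t..t+1}"
    have "norm (N s - N t) \<le> Lip * norm (D s - D t)" unfolding Lip_def by (rule N_Lipschitz) (rule u_le_max)+
    also have "\<dots> \<le> Lip * \<kappa>" by (intro mult_left_mono D_diff_le[OF V s] Lip_nonneg)
    finally show "norm (N s - N t) \<le> Lip * \<kappa>" .
  qed
  define \<phi>'' where "\<phi>'' = rep_l2 Q"
  have sq2: "square_integrable \<phi>''" and abs2: "abs_l2 \<phi>'' = Q"
    by (simp_all add: \<phi>''_def rep_l2_square_integrable abs_rep_l2)
  obtain \<phi>' where \<phi>': "is_primitive \<phi>' \<phi>''" "square_integrable \<phi>'" "abs_l2 \<phi>' = PA"
  proof (rule l2_deriv_imp_primitive[of "rep_l2 PA" \<phi>''])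
    show "l2_deriv (abs_l2 (rep_l2 PA)) (abs_l2 \<phi>'')" using dP by (simp add: abs_rep_l2 abs2)
  qed (simp_all add: sq2 rep_l2_square_integrable abs_rep_l2)
  define g where "g x = \<phi>' x - p t x" for x
  have sqg: "square_integrable g" unfolding g_def by (intro square_integrable_diff \<phi>'(2) p_sq)
  have absg: "abs_l2 g = PA - P t"
    unfolding g_def P_def \<phi>'(3)[symmetric] by (simp add: abs_l2_diff \<phi>'(2) p_sq)
  obtain z where z: "is_primitive z g" "square_integrable z" "abs_l2 z = zA"
  proof (rule l2_deriv_imp_primitive[of "rep_l2 zA" g])
    show "l2_deriv (abs_l2 (rep_l2 zA)) (abs_l2 g)" using dz by (simp add: abs_rep_l2 absg)
  qed (simp_all add: sqg rep_l2_square_integrable abs_rep_l2)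
  define \<phi> where "\<phi> x = u t x + z x" for x
  have \<phi>: "is_primitive \<phi> \<phi>'"
    using is_primitive_add[OF u_primitive[of t] z(1)] by (simp add: \<phi>_def[abs_def] g_def[abs_def])
  have zlim: "(z \<longlongrightarrow> 0) at_top" "(z \<longlongrightarrow> 0) at_bot" by (rule H1_tendsto[OF z(1,2) sqg])+
  have lims: "(\<phi> \<longlongrightarrow> l) at_bot" "(\<phi> \<longlongrightarrow> r) at_top"
    using tendsto_add[OF u_at_bot[of t] zlim(2)] tendsto_add[OF u_at_top[of t] zlim(1)] by (simp_all add: \<phi>_def[abs_def])
  have z2: "(z x)\<^sup>2 \<le> 4 * P_max * \<kappa>" for x
  proof -
    have "(z x)\<^sup>2 \<le> 2 * norm (abs_l2 z) * norm (abs_l2 g)" by (rule H1_sup_bound[OF z(1,2) sqg])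
    also have "\<dots> \<le> 2 * \<kappa> * (2 * P_max)"
    proof (intro mult_mono)
      show "norm (abs_l2 z) \<le> \<kappa>" by (simp add: z(3) nz)
      show "norm (abs_l2 g) \<le> 2 * P_max"
        unfolding absg using norm_triangle_ineq4[of PA "P t"] nPA norm_P_le[of t] by linarith
    qed (use k in auto)
    finally show ?thesis by (simp add: mult_ac)
  qed
  have zK: "\<bar>z x\<bar> \<le> 1 + 4 * P_max" for x
  proof -
    have "4 * P_max * \<kappa> \<le> 4 * P_max * 1" using \<kappa> P_max_nonneg by (intro mult_left_mono) auto
    then have "(z x)\<^sup>2 \<le> 4 * P_max" using z2[of x] by linarith
    moreover have "2 * \<bar>z x\<bar> * 1 \<le> \<bar>z x\<bar>\<^sup>2 + 1\<^sup>2" by (rule sum_squares_bound)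
    ultimately have "2 * \<bar>z x\<bar> \<le> 4 * P_max + 1" by simp
    then show ?thesis using P_max_nonneg by linarith
  qed
  have \<phi>K: "\<bar>\<phi> x\<bar> \<le> u_max" for x
    unfolding \<phi>_def u_max_def using u_le[of t x] zK[of x] by linarith
  have c\<phi>: "continuous_on UNIV \<phi>" by (rule is_primitive_continuous[OF \<phi>])
  have zeq: "(\<lambda>x. \<phi> x - u t x) = z" by (simp add: \<phi>_def)
  have sqz: "square_integrable (\<lambda>x. \<phi> x - u t x)" unfolding zeq by (rule z(2))
  note T = U_integral_Taylor[OF u_le_max \<phi>K c\<phi> U_u_integrable sqz dU_sq, unfolded zeq z(3), folded N_def UI_def Lip_def]
  have UI\<phi>: "\<bar>(LINT x|lborel. U (\<phi> x)) - UI t\<bar> \<le> (N_max + Lip) * \<kappa>"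
  proof -
    have "\<bar>inner (N t) zA\<bar> \<le> norm (N t) * norm zA" by (rule Cauchy_Schwarz_ineq2)
    also have "\<dots> \<le> N_max * \<kappa>" using norm_N_le nz N_max_nonneg by (intro mult_mono) auto
    finally have 1: "\<bar>inner (N t) zA\<bar> \<le> N_max * \<kappa>" .
    have "Lip * (norm zA)\<^sup>2 \<le> Lip * \<kappa>"
      using power_mono[OF nz, of 2] kk by (intro mult_left_mono Lip_nonneg) auto
    then show ?thesis using T(2) 1 by (simp add: algebra_simps)
  qed
  have sqdU: "square_integrable (\<lambda>x. dU (\<phi> x))" by (rule dU_square_integrable[OF c\<phi> T(1) \<phi>K])
  have f: "norm (abs_l2 (\<lambda>x. \<phi>'' x - dU (\<phi> x))) \<le> (2 + 2 * Lip) * \<kappa>"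
  proof -
    have a: "norm (abs_l2 (\<lambda>x. dU (\<phi> x)) - N t) \<le> Lip * \<kappa>"
    proof -
      have "norm (abs_l2 (\<lambda>x. dU (\<phi> x)) - N t) \<le> Lip * norm zA"
        using Lipschitz_dU_norm[OF u_le_max \<phi>K sqz dU_sq sqdU] unfolding zeq z(3) N_def Lip_def .
      also have "\<dots> \<le> Lip * \<kappa>" by (intro mult_left_mono nz Lip_nonneg)
      finally show ?thesis .
    qed
    have "abs_l2 (\<lambda>x. \<phi>'' x - dU (\<phi> x)) = V (t+1) - V t + (NA - N t) - (abs_l2 (\<lambda>x. dU (\<phi> x)) - N t)"
      using abs_l2_diff[OF sq2 sqdU] by (simp add: abs2 Q_def)
    also have "norm \<dots> \<le> norm (V (t+1)) + norm (V t) + norm (NA - N t) + norm (abs_l2 (\<lambda>x. dU (\<phi> x)) - N t)"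
      using norm_triangle_ineq4[of "V (t+1) - V t + (NA - N t)" "abs_l2 (\<lambda>x. dU (\<phi> x)) - N t"]
        norm_triangle_ineq[of "V (t+1) - V t" "NA - N t"] norm_triangle_ineq4[of "V (t+1)" "V t"] by linarith
    also have "\<dots> \<le> (2 + 2 * Lip) * \<kappa>"
      using V[of t] V[of "t+1"] nNA a by (simp add: algebra_simps)
    finally show ?thesis .
  qed
  have pot: "pot_energy \<phi> \<phi>' = (norm PA)\<^sup>2 / 2 + (LINT x|lborel. U (\<phi> x))"
  proof -
    have "integrable lborel (\<lambda>x. (\<phi>' x)\<^sup>2 / 2)" using square_integrable_square[OF \<phi>'(2)] by simp
    then have "pot_energy \<phi> \<phi>' = (LINT x|lborel. (\<phi>' x)\<^sup>2 / 2) + (LINT x|lborel. U (\<phi> x))"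
      unfolding pot_energy_def using T(1) by (rule Bochner_Integration.integral_add)
    then show ?thesis using norm_abs_l2[OF \<phi>'(2)] by (simp add: \<phi>'(3))
  qed
  have potM: "pot_energy \<phi> \<phi>' \<le> 2 * E + N_max + Lip"
  proof -
    have "(norm PA)\<^sup>2 \<le> P_max\<^sup>2" by (intro power_mono nPA) simp
    then have "(norm PA)\<^sup>2 / 2 \<le> E" using E_nonneg by (simp add: P_max_def)
    moreover have "(N_max + Lip) * \<kappa> \<le> N_max + Lip" using \<kappa> N_max_nonneg Lip_nonneg by (intro mult_left_le) auto
    ultimately show ?thesis unfolding pot using UI\<phi> UI_le_E[of t] by linarith
  qed
  have "almost_static \<phi> \<phi>' \<phi>'' ((2 + 2 * Lip) * \<kappa>) (2 * E + N_max + Lip)"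
    by unfold_locales (use \<phi> \<phi>' T(1) sq2 sqdU f potM in \<open>auto intro: square_integrable_diff\<close>)
  moreover have "E \<le> pot_energy \<phi> \<phi>' + (3 + 4 * N_max + 3 * Lip) * \<kappa>"
    using gradient_energy_of_average[of t \<kappa>, OF V \<kappa>] UI\<phi> unfolding pot PA_def[symmetric]
    by (simp add: algebra_simps)
  moreover have "\<forall>x. (\<phi> x - u t x)\<^sup>2 \<le> 4 * P_max * \<kappa>" using z2 by (simp add: \<phi>_def)
  ultimately show ?thesis using lims by blast
qed

end

section \<open>Asymptotically static solutions are kink clusters\<close>

lemma (in almost_static) \<theta>_le: "\<theta> \<le> sqrt (2 * M) * \<eta>"
proof -
  have "(LINT x|lborel. (\<phi>' x)\<^sup>2 / 2) \<le> M"
    by (rule LINT_le_M) (use square_integrable_square[OF sq] in \<open>auto simp: e_def U_nonneg\<close>)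
  then have "(norm (abs_l2 \<phi>'))\<^sup>2 \<le> 2 * M" by (simp add: norm_abs_l2[OF sq])
  then have "norm (abs_l2 \<phi>') \<le> sqrt (2 * M)" by (rule real_le_rsqrt)
  then show ?thesis unfolding \<theta>_def by (rule mult_right_mono[OF _ \<eta>_nonneg])
qed

lemma U_pos: "0 < y \<Longrightarrow> y < 1 \<Longrightarrow> 0 < U y"
proof -
  assume "0 < y" "y < 1"
  then have "y\<^sup>2 < 1" by (simp add: abs_square_less_1)
  then show ?thesis by (simp add: U_def)
qed

context kg_solution
begin

text \<open>Otherwise the averaged profile would have fewer than \<open>n\<close> crossings, and the energy would be at
  most \<open>(n - 1) \<cdot> 2/3\<close> plus an error below \<open>E - (n - 1) \<cdot> 2/3\<close>. The contribution \<open>2 n \<delta>\<close> to this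
  error is made small first; the others then vanish with \<open>\<kappa>\<close>.\<close>

lemma static_imp_eventually_alternates:
  assumes static: "((\<lambda>t. (norm (V t))\<^sup>2) \<longlongrightarrow> 0) at_top"
    and n: "n = 0 \<or> (real n - 1) * (2/3) < E" and \<epsilon>: "0 < \<epsilon>"
  shows "eventually (\<lambda>t. \<exists>x. alternates (u t) l \<epsilon> n x) at_top"
proof (cases "n = 0")
  case True
  have "\<exists>x. alternates (u t) l \<epsilon> n x" for t
  proof -
    have "eventually (\<lambda>x. dist (u t x) l < \<epsilon>) at_bot" by (rule tendstoD[OF u_at_bot \<epsilon>])
    then obtain x where "dist (u t x) l < \<epsilon>" unfolding eventually_at_bot_linorder by blast
    then have "alternates (u t) l \<epsilon> n (\<lambda>_. x)" by (simp add: alternates_def True dist_real_def)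
    then show ?thesis by blast
  qed
  then show ?thesis by simp
next
  case False
  define \<gamma> where "\<gamma> = E - (real n - 1) * (2/3)"
  have \<gamma>: "0 < \<gamma>" using n False by (simp add: \<gamma>_def)
  have n1: "1 \<le> real n" using False by simp
  define \<delta> where "\<delta> = min (\<epsilon> / 2) (min (1/4) (\<gamma> / (4 * real n)))"
  have \<delta>: "0 < \<delta>" "\<delta> \<le> \<epsilon> / 2" "\<delta> \<le> 1/2" "\<delta> < 1" "\<delta> \<le> \<gamma> / (4 * real n)"
    using \<epsilon> \<gamma> n1 by (auto simp: \<delta>_def)
  have \<delta>n: "real n * (2 * \<delta>) < \<gamma>"
  proof -
    have "real n * (2 * \<delta>) \<le> real n * (2 * (\<gamma> / (4 * real n)))"
      using \<delta>(5) n1 by (intro mult_left_mono) auto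
    also have "\<dots> = \<gamma> / 2" using n1 by simp
    finally show ?thesis using \<gamma> by simp
  qed
  define m where "m = U (1 - \<delta>)"
  have m: "0 < m" unfolding m_def using \<delta> by (intro U_pos) auto
  define M where "M = 2 * E + N_max + Lip"
  have M: "0 \<le> M" using E_nonneg N_max_nonneg Lip_nonneg by (simp add: M_def)
  define c1 where "c1 = 2 + 2 * Lip"
  define c2 where "c2 = 3 + 4 * N_max + 3 * Lip"
  define T where "T \<kappa> = sqrt (2 * M) * (c1 * \<kappa>)" for \<kappa>
  define h where "h \<kappa> = real n * (2 * \<delta> + 2 * sqrt M * (c1 * \<kappa>) + T \<kappa> * M / m) + c2 * \<kappa>" for \<kappa>
  have id0: "((\<lambda>\<kappa>::real. \<kappa>) \<longlongrightarrow> 0) (at_right 0)" by (rule tendsto_ident_at)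
  have T0: "(T \<longlongrightarrow> sqrt (2 * M) * (c1 * 0)) (at_right 0)"
    unfolding T_def[abs_def] by (intro tendsto_mult tendsto_const id0)
  have h0: "(h \<longlongrightarrow> real n * (2 * \<delta> + 2 * sqrt M * (c1 * 0) + sqrt (2 * M) * (c1 * 0) * M / m) + c2 * 0) (at_right 0)"
    unfolding h_def[abs_def]
    by (intro tendsto_add tendsto_mult tendsto_divide tendsto_const id0 T0) (use m in simp)
  have p0: "((\<lambda>\<kappa>. 4 * P_max * \<kappa>) \<longlongrightarrow> 4 * P_max * 0) (at_right 0)" by (intro tendsto_mult tendsto_const id0)
  have "eventually (\<lambda>\<kappa>. 0 < \<kappa> \<and> \<kappa> < 1 \<and> T \<kappa> < 1/4 \<and> T \<kappa> < m \<and> h \<kappa> < \<gamma> \<and> 4 * P_max * \<kappa> < (\<epsilon>/2)\<^sup>2) (at_right 0)"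
  proof (intro eventually_conj)
    show "eventually (\<lambda>\<kappa>::real. 0 < \<kappa>) (at_right 0)" by (rule eventually_at_right_less)
    show "eventually (\<lambda>\<kappa>::real. \<kappa> < 1) (at_right 0)" by (rule order_tendstoD(2)[OF id0]) simp
    show "eventually (\<lambda>\<kappa>. T \<kappa> < 1/4) (at_right 0)" by (rule order_tendstoD(2)[OF T0]) simp
    show "eventually (\<lambda>\<kappa>. T \<kappa> < m) (at_right 0)" by (rule order_tendstoD(2)[OF T0]) (use m in simp)
    show "eventually (\<lambda>\<kappa>. h \<kappa> < \<gamma>) (at_right 0)" by (rule order_tendstoD(2)[OF h0]) (use \<delta>n in simp)
    show "eventually (\<lambda>\<kappa>. 4 * P_max * \<kappa> < (\<epsilon>/2)\<^sup>2) (at_right 0)" by (rule order_tendstoD(2)[OF p0]) (use \<epsilon> in simp)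
  qed
  from eventually_happens'[OF _ this] obtain \<kappa>
    where \<kappa>: "0 < \<kappa>" "\<kappa> < 1" "T \<kappa> < 1/4" "T \<kappa> < m" "h \<kappa> < \<gamma>" "4 * P_max * \<kappa> < (\<epsilon>/2)\<^sup>2"
    by auto
  have "eventually (\<lambda>t. (norm (V t))\<^sup>2 < \<kappa>\<^sup>2) at_top"
    by (rule order_tendstoD(2)[OF static]) (use \<kappa> in simp)
  then obtain t0 where t0: "\<And>t. t \<ge> t0 \<Longrightarrow> (norm (V t))\<^sup>2 < \<kappa>\<^sup>2"
    unfolding eventually_at_top_linorder by blast
  have V: "norm (V t) \<le> \<kappa>" if "t \<ge> t0" for t
    using power_less_imp_less_base[OF t0[OF that]] \<kappa>(1) by simp
  show ?thesis
    unfolding eventually_at_top_linorder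
  proof (intro exI[of _ t0] allI impI)
    fix t assume t: "t0 \<le> t"
    show "\<exists>x. alternates (u t) l \<epsilon> n x"
    proof (rule ccontr)
      assume none: "\<nexists>x. alternates (u t) l \<epsilon> n x"
      have "\<And>s. s \<in> {t..t+1} \<Longrightarrow> norm (V s) \<le> \<kappa>" using V t by auto
      from averaged_profile[of t \<kappa>, OF this less_imp_le[OF \<kappa>(2)]]
      obtain \<phi> \<phi>' \<phi>'' where as: "almost_static \<phi> \<phi>' \<phi>'' (c1 * \<kappa>) M"
        and lims: "(\<phi> \<longlongrightarrow> l) at_bot" "(\<phi> \<longlongrightarrow> r) at_top"
        and E: "E \<le> pot_energy \<phi> \<phi>' + c2 * \<kappa>" and close: "\<And>x. (\<phi> x - u t x)\<^sup>2 \<le> 4 * P_max * \<kappa>"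
        unfolding c1_def c2_def M_def by blast
      interpret A: almost_static \<phi> \<phi>' \<phi>'' "c1 * \<kappa>" M by (rule as)
      have \<theta>T: "A.\<theta> \<le> T \<kappa>" unfolding T_def by (rule A.\<theta>_le)
      have close': "\<bar>\<phi> x - u t x\<bar> \<le> \<epsilon> / 2" for x
      proof -
        have "\<bar>\<phi> x - u t x\<bar>\<^sup>2 \<le> (\<epsilon>/2)\<^sup>2" using close[of x] \<kappa>(6) by simp
        then show ?thesis by (rule power2_le_imp_le) (use \<epsilon> in simp)
      qed
      have none': "\<nexists>x. alternates \<phi> l \<delta> n x"
      proof
        assume "\<exists>x. alternates \<phi> l \<delta> n x"
        then obtain x where x: "alternates \<phi> l \<delta> n x" by blast
        have "\<bar>u t (x k) - l * (-1) ^ k\<bar> \<le> \<epsilon>" if "k \<le> n" for k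
        proof -
          have "\<bar>\<phi> (x k) - l * (-1) ^ k\<bar> \<le> \<delta>" using x that by (simp add: alternates_def)
          then show ?thesis using close'[of "x k"] \<delta>(2) by linarith
        qed
        then have "alternates (u t) l \<epsilon> n x" using x by (simp add: alternates_def)
        then show False using none by blast
      qed
      have "A.\<theta> \<le> 1/4" "A.\<theta> < U (1 - \<delta>)" using \<theta>T \<kappa> by (auto simp: m_def)
      from A.pot_energy_or_alternates[OF \<delta>(1,3) this lims(1) l lims(2) r none']
      have pot: "pot_energy \<phi> \<phi>' \<le> (real n - 1) * (2/3) + real n * (2 * \<delta> + 2 * sqrt M * (c1 * \<kappa>) + A.\<theta> * M / m)"
        unfolding m_def .
      have "A.\<theta> * M / m \<le> T \<kappa> * M / m"
        using \<theta>T M m by (intro divide_right_mono mult_right_mono) auto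
      then have "real n * (2 * \<delta> + 2 * sqrt M * (c1 * \<kappa>) + A.\<theta> * M / m)
          \<le> real n * (2 * \<delta> + 2 * sqrt M * (c1 * \<kappa>) + T \<kappa> * M / m)"
        by (intro mult_left_mono add_left_mono) auto
      then have "E \<le> (real n - 1) * (2/3) + h \<kappa>" using E pot unfolding h_def by simp
      then show False using \<kappa>(5) by (simp add: \<gamma>_def)
    qed
  qed
qed

end

text \<open>At each time the points are chosen so that their accuracy is within \<open>1 / (1 + |t|)\<close> of the best
  possible one. The best accuracy tends to
  \<open>0\<close> by hypothesis.\<close>

lemma select_alternating_points:
  fixes w :: "real \<Rightarrow> real \<Rightarrow> real"
  assumes ev: "\<And>\<epsilon>. 0 < \<epsilon> \<Longrightarrow> eventually (\<lambda>t. \<exists>x. alternates (w t) \<sigma> \<epsilon> n x) at_top"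
  shows "\<exists>x :: nat \<Rightarrow> real \<Rightarrow> real. (\<forall>t. \<forall>k<n. x k t \<le> x (Suc k) t) \<and>
    (\<forall>k\<le>n. ((\<lambda>t. w t (x k t)) \<longlongrightarrow> \<sigma> * (-1) ^ k) at_top)"
proof -
  define S where "S t = {e. 0 < e \<and> (\<exists>x. alternates (w t) \<sigma> e n x)}" for t
  have bdd: "bdd_below (S t)" for t by (rule bdd_belowI[of _ 0]) (auto simp: S_def)
  have ne: "S t \<noteq> {}" for t
  proof -
    have "alternates (w t) \<sigma> (1 + \<bar>w t 0\<bar> + \<bar>\<sigma>\<bar>) n (\<lambda>_. 0)"
      unfolding alternates_def
    proof (intro conjI allI impI)
      fix k
      have "\<bar>\<sigma> * (-1) ^ k\<bar> = \<bar>\<sigma>\<bar>" by (simp add: abs_mult)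
      then show "\<bar>w t 0 - \<sigma> * (-1) ^ k\<bar> \<le> 1 + \<bar>w t 0\<bar> + \<bar>\<sigma>\<bar>" by linarith
    qed simp
    then have "1 + \<bar>w t 0\<bar> + \<bar>\<sigma>\<bar> \<in> S t" by (auto simp: S_def intro: add_pos_nonneg)
    then show ?thesis by blast
  qed
  have "\<exists>x e. e < Inf (S t) + 1 / (1 + \<bar>t\<bar>) \<and> alternates (w t) \<sigma> e n x" for t
  proof -
    have "Inf (S t) < Inf (S t) + 1 / (1 + \<bar>t\<bar>)" by (simp add: add_pos_nonneg)
    from cInf_lessD[OF ne this] show ?thesis by (auto simp: S_def)
  qed
  then obtain X e where X: "\<And>t. e t < Inf (S t) + 1 / (1 + \<bar>t\<bar>)" "\<And>t. alternates (w t) \<sigma> (e t) n (X t)"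
    by metis
  have "((\<lambda>t. w t (X t k)) \<longlongrightarrow> \<sigma> * (-1) ^ k) at_top" if k: "k \<le> n" for k
  proof (rule tendstoI)
    fix \<epsilon> :: real assume \<epsilon>: "0 < \<epsilon>"
    have "eventually (\<lambda>t. \<exists>x. alternates (w t) \<sigma> (\<epsilon>/2) n x) at_top" using ev \<epsilon> by simp
    moreover have "eventually (\<lambda>t::real. t \<ge> 2 / \<epsilon>) at_top" by (rule eventually_ge_at_top)
    ultimately show "eventually (\<lambda>t. dist (w t (X t k)) (\<sigma> * (-1) ^ k) < \<epsilon>) at_top"
    proof eventually_elim
      case (elim t)
      then have "\<epsilon>/2 \<in> S t" using \<epsilon> by (simp add: S_def)
      then have "Inf (S t) \<le> \<epsilon>/2" by (rule cInf_lower[OF _ bdd])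
      moreover have "1 / (1 + \<bar>t\<bar>) \<le> \<epsilon>/2"
      proof -
        have "0 < 2 / \<epsilon>" using \<epsilon> by simp
        then have "1 / (1 + \<bar>t\<bar>) \<le> 1 / (2 / \<epsilon>)" using elim(2) by (intro divide_left_mono mult_pos_pos) auto
        then show ?thesis by simp
      qed
      ultimately have "e t < \<epsilon>" using X(1)[of t] by linarith
      moreover have "\<bar>w t (X t k) - \<sigma> * (-1) ^ k\<bar> \<le> e t" using X(2)[of t] k by (simp add: alternates_def)
      ultimately show ?case by (simp add: dist_real_def)
    qed
  qed
  then show ?thesis
    using X(2) by (intro exI[of _ "\<lambda>k t. X t k"]) (auto simp: alternates_def)
qed

text \<open>The number of kinks is the least \<open>n\<close> that the energy bound permits; then the energy exceeds
  \<open>(n - 1) \<cdot> 2/3\<close> and forces \<open>n\<close> crossings.\<close>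

lemma (in kg_solution) static_imp_kink_cluster:
  assumes static: "((\<lambda>t. L2_norm_sq (snd (\<Phi> t))) \<longlongrightarrow> 0) at_top" and l1: "l = 1"
  shows "kink_cluster \<Phi>"
proof -
  define n where "n = (LEAST n. E \<le> real n * (2/3))"
  have "\<exists>n. E \<le> real n * (2/3)"
  proof -
    obtain k :: nat where "E * (3/2) \<le> real k" using real_arch_simple by blast
    then show ?thesis by (intro exI[of _ k]) simp
  qed
  then have n: "E \<le> real n * (2/3)" unfolding n_def by (rule LeastI_ex)
  have min: "n = 0 \<or> (real n - 1) * (2/3) < E"
  proof (cases n)
    case (Suc k)
    then have "\<not> E \<le> real k * (2/3)" using not_less_Least[of k "\<lambda>n. E \<le> real n * (2/3)"] by (simp add: n_def)
    then show ?thesis by (simp add: Suc)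
  qed simp
  obtain x where x: "\<And>t k. k < n \<Longrightarrow> x k t \<le> x (Suc k) t"
    "\<And>k. k \<le> n \<Longrightarrow> ((\<lambda>t. u t (x k t)) \<longlongrightarrow> l * (-1) ^ k) at_top"
    using select_alternating_points[of u l n] static_imp_eventually_alternates[OF static[unfolded static_iff] min]
    by blast
  have "solution \<Phi>" unfolding solution_def using l r states cont sol by blast
  moreover have "energy (\<Phi> 0) \<le> of_nat n * potential_energy kink" using n by (simp only: energy_le_iff E_def)
  moreover have "((\<lambda>t. fst (\<Phi> t) (x k t)) \<longlongrightarrow> (-1) ^ k) at_top" if "k \<le> n" for k
    using x(2)[OF that] by (simp add: u_def l1)
  ultimately have "kink_n_cluster n \<Phi>" unfolding kink_n_cluster_def using x(1) by blast
  then show ?thesis unfolding kink_cluster_def by blast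
qed

subsection \<open>The symmetry of changing the sign\<close>

lemma L2_norm_sq_minus: "L2_norm_sq (\<lambda>x. - f x) = L2_norm_sq f"
  by (simp add: L2_norm_sq_def)

text \<open>The weak derivative is an arbitrary representative, so it commutes with the sign only almost
  everywhere.\<close>

lemma weak_deriv_minus_AE:
  assumes "is_primitive f g"
  shows "AE x in lborel. weak_deriv (\<lambda>x. - f x) x = - weak_deriv f x"
proof -
  have g: "is_primitive h (weak_deriv h)" if "is_primitive h k" for h k
    using is_primitive_imp_weak_derivative[OF that]
    by (intro weak_deriv_is_primitive is_primitive_continuous[OF that]) blast
  have m: "is_primitive (\<lambda>x. - f x) (\<lambda>x. - weak_deriv f x)"
    using is_primitive_cmult[OF g[OF assms], of "-1"] by simp
  show ?thesis by (rule is_primitive_unique[OF g[OF m] m])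
qed

lemma (in kg_solution) kg_solution_minus: "kg_solution (- \<Phi>) (- l) (- r)"
proof
  show "- l \<in> {-1, 1}" "- r \<in> {-1, 1}" using l r by auto
  have eq: "(- \<Phi>) t = (\<lambda>x. - u t x, \<lambda>x. - v t x)" for t
    by (simp add: state_eq uminus_prod_def fun_Compl_def)
  have wd: "has_weak_derivative (\<lambda>x. - u t x) (\<lambda>x. - p t x)" for t
    using is_primitive_imp_weak_derivative[OF is_primitive_cmult[OF u_primitive[of t], of "-1"]] by simp
  show "(- \<Phi>) t \<in> finite_energy_states (- l) (- r)" for t
  proof -
    have "potential_energy (\<lambda>x. - u t x) = potential_energy (u t)"
      unfolding potential_energy_def
    proof (rule nn_integral_cong_AE)
      show "AE x in lborel. ennreal (1/2 * (weak_deriv (\<lambda>x. - u t x) x)\<^sup>2 + U (- u t x)) =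
          ennreal (1/2 * (weak_deriv (u t) x)\<^sup>2 + U (u t x))"
        using weak_deriv_minus_AE[OF u_primitive[of t]] by eventually_elim (simp add: U_even)
    qed
    then have "energy (\<lambda>x. - u t x, \<lambda>x. - v t x) = energy (u t, v t)" by (simp add: energy_def)
    moreover have "energy (u t, v t) < \<infinity>" "v t \<in> borel_measurable lborel"
      using state_mem[of t] by (auto simp: finite_energy_states_def)
    ultimately show ?thesis
      unfolding eq finite_energy_states_def using wd[of t] u_continuous[of t] u_at_bot[of t] u_at_top[of t]
      by (auto intro!: continuous_on_minus tendsto_minus)
  qed
  show "continuous_in_time (- \<Phi>)"
  proof -
    have "H1_L2_norm_sq ((- \<Phi>) s - (- \<Phi>) t) = H1_L2_norm_sq (\<Phi> s - \<Phi> t)" for s t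
    proof -
      have 1: "(- \<Phi>) s - (- \<Phi>) t = (\<lambda>x. - (u s x - u t x), \<lambda>x. - (v s x - v t x))"
        unfolding eq by (simp add: minus_prod_def fun_diff_def)
      have 2: "\<Phi> s - \<Phi> t = (\<lambda>x. u s x - u t x, \<lambda>x. v s x - v t x)"
        by (simp add: state_eq minus_prod_def fun_diff_def)
      have "L2_norm_sq (weak_deriv (\<lambda>x. - (u s x - u t x))) = L2_norm_sq (weak_deriv (\<lambda>x. u s x - u t x))"
        unfolding L2_norm_sq_def
      proof (rule nn_integral_cong_AE)
        show "AE x in lborel. ennreal ((weak_deriv (\<lambda>x. - (u s x - u t x)) x)\<^sup>2) =
            ennreal ((weak_deriv (\<lambda>x. u s x - u t x) x)\<^sup>2)"
          using weak_deriv_minus_AE[OF u_diff_primitive[of s t]] by eventually_elim (simp only: power2_minus)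
      qed
      then show ?thesis unfolding 1 2 H1_L2_norm_sq_def fst_conv snd_conv L2_norm_sq_minus by simp
    qed
    then show ?thesis using cont by (simp only: continuous_in_time_def simp_thms)
  qed
  show "solves_in_distributions (- \<Phi>)"
    unfolding solves_in_distributions_def
  proof (intro allI impI)
    fix \<psi> :: "real \<times> real \<Rightarrow> real" assume "test_function \<psi>"
    note s = sol[unfolded solves_in_distributions_def, rule_format, OF this]
    have m: "fst ((- \<Phi>) t) x = - fst (\<Phi> t) x" "snd ((- \<Phi>) t) x = - snd (\<Phi> t) x" for t x
      by simp_all
    have "- fst (\<Phi> t) x * a - deriv U (- fst (\<Phi> t) x) * b = - (fst (\<Phi> t) x * a - deriv U (fst (\<Phi> t) x) * b)"
      for t x a b by (simp add: deriv_U dU_def power3_eq_cube field_simps)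
    then show "- (LINT t|lborel. LINT x|lborel. fst ((- \<Phi>) t) x * deriv (\<lambda>s. \<psi> (s, x)) t)
          = (LINT t|lborel. LINT x|lborel. snd ((- \<Phi>) t) x * \<psi> (t, x)) \<and>
        - (LINT t|lborel. LINT x|lborel. snd ((- \<Phi>) t) x * deriv (\<lambda>s. \<psi> (s, x)) t)
          = (LINT t|lborel. LINT x|lborel.
               fst ((- \<Phi>) t) x * (deriv ^^ 2) (\<lambda>y. \<psi> (t, y)) x
               - deriv U (fst ((- \<Phi>) t) x) * \<psi> (t, x))"
      using s unfolding m by (simp only: mult_minus_left Bochner_Integration.integral_minus) 
  qed
qed

lemma L2_norm_sq_snd_minus: "L2_norm_sq (snd ((- \<Phi>) t)) = L2_norm_sq (snd (\<Phi> t))" for \<Phi> :: "real \<Rightarrow> state"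
proof -
  have "snd ((- \<Phi>) t) = (\<lambda>x. - snd (\<Phi> t) x)" by (simp add: fun_Compl_def)
  then show ?thesis by (simp only: L2_norm_sq_minus)
qed

theorem proposition1p4:
  fixes \<Phi> :: "real \<Rightarrow> state"
  assumes "solution \<Phi>"
  shows "((\<lambda>t. L2_norm_sq (snd (\<Phi> t))) \<longlongrightarrow> 0) at_top \<longleftrightarrow>
    kink_cluster \<Phi> \<or> kink_cluster (- \<Phi>)"
proof
  assume static: "((\<lambda>t. L2_norm_sq (snd (\<Phi> t))) \<longlongrightarrow> 0) at_top"
  obtain l r where \<Phi>: "kg_solution \<Phi> l r" by (rule solutionE[OF assms])
  then consider "l = 1" | "l = -1" using kg_solution.l by blast
  then show "kink_cluster \<Phi> \<or> kink_cluster (- \<Phi>)"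
  proof cases
    case 1
    then show ?thesis using kg_solution.static_imp_kink_cluster[OF \<Phi> static] by blast
  next
    case 2
    have "((\<lambda>t. L2_norm_sq (snd ((- \<Phi>) t))) \<longlongrightarrow> 0) at_top"
      using static by (simp only: L2_norm_sq_snd_minus)
    then have "kink_cluster (- \<Phi>)"
      by (rule kg_solution.static_imp_kink_cluster[OF kg_solution.kg_solution_minus[OF \<Phi>]]) (simp add: 2)
    then show ?thesis ..
  qed
next
  assume "kink_cluster \<Phi> \<or> kink_cluster (- \<Phi>)"
  then show "((\<lambda>t. L2_norm_sq (snd (\<Phi> t))) \<longlongrightarrow> 0) at_top"
  proof
    assume "kink_cluster \<Phi>"
    then show ?thesis using kink_n_cluster_imp_static unfolding kink_cluster_def by blast
  next
    assume "kink_cluster (- \<Phi>)"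
    then have "((\<lambda>t. L2_norm_sq (snd ((- \<Phi>) t))) \<longlongrightarrow> 0) at_top"
      using kink_n_cluster_imp_static unfolding kink_cluster_def by blast
    then show ?thesis by (simp only: L2_norm_sq_snd_minus)
  qed
qed

end
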